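(* Let $Z\to X\to B$ be a fiber bundle with 10-dimensional fiber $Z$, with vertical tangent bundle $TZ$ equipped with a metric $g^{TZ}$ and an associated Levi-Civita connection $\nabla^{TZ}$. Let $F_1$, $F_2$ be Euclidean vector bundles over $X$ with Euclidean connections $\nabla^{F_1}$, $\nabla^{F_2}$, and let $\xi$ be a rank two real oriented Euclidean vector bundle over $X$ with Euclidean connection $\nabla^\xi$ and Euler form $c=e(\xi,\nabla^\xi)$. If $\dim F_1-\dim F_2=32$, then the following identity of differential forms on $X$ holds: $$\begin{aligned} &\{\widehat{A}(TZ)e^{\frac{c}{2}}\mathrm{ch}(\wedge^2{F_1}_{\mathbf C})\}^{(12)}+\{\widehat{A}(TZ)e^{\frac{c}{2}}\mathrm{ch}(S^2{F_2}_{\mathbf C})\}^{(12)}-\{\widehat{A}(TZ)e^{\frac{c}{2}}\mathrm{ch}({F_1}_{\mathbf C}\otimes {F_2}_{\mathbf C})\}^{(12)}\\ &+\{\widehat{A}(TZ)e^{\frac{c}{2}}\mathrm{ch}(T_{\mathbf C} Z)\}^{(12)}-2\{\widehat{A}(TZ)e^{\frac{c}{2}}\}^{(12)}\\ &+5\{\widehat{A}(TZ)e^{\frac{c}{2}}\mathrm{ch}(\widetilde{\xi_{\mathbf C}}\otimes\widetilde{\xi_{\mathbf C}})\}^{(12)}+3\{\widehat{A}(TZ)e^{\frac{c}{2}}\mathrm{ch}((1-{F_1}_{\mathbf C}+{F_2}_{\mathbf C})\otimes\widetilde{\xi_{\mathbf C}})\}^{(12)}\\ =\;&(p_1(TZ)-p_1(F_1)+p_1(F_2))\\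 &\cdot\left\{-\frac{e^{\frac{1}{24}(p_1(TZ)-p_1(F_1)+p_1(F_2))}-1}{p_1(TZ)-p_1(F_1)+p_1(F_2)}\widehat{A}(TZ)e^{\frac{c}{2}}\mathrm{ch}(\mathfrak{C})+e^{\frac{1}{24}(p_1(TZ)-p_1(F_1)+p_1(F_2))}\widehat{A}(TZ)e^{\frac{c}{2}}\right\}^{(8)}, \end{aligned}$$ where $$\mathfrak{C}=\wedge^2{F_1}_{\mathbf C}+S^2{F_2}_{\mathbf C}-{F_1}_{\mathbf C}\otimes {F_2}_{\mathbf C}+T_{\mathbf C} Z-2+5\widetilde{\xi_{\mathbf C}}\otimes\widetilde{\xi_{\mathbf C}}+3(1-{F_1}_{\mathbf C}+{F_2}_{\mathbf C})\otimes\widetilde{\xi_{\mathbf C}}.$$ If $\xi$ is trivial, one obtains the Schwarz-Witten formula $$\begin{aligned} &\{\widehat{A}(TZ)\mathrm{ch}(\wedge^2{F_1}_{\mathbf C})\}^{(12)}+\{\widehat{A}(TZ)\mathrm{ch}(S^2{F_2}_{\mathbf C})\}^{(12)}-\{\widehat{A}(TZ)\mathrm{ch}({F_1}_{\mathbf C}\otimes {F_2}_{\mathbf C})\}^{(12)}\\ &+\{\widehat{A}(TZ)\mathrm{ch}(T_{\mathbf C} Z)\}^{(12)}-2\{\widehat{A}(TZ)\}^{(12)}\\ =\;&(p_1(TZ)-p_1(F_1)+p_1(F_2))\\ &\cdot\left\{-\frac{e^{\frac{1}{24}(p_1(TZ)-p_1(F_1)+p_1(F_2))}-1}{p_1(TZ)-p_1(F_1)+p_1(F_2)}\widehat{A}(TZ)\mathrm{ch}(\mathfrak{D})+e^{\frac{1}{24}(p_1(TZ)-p_1(F_1)+p_1(F_2))}\widehat{A}(TZ)\right\}^{(8)},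 \end{aligned}$$ where $$\mathfrak{D}=\wedge^2{F_1}_{\mathbf C}+S^2{F_2}_{\mathbf C}-{F_1}_{\mathbf C}\otimes {F_2}_{\mathbf C}+T_{\mathbf C} Z-2.$$
   Context: For a differential form $\omega$, $\omega^{(j)}$ (or $\{\omega\}^{(j)}$) is its degree-$j$ component. For a real bundle $E$, $E_{\mathbf C}$ is its complexification with the induced Hermitian connection; $T_{\mathbf C}Z$ is the complexification of $TZ$. For a real (resp. complex) bundle $E$, $\widetilde{E}=E-\dim E$ in $KO(X)$ (resp. $K(X)$). Integers in $K(X)$ denote (virtual) trivial bundles with trivial connection; tensor products, exterior powers $\wedge^2$ and symmetric powers $S^2$ carry the induced connections, and $\mathrm{ch}$ is extended additively to virtual bundles. $\widehat{A}(TZ)=\widehat{A}(TZ,\nabla^{TZ})$, $\mathrm{ch}(\cdot)$ and $p_i(\cdot)$ denote the Chern-Weil forms (Hirzebruch $\widehat{A}$-form, Chern character form, Pontryagin forms) of the given connections, connections being suppressed from notation. They are normalized so that, if the formal Chern roots of the complexification of a real bundle are $\pm y_j$ (plus possibly $0$), then $p_1=\sum_j y_j^2$, $\widehat{A}=\prod_j \frac{y_j/2}{\sinh(y_j/2)}$, $\mathrm{ch}$ is the sum of the exponentials of the roots, and the roots of $\xi_{\mathbf C}$ are $\pm c$. The quotient $\frac{e^{x/24}-1}{x}$ is understood as the power series $\sum_{k\ge 1}\frac{x^{k-1}}{24^k k!}$. *)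

theory Defs
  imports
    "HOL-Analysis.Analysis"
    "HOL-Computational_Algebra.Formal_Power_Series"
    "HOL-Library.Nat_Bijection"
    "HOL-Library.Poly_Mapping"
begin

section \<open>Smooth manifolds\<close>

text \<open>Used for open sets in finite-dimensional spaces, where requiring the directional derivatives
  in all directions to be of class \<open>C\<^sup>k\<close> is the same as requiring the derivative to be so.\<close>

primrec class_C ::
  "nat \<Rightarrow> 'a::real_normed_vector set \<Rightarrow> ('a \<Rightarrow> 'b::real_normed_vector) \<Rightarrow> bool" where
  "class_C 0 S f \<longleftrightarrow> continuous_on S f"
| "class_C (Suc k) S f \<longleftrightarrow>
     (\<forall>x\<in>S. f differentiable (at x)) \<and> (\<forall>v. class_C k S (\<lambda>x. frechet_derivative f (at x) v))"

definition smooth_on ::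
  "'a::real_normed_vector set \<Rightarrow> ('a \<Rightarrow> 'b::real_normed_vector) \<Rightarrow> bool" where
  "smooth_on S f \<longleftrightarrow> (\<forall>k. class_C k S f)"

text \<open>The model space is a finite-dimensional normed space rather than a Euclidean space, because
  types of class \<open>euclidean_space\<close> have positive dimension and the base of a fibre bundle may have
  dimension 0.\<close>

type_synonym ('x, 'm) chart = "'x set \<times> ('x \<Rightarrow> 'm)"

record ('x, 'm) mfd =
  mtop :: "'x topology"
  atlas :: "('x, 'm) chart set"

abbreviation pts :: "('x, 'm) mfd \<Rightarrow> 'x set" where
  "pts M \<equiv> topspace (mtop M)"

definition chart_inv :: "('x, 'm) chart \<Rightarrow> 'm \<Rightarrow> 'x" where
  "chart_inv c = inv_into (fst c) (snd c)"

definition smooth_manifold :: "('x, 'm::real_normed_vector) mfd \<Rightarrow> bool" where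
  "smooth_manifold M \<longleftrightarrow>
     (\<exists>b::'m set. finite b \<and> span b = UNIV) \<and>
     Hausdorff_space (mtop M) \<and> second_countable (mtop M) \<and>
     (\<Union>c\<in>atlas M. fst c) = pts M \<and>
     (\<forall>(U, \<phi>)\<in>atlas M. openin (mtop M) U \<and> open (\<phi> ` U) \<and>
        homeomorphic_map (subtopology (mtop M) U) (top_of_set (\<phi> ` U)) \<phi>) \<and>
     (\<forall>(U, \<phi>)\<in>atlas M. \<forall>(V, \<psi>)\<in>atlas M.
        smooth_on (\<phi> ` (U \<inter> V)) (\<psi> \<circ> chart_inv (U, \<phi>)))"

definition smooth_fun ::
  "('x, 'm::real_normed_vector) mfd \<Rightarrow> 'x set \<Rightarrow> ('x \<Rightarrow> real) \<Rightarrow> bool" where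
  "smooth_fun M W f \<longleftrightarrow>
     (\<forall>p\<in>W. \<exists>c\<in>atlas M. \<exists>V. openin (mtop M) V \<and> p \<in> V \<and> V \<subseteq> fst c \<inter> W \<and>
        smooth_on (snd c ` V) (f \<circ> chart_inv c))"

definition smooth_map ::
  "('x, 'm::real_normed_vector) mfd \<Rightarrow> 'x set \<Rightarrow> ('y, 'n::real_normed_vector) mfd \<Rightarrow> ('x \<Rightarrow> 'y) \<Rightarrow> bool"
  where
  "smooth_map M W N f \<longleftrightarrow>
     (\<forall>p\<in>W. \<exists>c\<in>atlas M. \<exists>d\<in>atlas N. \<exists>V. openin (mtop M) V \<and> p \<in> V \<and> V \<subseteq> fst c \<inter> W \<and>
        f ` V \<subseteq> fst d \<and> smooth_on (snd c ` V) (snd d \<circ> f \<circ> chart_inv c))"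

definition prod_mfd :: "('x, 'm) mfd \<Rightarrow> ('y, 'n) mfd \<Rightarrow> ('x \<times> 'y, 'm \<times> 'n) mfd" where
  "prod_mfd M N =
     \<lparr>mtop = prod_topology (mtop M) (mtop N),
      atlas = {(U \<times> V, map_prod \<phi> \<psi>) | U \<phi> V \<psi>. (U, \<phi>) \<in> atlas M \<and> (V, \<psi>) \<in> atlas N}\<rparr>"

text \<open>Tangent vectors: a chart around each point \<open>p\<close> is fixed once and for all, and the tangent
  space at \<open>p\<close> is identified with the model space through it. The coordinates of the same tangent
  vector in another chart are obtained from the derivative of the change of charts.\<close>

definition chart_at :: "('x, 'm) mfd \<Rightarrow> 'x \<Rightarrow> ('x, 'm) chart" where
  "chart_at M p = (SOME c. c \<in> atlas M \<and> p \<in> fst c)"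

definition tan_coord ::
  "('x, 'm::real_normed_vector) mfd \<Rightarrow> ('x, 'm) chart \<Rightarrow> 'x \<Rightarrow> 'm \<Rightarrow> 'm" where
  "tan_coord M c p v =
     frechet_derivative (snd c \<circ> chart_inv (chart_at M p)) (at (snd (chart_at M p) p)) v"

definition tan_vec ::
  "('x, 'm::real_normed_vector) mfd \<Rightarrow> ('x, 'm) chart \<Rightarrow> 'x \<Rightarrow> 'm \<Rightarrow> 'm" where
  "tan_vec M c p u = frechet_derivative (snd (chart_at M p) \<circ> chart_inv c) (at (snd c p)) u"

definition dfun ::
  "('x, 'm::real_normed_vector) mfd \<Rightarrow> ('x \<Rightarrow> real) \<Rightarrow> 'x \<Rightarrow> 'm \<Rightarrow> real" where
  "dfun M f p v = frechet_derivative (f \<circ> chart_inv (chart_at M p)) (at (snd (chart_at M p) p)) v"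

definition dmap ::
  "('x, 'm::real_normed_vector) mfd \<Rightarrow> ('y, 'n::real_normed_vector) mfd \<Rightarrow> ('x \<Rightarrow> 'y) \<Rightarrow> 'x \<Rightarrow> 'm \<Rightarrow> 'n"
  where
  "dmap M N f p v =
     frechet_derivative (snd (chart_at N (f p)) \<circ> f \<circ> chart_inv (chart_at M p))
       (at (snd (chart_at M p) p)) v"

definition vf_coord ::
  "('x, 'm::real_normed_vector) mfd \<Rightarrow> ('x, 'm) chart \<Rightarrow> ('x \<Rightarrow> 'm) \<Rightarrow> 'm \<Rightarrow> 'm" where
  "vf_coord M c Y z = tan_coord M c (chart_inv c z) (Y (chart_inv c z))"

definition smooth_vf ::
  "('x, 'm::real_normed_vector) mfd \<Rightarrow> 'x set \<Rightarrow> ('x \<Rightarrow> 'm) \<Rightarrow> bool" where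
  "smooth_vf M W Y \<longleftrightarrow>
     (\<forall>p\<in>W. \<exists>c\<in>atlas M. \<exists>V. openin (mtop M) V \<and> p \<in> V \<and> V \<subseteq> fst c \<inter> W \<and>
        smooth_on (snd c ` V) (vf_coord M c Y))"

definition lie_bracket ::
  "('x, 'm::real_normed_vector) mfd \<Rightarrow> ('x \<Rightarrow> 'm) \<Rightarrow> ('x \<Rightarrow> 'm) \<Rightarrow> 'x \<Rightarrow> 'm" where
  "lie_bracket M Y Y' p =
     (let c = chart_at M p; z = snd c p
      in frechet_derivative (vf_coord M c Y') (at z) (Y p)
         - frechet_derivative (vf_coord M c Y) (at z) (Y' p))"

definition fiber_bundle ::
  "('x, 'm::real_normed_vector) mfd \<Rightarrow> ('b, 'k::real_normed_vector) mfd \<Rightarrow>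
   ('z, 'f::real_normed_vector) mfd \<Rightarrow> ('x \<Rightarrow> 'b) \<Rightarrow> bool" where
  "fiber_bundle X B Z \<pi> \<longleftrightarrow>
     smooth_manifold X \<and> smooth_manifold B \<and> smooth_manifold Z \<and>
     \<pi> ` pts X = pts B \<and> smooth_map X (pts X) B \<pi> \<and>
     (\<forall>b\<in>pts B. \<exists>V \<Phi> \<Psi>. openin (mtop B) V \<and> b \<in> V \<and>
        smooth_map X {x \<in> pts X. \<pi> x \<in> V} (prod_mfd B Z) \<Phi> \<and>
        smooth_map (prod_mfd B Z) (V \<times> pts Z) X \<Psi> \<and>
        (\<forall>x\<in>pts X. \<pi> x \<in> V \<longrightarrow> \<Phi> x \<in> V \<times> pts Z \<and> fst (\<Phi> x) = \<pi> x \<and> \<Psi> (\<Phi> x) = x) \<and>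
        (\<forall>y\<in>V \<times> pts Z. \<Psi> y \<in> pts X \<and> \<pi> (\<Psi> y) = fst y \<and> \<Phi> (\<Psi> y) = y))"

definition mfd_dim :: "('x, 'm::real_normed_vector) mfd \<Rightarrow> nat" where
  "mfd_dim M = dim (UNIV :: 'm set)"


section \<open>Euclidean vector bundles with connection\<close>

text \<open>The fibre \<open>fib E x\<close> is a subspace of an ambient real vector space (which carries no
  topology), \<open>sec E W\<close> consists of the smooth sections over the open set \<open>W\<close> (their values
  outside \<open>W\<close> are irrelevant), \<open>inn E x\<close> is the metric and \<open>nab E x v s\<close> is the covariant
  derivative at \<open>x\<close>, in the direction \<open>v\<close>, of a section \<open>s\<close> that is smooth near \<open>x\<close>.\<close>

record ('x, 'm, 'v) rbundle =
  rk :: nat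
  fib :: "'x \<Rightarrow> 'v set"
  sec :: "'x set \<Rightarrow> ('x \<Rightarrow> 'v) set"
  inn :: "'x \<Rightarrow> 'v \<Rightarrow> 'v \<Rightarrow> real"
  nab :: "'x \<Rightarrow> 'm \<Rightarrow> ('x \<Rightarrow> 'v) \<Rightarrow> 'v"

definition orthonormal_frame ::
  "('x, 'm::real_normed_vector) mfd \<Rightarrow> ('x, 'm, 'v::real_vector) rbundle \<Rightarrow> 'x set \<Rightarrow>
   (nat \<Rightarrow> 'x \<Rightarrow> 'v) \<Rightarrow> bool" where
  "orthonormal_frame X E U e \<longleftrightarrow>
     openin (mtop X) U \<and>
     (\<forall>x\<in>U. span ((\<lambda>i. e i x) ` {..<rk E}) = fib E x \<and>
        (\<forall>i<rk E. \<forall>j<rk E. inn E x (e i x) (e j x) = (if i = j then 1 else 0))) \<and>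
     (\<forall>W s. openin (mtop X) W \<and> W \<subseteq> U \<longrightarrow>
        (s \<in> sec E W \<longleftrightarrow>
           (\<forall>x\<in>W. s x \<in> fib E x) \<and> (\<forall>i<rk E. smooth_fun X W (\<lambda>x. inn E x (s x) (e i x)))))"

text \<open>Local triviality is required in terms of orthonormal frames; by Gram--Schmidt these exist
  whenever a smooth metric is given on a locally trivial bundle.\<close>

definition euclidean_bundle ::
  "('x, 'm::real_normed_vector) mfd \<Rightarrow> ('x, 'm, 'v::real_vector) rbundle \<Rightarrow> bool" where
  "euclidean_bundle X E \<longleftrightarrow>
     (\<forall>x\<in>pts X. subspace (fib E x) \<and>
        (\<forall>u\<in>fib E x. \<forall>w\<in>fib E x. inn E x u w = inn E x w u) \<and>
        (\<forall>u\<in>fib E x. \<forall>u'\<in>fib E x. \<forall>w\<in>fib E x. \<forall>a b.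
           inn E x (a *\<^sub>R u + b *\<^sub>R u') w = a * inn E x u w + b * inn E x u' w) \<and>
        (\<forall>u\<in>fib E x. u \<noteq> 0 \<longrightarrow> inn E x u u > 0)) \<and>
     (\<forall>W s. openin (mtop X) W \<longrightarrow>
        (s \<in> sec E W \<longleftrightarrow> (\<forall>p\<in>W. \<exists>V. openin (mtop X) V \<and> p \<in> V \<and> V \<subseteq> W \<and> s \<in> sec E V))) \<and>
     (\<forall>p\<in>pts X. \<exists>U e. p \<in> U \<and> orthonormal_frame X E U e)"

definition euclidean_connection ::
  "('x, 'm::real_normed_vector) mfd \<Rightarrow> ('x, 'm, 'v::real_vector) rbundle \<Rightarrow> bool" where
  "euclidean_connection X E \<longleftrightarrow>
     (\<forall>W x s. openin (mtop X) W \<and> x \<in> W \<and> s \<in> sec E W \<longrightarrow>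
        (\<forall>v. nab E x v s \<in> fib E x) \<and>
        (\<forall>a b v w. nab E x (a *\<^sub>R v + b *\<^sub>R w) s = a *\<^sub>R nab E x v s + b *\<^sub>R nab E x w s) \<and>
        (\<forall>t\<in>sec E W. (\<forall>y\<in>W. s y = t y) \<longrightarrow> (\<forall>v. nab E x v s = nab E x v t)) \<and>
        (\<forall>t\<in>sec E W. \<forall>v. nab E x v (\<lambda>y. s y + t y) = nab E x v s + nab E x v t) \<and>
        (\<forall>f v. smooth_fun X W f \<longrightarrow>
           nab E x v (\<lambda>y. f y *\<^sub>R s y) = dfun X f x v *\<^sub>R s x + f x *\<^sub>R nab E x v s) \<and>
        (\<forall>t\<in>sec E W. \<forall>v. dfun X (\<lambda>y. inn E y (s y) (t y)) x v
           = inn E x (nab E x v s) (t x) + inn E x (s x) (nab E x v t))) \<and>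
     (\<forall>W s Y. openin (mtop X) W \<and> s \<in> sec E W \<and> smooth_vf X W Y \<longrightarrow>
        (\<lambda>x. nab E x (Y x) s) \<in> sec E W)"

definition euclidean_bundle_conn ::
  "('x, 'm::real_normed_vector) mfd \<Rightarrow> ('x, 'm, 'v::real_vector) rbundle \<Rightarrow> bool" where
  "euclidean_bundle_conn X E \<longleftrightarrow> euclidean_bundle X E \<and> euclidean_connection X E"

definition trivial_bundle ::
  "('x, 'm::real_normed_vector) mfd \<Rightarrow> ('x, 'm, 'v::real_vector) rbundle \<Rightarrow> bool" where
  "trivial_bundle X E \<longleftrightarrow>
     (\<exists>e. (\<forall>i<rk E. e i \<in> sec E (pts X)) \<and>
          (\<forall>x\<in>pts X. span ((\<lambda>i. e i x) ` {..<rk E}) = fib E x))"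

text \<open>An orientation of a Euclidean bundle of rank two, given by the set \<open>pos x\<close> of positively
  oriented orthonormal bases of each fibre: one orbit of the rotation group, varying smoothly.\<close>

definition oriented_rank2 ::
  "('x, 'm::real_normed_vector) mfd \<Rightarrow> ('x, 'm, 'v::real_vector) rbundle \<Rightarrow> ('x \<Rightarrow> ('v \<times> 'v) set) \<Rightarrow>
   bool" where
  "oriented_rank2 X E pos \<longleftrightarrow>
     rk E = 2 \<and>
     (\<forall>p\<in>pts X. \<exists>U e. p \<in> U \<and> orthonormal_frame X E U e \<and>
        (\<forall>x\<in>U. pos x = {(a *\<^sub>R e 0 x + b *\<^sub>R e 1 x, a *\<^sub>R e 1 x - b *\<^sub>R e 0 x) | a b.
           a\<^sup>2 + b\<^sup>2 = 1}))"

definition vertical_bundle ::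
  "('x, 'm::real_normed_vector) mfd \<Rightarrow> ('b, 'k::real_normed_vector) mfd \<Rightarrow>
   ('z, 'f::real_normed_vector) mfd \<Rightarrow> ('x \<Rightarrow> 'b) \<Rightarrow> ('x \<Rightarrow> 'm \<Rightarrow> 'm \<Rightarrow> real) \<Rightarrow>
   ('x \<Rightarrow> 'm \<Rightarrow> ('x \<Rightarrow> 'm) \<Rightarrow> 'm) \<Rightarrow> ('x, 'm, 'm) rbundle" where
  "vertical_bundle X B Z \<pi> g D =
     \<lparr>rk = mfd_dim Z,
      fib = (\<lambda>x. {v. dmap X B \<pi> x v = 0}),
      sec = (\<lambda>W. {Y. smooth_vf X W Y \<and> (\<forall>x\<in>W. dmap X B \<pi> x (Y x) = 0)}),
      inn = g, nab = D\<rparr>"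

text \<open>A Euclidean connection on the vertical tangent bundle is a Levi-Civita connection for the
  family if it restricts to the Levi-Civita connection of every fibre, i.e. if its torsion vanishes
  on pairs of vertical vectors.\<close>

definition levi_civita_vertical ::
  "('x, 'm::real_normed_vector) mfd \<Rightarrow> ('x, 'm, 'm) rbundle \<Rightarrow> bool" where
  "levi_civita_vertical X T \<longleftrightarrow>
     euclidean_bundle_conn X T \<and>
     (\<forall>W x Y Y'. openin (mtop X) W \<and> x \<in> W \<and> Y \<in> sec T W \<and> Y' \<in> sec T W \<longrightarrow>
        nab T x (Y x) Y' - nab T x (Y' x) Y = lie_bracket X Y Y' x)"


section \<open>The algebra of forms at a point\<close>

text \<open>A complex form of mixed degree on the vector space \<open>'v\<close> is represented by the function that
  sends a list of \<open>k\<close> vectors to the value of its degree \<open>k\<close> component on these vectors. The wedge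
  product is characterised by contraction with a vector being an antiderivation. On multilinear
  alternating functions this is the usual shuffle product; in degree one
  \<open>(\<alpha> \<and> \<beta>)(u, v) = \<alpha> u * \<beta> v - \<alpha> v * \<beta> u\<close>.\<close>

primrec wedge :: "'v list \<Rightarrow> ('v list \<Rightarrow> complex) \<Rightarrow> ('v list \<Rightarrow> complex) \<Rightarrow> complex" where
  "wedge [] \<alpha> \<beta> = \<alpha> [] * \<beta> []"
| "wedge (v # vs) \<alpha> \<beta> =
     wedge vs (\<lambda>us. \<alpha> (v # us)) \<beta>
     + wedge vs (\<lambda>us. (-1) ^ length us * \<alpha> us) (\<lambda>us. \<beta> (v # us))"

typedef 'v form = "UNIV :: ('v list \<Rightarrow> complex) set"
  morphisms form_val Form by simp

setup_lifting type_definition_form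

lemma wedge_add_left: "wedge vs (\<lambda>us. \<alpha> us + \<alpha>' us) \<beta> = wedge vs \<alpha> \<beta> + wedge vs \<alpha>' \<beta>"
  by (induction vs arbitrary: \<alpha> \<alpha>' \<beta>) (simp_all add: algebra_simps)

lemma wedge_add_right: "wedge vs \<alpha> (\<lambda>us. \<beta> us + \<beta>' us) = wedge vs \<alpha> \<beta> + wedge vs \<alpha> \<beta>'"
  by (induction vs arbitrary: \<alpha> \<beta> \<beta>') (simp_all add: algebra_simps)

lemma wedge_scale_left: "wedge vs (\<lambda>us. z * \<alpha> us) \<beta> = z * wedge vs \<alpha> \<beta>"
  by (induction vs arbitrary: \<alpha> \<beta>) (simp_all add: algebra_simps)

lemma wedge_grading:
  "(-1) ^ length vs * wedge vs \<alpha> \<beta> =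
     wedge vs (\<lambda>us. (-1) ^ length us * \<alpha> us) (\<lambda>us. (-1) ^ length us * \<beta> us)"
proof (induction vs arbitrary: \<alpha> \<beta>)
  case (Cons v vs)
  have negr: "wedge vs f (\<lambda>us. - h us) = - wedge vs f h" for f h :: "'a list \<Rightarrow> complex"
  proof -
    have "wedge vs f (\<lambda>us. - h us) + wedge vs f h = wedge vs f (\<lambda>us. - h us + h us)"
      by (simp only: wedge_add_right)
    also have "\<dots> = 0"
    proof -
      have "wedge ws f (\<lambda>us. 0) = 0" for ws and f :: "'a list \<Rightarrow> complex"
        by (induction ws arbitrary: f) simp_all
      then show ?thesis by simp
    qed
    finally show ?thesis by (simp add: eq_neg_iff_add_eq_0)
  qed
  have negl: "wedge vs (\<lambda>us. - f us) h = - wedge vs f h" for f h :: "'a list \<Rightarrow> complex"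
    using wedge_scale_left[of vs "-1" f h] by simp
  show ?case
    using Cons.IH[of "\<lambda>us. \<alpha> (v # us)" \<beta>]
      Cons.IH[of "\<lambda>us. (-1) ^ length us * \<alpha> us" "\<lambda>us. \<beta> (v # us)"]
    by (simp add: distrib_left negl negr)
qed simp

lemma wedge_assoc:
  "wedge vs (\<lambda>us. wedge us \<alpha> \<beta>) \<gamma> = wedge vs \<alpha> (\<lambda>us. wedge us \<beta> \<gamma>)"
proof (induction vs arbitrary: \<alpha> \<beta> \<gamma>)
  case (Cons v vs)
  then show ?case
    by (simp add: wedge_add_left wedge_add_right wedge_grading)
qed simp

lemma wedge_one_left: "wedge vs (\<lambda>us. if us = [] then 1 else 0) \<beta> = \<beta> vs"
proof (induction vs arbitrary: \<beta>)
  case (Cons v vs)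
  have z: "wedge ws (\<lambda>us. 0) h = 0" for ws and h :: "'a list \<Rightarrow> complex"
    by (induction ws arbitrary: h) simp_all
  have "(\<lambda>us. (-1) ^ length us * (if us = [] then 1 else 0 :: complex))
      = (\<lambda>us::'a list. if us = [] then 1 else 0)" by auto
  then show ?case using Cons by (simp add: z)
qed simp

lemma wedge_one_right: "wedge vs \<alpha> (\<lambda>us. if us = [] then 1 else 0) = \<alpha> vs"
proof (induction vs arbitrary: \<alpha>)
  case (Cons v vs)
  have z: "wedge ws h (\<lambda>us. 0) = 0" for ws and h :: "'a list \<Rightarrow> complex"
    by (induction ws arbitrary: h) simp_all
  show ?case using Cons by (simp add: z)
qed simp

instantiation form :: (type) ring_1
begin

lift_definition zero_form :: "'a form" is "\<lambda>_. 0" .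
lift_definition one_form :: "'a form" is "\<lambda>vs. if vs = [] then 1 else 0" .
lift_definition plus_form :: "'a form \<Rightarrow> 'a form \<Rightarrow> 'a form" is "\<lambda>\<alpha> \<beta> vs. \<alpha> vs + \<beta> vs" .
lift_definition minus_form :: "'a form \<Rightarrow> 'a form \<Rightarrow> 'a form" is "\<lambda>\<alpha> \<beta> vs. \<alpha> vs - \<beta> vs" .
lift_definition uminus_form :: "'a form \<Rightarrow> 'a form" is "\<lambda>\<alpha> vs. - \<alpha> vs" .
lift_definition times_form :: "'a form \<Rightarrow> 'a form \<Rightarrow> 'a form" is "\<lambda>\<alpha> \<beta> vs. wedge vs \<alpha> \<beta>" .

instance
proof
  show "(0 :: 'a form) \<noteq> 1"
    by transfer (metis zero_neq_one)
qed (transfer; simp add: fun_eq_iff wedge_assoc wedge_add_left wedge_add_right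
       wedge_one_left wedge_one_right)+

end

lift_definition const_form :: "complex \<Rightarrow> 'v form" is "\<lambda>z vs. if vs = [] then z else 0" .

definition deg_part :: "nat \<Rightarrow> 'v form \<Rightarrow> 'v form" where
  "deg_part j \<omega> = Form (\<lambda>vs. if length vs = j then form_val \<omega> vs else 0)"

text \<open>Value of a power series on a form without component of degree 0: powers of exponent larger
  than \<open>k\<close> have no component of degree \<open>k\<close>.\<close>

definition form_series :: "complex fps \<Rightarrow> 'v form \<Rightarrow> 'v form" where
  "form_series a \<omega> = Form (\<lambda>vs. \<Sum>k\<le>length vs. fps_nth a k * form_val (\<omega> ^ k) vs)"


section \<open>Complex bundles with connection and Chern--Weil forms\<close>

text \<open>A complex vector bundle with connection is presented by local trivialisations: around each
  point \<open>p\<close> there is a neighbourhood \<open>dmn E p\<close> with a frame \<open>e\<^sub>p\<close> indexed by the finite set \<open>idx E\<close>.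
  The transition functions and connection matrices are given by
  \<open>e\<^sub>q\<^sub>j(y) = (\<Sum>i. trn E p q y i j * e\<^sub>p\<^sub>i(y))\<close> and \<open>\<nabla>\<^sub>v e\<^sub>p\<^sub>j = (\<Sum>i. con E p y v i j * e\<^sub>p\<^sub>i(y))\<close>
  for a tangent vector \<open>v\<close> at \<open>y\<close>.\<close>

record ('x, 'm) cbundle =
  idx :: "nat set"
  dmn :: "'x \<Rightarrow> 'x set"
  trn :: "'x \<Rightarrow> 'x \<Rightarrow> 'x \<Rightarrow> nat \<Rightarrow> nat \<Rightarrow> complex"
  con :: "'x \<Rightarrow> 'x \<Rightarrow> 'm \<Rightarrow> nat \<Rightarrow> nat \<Rightarrow> complex"

definition frame_at ::
  "('x, 'm::real_normed_vector) mfd \<Rightarrow> ('x, 'm, 'v::real_vector) rbundle \<Rightarrow> 'x \<Rightarrow>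
   'x set \<times> (nat \<Rightarrow> 'x \<Rightarrow> 'v)" where
  "frame_at X E p = (SOME (U, e). p \<in> U \<and> orthonormal_frame X E U e)"

definition complexify ::
  "('x, 'm::real_normed_vector) mfd \<Rightarrow> ('x, 'm, 'v::real_vector) rbundle \<Rightarrow> ('x, 'm) cbundle" where
  "complexify X E =
     \<lparr>idx = {..<rk E},
      dmn = (\<lambda>p. fst (frame_at X E p)),
      trn = (\<lambda>p q y i j. of_real (inn E y (snd (frame_at X E q) j y) (snd (frame_at X E p) i y))),
      con = (\<lambda>p y v i j.
        of_real (inn E y (nab E y v (snd (frame_at X E p) j)) (snd (frame_at X E p) i y)))\<rparr>"

definition trivial_line :: "('x, 'm) mfd \<Rightarrow> ('x, 'm) cbundle" where
  "trivial_line X =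
     \<lparr>idx = {0}, dmn = (\<lambda>p. pts X), trn = (\<lambda>p q y i j. 1), con = (\<lambda>p y v i j. 0)\<rparr>"

text \<open>The frame of \<open>E \<otimes> F\<close> is \<open>e\<^sub>i \<otimes> f\<^sub>j\<close>, indexed by the code \<open>prod_encode (i, j)\<close>.\<close>

definition tensor :: "('x, 'm) cbundle \<Rightarrow> ('x, 'm) cbundle \<Rightarrow> ('x, 'm) cbundle" where
  "tensor E F =
     \<lparr>idx = prod_encode ` (idx E \<times> idx F),
      dmn = (\<lambda>p. dmn E p \<inter> dmn F p),
      trn = (\<lambda>p q y m n. let (k, l) = prod_decode m; (i, j) = prod_decode n
        in trn E p q y k i * trn F p q y l j),
      con = (\<lambda>p y v m n. let (k, l) = prod_decode m; (i, j) = prod_decode n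
        in con E p y v k i * of_bool (l = j) + of_bool (k = i) * con F p y v l j)\<rparr>"

text \<open>Quotients of \<open>E \<otimes> E\<close>: the frame consists of the products \<open>e\<^sub>k e\<^sub>l\<close> with \<open>(k, l)\<close> in \<open>J\<close>, and
  \<open>\<kappa> (k, l) (a, b)\<close> is the coefficient of \<open>e\<^sub>k e\<^sub>l\<close> in \<open>e\<^sub>a e\<^sub>b\<close>. The product rule gives
  \<open>\<nabla>(e\<^sub>i e\<^sub>j) = (\<nabla> e\<^sub>i) e\<^sub>j + e\<^sub>i (\<nabla> e\<^sub>j)\<close>.\<close>

definition square_bundle ::
  "(nat \<times> nat) set \<Rightarrow> (nat \<times> nat \<Rightarrow> nat \<times> nat \<Rightarrow> complex) \<Rightarrow> ('x, 'm) cbundle \<Rightarrow> ('x, 'm) cbundle"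
  where
  "square_bundle J \<kappa> E =
     \<lparr>idx = prod_encode ` J,
      dmn = dmn E,
      trn = (\<lambda>p q y m n. let (i, j) = prod_decode n
        in \<Sum>a\<in>idx E. \<Sum>b\<in>idx E. trn E p q y a i * trn E p q y b j * \<kappa> (prod_decode m) (a, b)),
      con = (\<lambda>p y v m n. let (i, j) = prod_decode n
        in \<Sum>a\<in>idx E. con E p y v a i * \<kappa> (prod_decode m) (a, j)
                     + con E p y v a j * \<kappa> (prod_decode m) (i, a))\<rparr>"

definition ext2 :: "('x, 'm) cbundle \<Rightarrow> ('x, 'm) cbundle" where
  "ext2 E = square_bundle {(k, l) \<in> idx E \<times> idx E. k < l}
     (\<lambda>(k, l) (a, b). if (a, b) = (k, l) then 1 else if (b, a) = (k, l) then -1 else 0) E"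

definition sym2 :: "('x, 'm) cbundle \<Rightarrow> ('x, 'm) cbundle" where
  "sym2 E = square_bundle {(k, l) \<in> idx E \<times> idx E. k \<le> l}
     (\<lambda>(k, l) (a, b). if (a, b) = (k, l) \<or> (b, a) = (k, l) then 1 else 0) E"

text \<open>Curvature at \<open>p\<close>, computed in the frame and chart fixed around \<open>p\<close>:
  \<open>R = d\<omega> + \<omega> \<and> \<omega>\<close> for the connection matrix \<open>\<omega>\<close>.\<close>

definition con_coord ::
  "('x, 'm::real_normed_vector) mfd \<Rightarrow> ('x, 'm) cbundle \<Rightarrow> 'x \<Rightarrow> nat \<Rightarrow> nat \<Rightarrow> 'm \<Rightarrow> 'm \<Rightarrow> complex"
  where
  "con_coord X E p i j u z =
     (let c = chart_at X p; y = chart_inv c z in con E p y (tan_vec X c y u) i j)"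

definition curv ::
  "('x, 'm::real_normed_vector) mfd \<Rightarrow> ('x, 'm) cbundle \<Rightarrow> 'x \<Rightarrow> nat \<Rightarrow> nat \<Rightarrow> 'm form" where
  "curv X E p i j = Form (\<lambda>vs. case vs of
       [u, v] \<Rightarrow>
         (let z = snd (chart_at X p) p
          in frechet_derivative (con_coord X E p i j v) (at z) u
             - frechet_derivative (con_coord X E p i j u) (at z) v
             + (\<Sum>k\<in>idx E. con_coord X E p i k u z * con_coord X E p k j v z
                          - con_coord X E p i k v z * con_coord X E p k j u z))
     | _ \<Rightarrow> 0)"

text \<open>The Chern roots are the formal eigenvalues of \<open>(\<i> / 2\<pi>) R\<close>.\<close>

definition chern_matrix ::
  "('x, 'm::real_normed_vector) mfd \<Rightarrow> ('x, 'm) cbundle \<Rightarrow> 'x \<Rightarrow> nat \<Rightarrow> nat \<Rightarrow> 'm form" where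
  "chern_matrix X E p i j = const_form (\<i> / (2 * of_real pi)) * curv X E p i j"

primrec mat_pow :: "nat set \<Rightarrow> (nat \<Rightarrow> nat \<Rightarrow> 'a::ring_1) \<Rightarrow> nat \<Rightarrow> nat \<Rightarrow> nat \<Rightarrow> 'a" where
  "mat_pow I A 0 = (\<lambda>i j. of_bool (i = j))"
| "mat_pow I A (Suc n) = (\<lambda>i j. \<Sum>k\<in>I. A i k * mat_pow I A n k j)"

text \<open>The trace of the power series \<open>a\<close> in the Chern matrix, i.e. the sum of the values of \<open>a\<close> at
  the Chern roots.\<close>

definition tr_series ::
  "complex fps \<Rightarrow> ('x, 'm::real_normed_vector) mfd \<Rightarrow> ('x, 'm) cbundle \<Rightarrow> 'x \<Rightarrow> 'm form" where
  "tr_series a X E p = Form (\<lambda>vs. \<Sum>k\<le>length vs. fps_nth a k *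
     form_val (\<Sum>i\<in>idx E. mat_pow (idx E) (chern_matrix X E p) k i i) vs)"

definition ch_bundle ::
  "('x, 'm::real_normed_vector) mfd \<Rightarrow> ('x, 'm) cbundle \<Rightarrow> 'x \<Rightarrow> 'm form" where
  "ch_bundle X E p = tr_series (fps_exp 1) X E p"

text \<open>The power series of \<open>(x/2) / sinh (x/2)\<close>; the roots of the complexification come in pairs of
  opposite sign, whence \<open>Ahat = exp (1/2 * tr (ln ((x/2) / sinh (x/2))))\<close>, the square root of the
  determinant.\<close>

definition ahat_fps :: "complex fps" where
  "ahat_fps = fps_X / (fps_exp (1/2) - fps_exp (- 1/2))"

definition ahat ::
  "('x, 'm::real_normed_vector) mfd \<Rightarrow> ('x, 'm, 'v::real_vector) rbundle \<Rightarrow> 'x \<Rightarrow> 'm form" where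
  "ahat X E p = form_series (fps_exp (1/2))
     (tr_series (fps_compose (fps_ln 1) (ahat_fps - 1)) X (complexify X E) p)"

definition pont1 ::
  "('x, 'm::real_normed_vector) mfd \<Rightarrow> ('x, 'm, 'v::real_vector) rbundle \<Rightarrow> 'x \<Rightarrow> 'm form" where
  "pont1 X E p = const_form (1/2) * tr_series (fps_X ^ 2) X (complexify X E) p"

text \<open>The Euler form \<open>Pf (R / 2\<pi>)\<close> of an oriented Euclidean bundle of rank two. The Pfaffian
  changes sign if the chosen orthonormal frame is negatively oriented.\<close>

definition euler2 ::
  "('x, 'm::real_normed_vector) mfd \<Rightarrow> ('x, 'm, 'v::real_vector) rbundle \<Rightarrow> ('x \<Rightarrow> ('v \<times> 'v) set) \<Rightarrow>
   'x \<Rightarrow> 'm form" where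
  "euler2 X E pos p =
     (let e = snd (frame_at X E p)
      in const_form ((if (e 0 p, e 1 p) \<in> pos p then 1 else -1) / (2 * of_real pi))
         * curv X (complexify X E) p 0 1)"


section \<open>Virtual bundles\<close>

text \<open>Virtual bundles with connection are formal integral combinations of bundles with connection.\<close>

type_synonym ('x, 'm) vbundle = "('x, 'm) cbundle \<Rightarrow>\<^sub>0 int"

definition vtrivial :: "('x, 'm) mfd \<Rightarrow> int \<Rightarrow> ('x, 'm) vbundle" where
  "vtrivial X n = frag_cmul n (frag_of (trivial_line X))"

definition vtensor :: "('x, 'm) vbundle \<Rightarrow> ('x, 'm) vbundle \<Rightarrow> ('x, 'm) vbundle"
  (infixl "\<otimes>\<^sub>v" 70) where
  "V \<otimes>\<^sub>v W = frag_extend (\<lambda>E. frag_extend (\<lambda>F. frag_of (tensor E F)) W) V"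

definition vreduced :: "('x, 'm) mfd \<Rightarrow> ('x, 'm) cbundle \<Rightarrow> ('x, 'm) vbundle" where
  "vreduced X E = frag_of E - vtrivial X (int (card (idx E)))"

definition ch ::
  "('x, 'm::real_normed_vector) mfd \<Rightarrow> ('x, 'm) vbundle \<Rightarrow> 'x \<Rightarrow> 'm form" where
  "ch X V p = (\<Sum>E\<in>Poly_Mapping.keys V. of_int (Poly_Mapping.lookup V E) * ch_bundle X E p)"

end

theory Submission
  imports Defs
begin

text \<open>With \<open>C\<close> the virtual bundle of the statement, the claim says that the degree 12 component of
  \<open>exp (p/24) Ahat (TZ) exp (c/2) (ch C - p)\<close> vanishes. Since \<open>\<wedge>\<^sup>2F\<^sub>1 + S\<^sup>2F\<^sub>2 - F\<^sub>1 \<otimes> F\<^sub>2\<close> has the Chern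
  character of \<open>\<wedge>\<^sup>2(F\<^sub>1 - F\<^sub>2)\<close>, this is a polynomial identity in \<open>c\<close> and the power sums of the Chern
  roots of \<open>TZ\<close> and \<open>F\<^sub>1 - F\<^sub>2\<close>, i.e. in traces of powers of curvature matrices. It holds in any
  commutative ring, and even forms commute. Odd traces vanish because the curvature is skew in an
  orthonormal frame, so every other factor lives in degrees divisible by 4 and only the even part
  of \<open>exp (c/2)\<close> contributes. For trivial \<open>\<xi>\<close> the identity is the specialisation \<open>c = 0\<close>.\<close>

section \<open>The algebra of even forms\<close>

unbundle no vec_syntax and fps_syntax

text \<open>Each number in the statement is forced by one monomial of the polynomial identity. The
  sixth power sum of the Chern roots of a virtual bundle F enters the Chern character of its
  exterior square with a factor proportional to rank F - 32, hence the rank 32. The exterior square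
  then has rank 496, and 496 + 10 - 2 = 504 is what lets the sixth power sum of TZ cancel between
  its Chern character and its \<open>ahat\<close> form. The monomial formed by c^2 and the fourth
  power sum of TZ forces the coefficient 3, after which c^6 forces 5. The obstacle is formal. Forms
  are arbitrary functions on lists with a noncommutative product, while the identity lives in a
  commutative ring. Hence the passage to a subtype of even elements and, to separate degrees, to
  power series over it whose coefficient n holds degree 2n, so that coefficient 6 is the one to
  compute. Power sums are rescaled to make all constants integers, so the identity is checked by
  ring normalisation without fractions. The division by p is avoided as well: exp (p/24) = 1 + p
  \<open>quot\<close> replaces it.\<close>

lemma wedge_zero_left [simp]: "wedge vs (\<lambda>us. 0) \<beta> = 0"
  by (induction vs arbitrary: \<beta>) simp_all

lemma wedge_zero_right [simp]: "wedge vs \<alpha> (\<lambda>us. 0) = 0"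
  by (induction vs arbitrary: \<alpha>) simp_all

lemma wedge_minus_left: "wedge vs (\<lambda>us. - \<alpha> us) \<beta> = - wedge vs \<alpha> \<beta>"
  using wedge_scale_left[of vs "-1" \<alpha> \<beta>] by simp

text \<open>Swapping the two blocks of a shuffle multiplies its sign by \<open>-1\<close> to the product of their
  lengths; this makes sense for arbitrary functions on lists.\<close>

lemma wedge_graded_commute:
  shows "(\<And>us. odd (length us) \<Longrightarrow> \<alpha> us = 0) \<Longrightarrow> wedge vs \<alpha> \<beta> = wedge vs \<beta> \<alpha>"
    and "(\<And>us. even (length us) \<Longrightarrow> \<alpha> us = 0) \<Longrightarrow>
      wedge vs \<alpha> \<beta> = wedge vs (\<lambda>us. (-1) ^ length us * \<beta> us) \<alpha>"
\<comment> \<open>Both parities need one induction: contraction with the head vector makes an even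
  \<open>\<alpha>\<close> odd and an odd one even.\<close>
proof (induction vs arbitrary: \<alpha> \<beta>)
  case Nil
  case 1 then show ?case by simp
next
  case Nil
  case 2 then show ?case by simp
next
  case (Cons v vs)
  case 1
  have "(\<lambda>us. (-1) ^ length us * \<alpha> us) = \<alpha>"
    using 1 by (auto simp: fun_eq_iff) (metis mult_eq_0_iff neg_one_even_power mult_1)
  then show ?case
    using Cons.IH(1)[of \<alpha> "\<lambda>us. \<beta> (v # us)"] Cons.IH(2)[of "\<lambda>us. \<alpha> (v # us)" \<beta>] 1
    by simp
next
  case (Cons v vs)
  case 2
  have gr: "(\<lambda>us. (-1) ^ length us * \<alpha> us) = (\<lambda>us. - \<alpha> us)"
    using 2 by (auto simp: fun_eq_iff) (metis minus_zero mult_eq_0_iff neg_one_odd_power mult_minus1)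
  have "wedge (v # vs) \<alpha> \<beta> = wedge vs (\<lambda>us. \<alpha> (v # us)) \<beta> - wedge vs \<alpha> (\<lambda>us. \<beta> (v # us))"
    by (simp add: gr wedge_minus_left)
  also have "wedge vs (\<lambda>us. \<alpha> (v # us)) \<beta> = wedge vs \<beta> (\<lambda>us. \<alpha> (v # us))"
    by (rule Cons.IH(1)) (use 2 in simp)
  also have "wedge vs \<alpha> (\<lambda>us. \<beta> (v # us)) = wedge vs (\<lambda>us. (-1) ^ length us * \<beta> (v # us)) \<alpha>"
    by (rule Cons.IH(2)) (use 2 in simp)
  finally show ?case
    by (simp add: wedge_minus_left flip: mult.assoc power_add mult_2)
qed

text \<open>A shuffle distributes the arguments over two complementary blocks, so only pairs of
  components whose degrees add up to the number of arguments contribute. The graded product formula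
  \<open>deg_part_times\<close> rests on this.\<close>

lemma wedge_components:
  "wedge vs \<alpha> \<beta> = (\<Sum>i\<le>length vs. wedge vs (\<lambda>us. if length us = i then \<alpha> us else 0)
     (\<lambda>us. if length us = length vs - i then \<beta> us else 0))"
proof (induction vs arbitrary: \<alpha> \<beta>)
  case (Cons v vs)
  let ?r = "\<lambda>i \<alpha> us. if length us = i then \<alpha> us else (0::complex)"
  let ?n = "length vs"
  have 1: "(\<lambda>us. ?r i \<alpha> (v # us)) = (case i of 0 \<Rightarrow> \<lambda>_. 0 | Suc k \<Rightarrow> ?r k (\<lambda>us. \<alpha> (v # us)))" for i \<alpha>
    by (auto simp: fun_eq_iff split: nat.split)
  have 2: "(\<lambda>us. (-1) ^ length us * ?r i \<alpha> us) = ?r i (\<lambda>us. (-1) ^ length us * \<alpha> us)" for i \<alpha>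
    by (auto simp: fun_eq_iff)
  have "(\<Sum>i\<le>Suc ?n. wedge (v # vs) (?r i \<alpha>) (?r (Suc ?n - i) \<beta>))
    = (\<Sum>i\<le>Suc ?n. wedge vs (case i of 0 \<Rightarrow> \<lambda>_. 0 | Suc k \<Rightarrow> ?r k (\<lambda>us. \<alpha> (v # us))) (?r (Suc ?n - i) \<beta>))
    + (\<Sum>i\<le>Suc ?n. wedge vs (?r i (\<lambda>us. (-1) ^ length us * \<alpha> us))
         (case Suc ?n - i of 0 \<Rightarrow> \<lambda>_. 0 | Suc k \<Rightarrow> ?r k (\<lambda>us. \<beta> (v # us))))"
    by (simp only: wedge.simps 1 2 sum.distrib)
  also have "(\<Sum>i\<le>Suc ?n. wedge vs (case i of 0 \<Rightarrow> \<lambda>_. 0 | Suc k \<Rightarrow> ?r k (\<lambda>us. \<alpha> (v # us))) (?r (Suc ?n - i) \<beta>))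
     = wedge vs (\<lambda>us. \<alpha> (v # us)) \<beta>"
    by (subst sum.atMost_Suc_shift) (simp add: Cons.IH[of "\<lambda>us. \<alpha> (v # us)" \<beta>])
  also have "(\<Sum>i\<le>Suc ?n. wedge vs (?r i (\<lambda>us. (-1) ^ length us * \<alpha> us))
         (case Suc ?n - i of 0 \<Rightarrow> \<lambda>_. 0 | Suc k \<Rightarrow> ?r k (\<lambda>us. \<beta> (v # us))))
     = wedge vs (\<lambda>us. (-1) ^ length us * \<alpha> us) (\<lambda>us. \<beta> (v # us))"
    by (simp add: Cons.IH[of "\<lambda>us. (-1) ^ length us * \<alpha> us" "\<lambda>us. \<beta> (v # us)"] Suc_diff_le
          cong: sum.cong_simp)
  finally show ?case by simp
qed simp

lemma form_eqI: "(\<And>vs. form_val \<alpha> vs = form_val \<beta> vs) \<Longrightarrow> \<alpha> = \<beta>"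
  by (metis form_val_inject ext)

lemma form_val_simps [simp]:
  "form_val 0 vs = 0" "form_val (\<alpha> + \<beta>) vs = form_val \<alpha> vs + form_val \<beta> vs"
  "form_val (\<alpha> - \<beta>) vs = form_val \<alpha> vs - form_val \<beta> vs" "form_val (- \<alpha>) vs = - form_val \<alpha> vs"
  "form_val 1 vs = (if vs = [] then 1 else 0)" "form_val (const_form z) vs = (if vs = [] then z else 0)"
  by (transfer; simp)+

lemma form_val_Form [simp]: "form_val (Form f) = f"
  by (simp add: Form_inverse)

lemma form_val_times: "form_val (\<alpha> * \<beta>) vs = wedge vs (form_val \<alpha>) (form_val \<beta>)"
  by transfer simp

lemma form_val_sum: "form_val (\<Sum>i\<in>I. f i) vs = (\<Sum>i\<in>I. form_val (f i) vs)"
  by (induction I rule: infinite_finite_induct) auto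

lemma form_val_deg_part: "form_val (deg_part j \<omega>) vs = (if length vs = j then form_val \<omega> vs else 0)"
  by (simp add: deg_part_def)

lemma const_form_times: "form_val (const_form z * \<omega>) vs = z * form_val \<omega> vs"
proof -
  have "form_val (const_form z * \<omega>) vs = wedge vs (\<lambda>us. z * (if us = [] then 1 else 0)) (form_val \<omega>)"
    by (simp add: form_val_times const_form.rep_eq if_distrib cong: if_cong)
  then show ?thesis by (simp only: wedge_scale_left wedge_one_left)
qed

lemma deg_part_add: "deg_part j (\<alpha> + \<beta>) = deg_part j \<alpha> + deg_part j \<beta>"
  by (rule form_eqI) (simp add: form_val_deg_part)

lemma deg_part_uminus: "deg_part j (- \<alpha>) = - deg_part j \<alpha>"
  by (rule form_eqI) (simp add: form_val_deg_part)

lemma deg_part_diff: "deg_part j (\<alpha> - \<beta>) = deg_part j \<alpha> - deg_part j \<beta>"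
  by (rule form_eqI) (simp add: form_val_deg_part)

lemma deg_part_times: "deg_part n (\<alpha> * \<beta>) = (\<Sum>i\<le>n. deg_part i \<alpha> * deg_part (n - i) \<beta>)"
proof (rule form_eqI)
  fix vs
  have *: "wedge vs (form_val (deg_part i \<alpha>)) (form_val (deg_part (n - i) \<beta>)) = 0"
    if "length vs \<noteq> n" "i \<le> n" for i
  proof (subst wedge_components, rule sum.neutral, rule ballI)
    fix k assume "k \<in> {..length vs}"
    show "wedge vs (\<lambda>us. if length us = k then form_val (deg_part i \<alpha>) us else 0)
        (\<lambda>us. if length us = length vs - k then form_val (deg_part (n - i) \<beta>) us else 0) = 0"
    proof (cases "k = i")
      case True
      then have "(\<lambda>us. if length us = length vs - k then form_val (deg_part (n - i) \<beta>) us else 0)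
          = (\<lambda>us. 0)"
        using that \<open>k \<in> _\<close> by (auto simp: fun_eq_iff form_val_deg_part)
      then show ?thesis by simp
    next
      case False
      then have "(\<lambda>us. if length us = k then form_val (deg_part i \<alpha>) us else 0) = (\<lambda>us. 0)"
        by (auto simp: fun_eq_iff form_val_deg_part)
      then show ?thesis by simp
    qed
  qed
  show "form_val (deg_part n (\<alpha> * \<beta>)) vs = form_val (\<Sum>i\<le>n. deg_part i \<alpha> * deg_part (n - i) \<beta>) vs"
  proof (cases "length vs = n")
    case True
    then show ?thesis
      by (subst form_val_deg_part) (simp add: form_val_times form_val_sum,
        subst wedge_components, simp add: deg_part_def)
  next
    case False
    then show ?thesis by (simp add: form_val_deg_part form_val_sum form_val_times *)
  qed
qed

lemma const_form_hom:
  "const_form (a + b) = const_form a + const_form b"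
  "const_form (a - b) = const_form a - const_form b"
  "const_form (- a) = - const_form a"
  "const_form (a * b) = const_form a * const_form b"
  "const_form 0 = 0" "const_form 1 = 1"
  by (rule form_eqI; simp add: const_form_times)+

section \<open>The commutative ring of even forms\<close>

definition even_form :: "'v form \<Rightarrow> bool" where
  "even_form \<omega> \<longleftrightarrow> (\<forall>vs. odd (length vs) \<longrightarrow> form_val \<omega> vs = 0)"

lemma even_form_intros:
  "even_form 0" "even_form 1" "even_form (const_form z)"
  "even_form \<alpha> \<Longrightarrow> even_form (- \<alpha>)"
  "even_form \<alpha> \<Longrightarrow> even_form \<beta> \<Longrightarrow> even_form (\<alpha> + \<beta>)"
  "even_form \<alpha> \<Longrightarrow> even_form \<beta> \<Longrightarrow> even_form (\<alpha> - \<beta>)"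
  by (auto simp: even_form_def)

text \<open>The sign \<open>(-1) ^ length us\<close> defines an automorphism of the product
  (\<open>wedge_grading\<close>) that fixes even forms. On a list of odd length the product
  therefore equals its own negative.\<close>

lemma even_form_times:
  assumes "even_form \<alpha>" "even_form \<beta>"
  shows "even_form (\<alpha> * \<beta>)"
  unfolding even_form_def
proof (intro allI impI)
  fix vs :: "'a list" assume "odd (length vs)"
  have "- wedge vs (form_val \<alpha>) (form_val \<beta>)
    = wedge vs (\<lambda>us. (-1) ^ length us * form_val \<alpha> us) (\<lambda>us. (-1) ^ length us * form_val \<beta> us)"
    using \<open>odd _\<close> by (simp flip: wedge_grading)
  also have "(\<lambda>us. (-1) ^ length us * form_val \<alpha> us) = form_val \<alpha>"
    using assms(1) by (auto simp: even_form_def fun_eq_iff minus_one_power_iff)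
  also have "(\<lambda>us. (-1) ^ length us * form_val \<beta> us) = form_val \<beta>"
    using assms(2) by (auto simp: even_form_def fun_eq_iff minus_one_power_iff)
  finally show "form_val (\<alpha> * \<beta>) vs = 0"
    by (simp add: form_val_times eq_neg_iff_add_eq_0 neg_eq_iff_add_eq_0)
qed

lemma even_form_power: "even_form \<alpha> \<Longrightarrow> even_form (\<alpha> ^ n)"
  by (induction n) (simp_all add: even_form_intros even_form_times)

lemma even_form_of_int: "even_form (of_int n :: 'v form)"
proof -
  have "even_form (of_nat m :: 'v form)" for m
    by (induction m) (simp_all add: even_form_intros)
  then show ?thesis
    by (cases n rule: int_cases2) (simp_all add: even_form_intros)
qed

lemma even_form_sum: "(\<And>i. i \<in> I \<Longrightarrow> even_form (f i)) \<Longrightarrow> even_form (\<Sum>i\<in>I. f i)"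
  by (induction I rule: infinite_finite_induct) (simp_all add: even_form_intros)

lemma even_form_commute: "even_form \<alpha> \<Longrightarrow> \<alpha> * \<beta> = \<beta> * \<alpha>"
  by (rule form_eqI, unfold form_val_times, rule wedge_graded_commute(1)) (simp add: even_form_def)

text \<open>A separate type is what provides a \<open>comm_ring_1\<close> instance, and with it ring
  normalisation, matrices and power series over a commutative ring.\<close>

typedef 'v eform = "{\<omega> :: 'v form. even_form \<omega>}"
  morphisms Rep Even
  using even_form_intros(1) by blast

setup_lifting type_definition_eform

instantiation eform :: (type) comm_ring_1
begin

lift_definition zero_eform :: "'a eform" is 0 by (rule even_form_intros)
lift_definition one_eform :: "'a eform" is 1 by (rule even_form_intros)
lift_definition plus_eform :: "'a eform \<Rightarrow> 'a eform \<Rightarrow> 'a eform" is "(+)" by (rule even_form_intros)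
lift_definition minus_eform :: "'a eform \<Rightarrow> 'a eform \<Rightarrow> 'a eform" is "(-)" by (rule even_form_intros)
lift_definition uminus_eform :: "'a eform \<Rightarrow> 'a eform" is uminus by (rule even_form_intros)
lift_definition times_eform :: "'a eform \<Rightarrow> 'a eform \<Rightarrow> 'a eform" is "(*)" by (rule even_form_times)

instance
  by standard (transfer; simp add: algebra_simps even_form_commute)+

end

lift_definition econst :: "complex \<Rightarrow> 'v eform" is const_form by (rule even_form_intros)

lemma econst_hom:
  "econst (a + b) = econst a + econst b"
  "econst (a - b) = econst a - econst b"
  "econst (- a) = - econst a"
  "econst (a * b) = econst a * econst b"
  "econst 0 = 0" "econst 1 = 1"
  by (transfer; simp add: const_form_hom)+

lemma econst_of_nat: "econst (of_nat n) = of_nat n"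
  by (induction n) (simp_all add: econst_hom)

lemma econst_numeral: "econst (numeral n) = numeral n"
  using econst_of_nat[of "numeral n"] by simp

lemma econst_power: "econst (a ^ n) = econst a ^ n"
  by (induction n) (simp_all add: econst_hom)

lemma Rep_sum: "Rep (\<Sum>i\<in>I. f i) = (\<Sum>i\<in>I. Rep (f i))"
  by (induction I rule: infinite_finite_induct) (simp_all add: zero_eform.rep_eq plus_eform.rep_eq)

lemma even_form_deg_part: "even_form (deg_part (2 * n) \<omega>)"
  by (auto simp: even_form_def form_val_deg_part)

text \<open>A form becomes the series of its components of degree \<open>2 * n\<close>; this turns products of even forms
  into products of power series over a commutative ring.\<close>

definition even_series :: "'v form \<Rightarrow> 'v eform fps" where
  "even_series \<omega> = Abs_fps (\<lambda>n. Even (deg_part (2 * n) \<omega>))"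

lemma Rep_even_series: "Rep (even_series \<omega> $ n) = deg_part (2 * n) \<omega>"
  by (simp add: even_series_def Even_inverse even_form_deg_part)

lemma even_series_eqI: "(\<And>n. deg_part (2 * n) \<omega> = Rep (F $ n)) \<Longrightarrow> even_series \<omega> = F"
  by (rule fps_ext) (metis Rep_even_series Rep_inject)

lemma even_series_add: "even_series (\<alpha> + \<beta>) = even_series \<alpha> + even_series \<beta>"
  by (rule even_series_eqI) (simp add: plus_eform.rep_eq Rep_even_series deg_part_add)

lemma even_series_diff: "even_series (\<alpha> - \<beta>) = even_series \<alpha> - even_series \<beta>"
  by (rule even_series_eqI) (simp add: minus_eform.rep_eq Rep_even_series deg_part_diff)

lemma even_series_uminus: "even_series (- \<alpha>) = - even_series \<alpha>"
  by (rule even_series_eqI) (simp add: uminus_eform.rep_eq Rep_even_series deg_part_uminus)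

lemma even_series_const: "even_series (const_form z) = fps_const (econst z)"
proof (rule even_series_eqI, rule form_eqI)
  fix n and vs :: "'a list"
  show "form_val (deg_part (2 * n) (const_form z)) vs = form_val (Rep (fps_const (econst z) $ n)) vs"
    by (auto simp: econst.rep_eq zero_eform.rep_eq form_val_deg_part)
qed

lemma even_series_0: "even_series 0 = 0"
  using even_series_const[of 0] by (simp add: const_form_hom econst_hom)

lemma even_series_1: "even_series 1 = 1"
  using even_series_const[of 1] by (simp add: const_form_hom econst_hom)

text \<open>In an even total degree an odd component of \<open>\<beta>\<close> could only meet an
  odd component of \<open>\<alpha>\<close>, and those are 0. Chern characters of virtual bundles can
  thus stand on the right with no argument about their parity.\<close>

lemma even_series_times:
  assumes "even_form \<alpha>"
  shows "even_series (\<alpha> * \<beta>) = even_series \<alpha> * even_series \<beta>"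
proof (rule even_series_eqI)
  fix n
  have z: "deg_part i \<alpha> = 0" if "odd i" for i
    using assms that by (intro form_eqI) (auto simp: form_val_deg_part even_form_def)
  have "deg_part (2 * n) (\<alpha> * \<beta>) = (\<Sum>i\<le>2 * n. deg_part i \<alpha> * deg_part (2 * n - i) \<beta>)"
    by (rule deg_part_times)
  also have "\<dots> = (\<Sum>i\<in>(*) 2 ` {..n}. deg_part i \<alpha> * deg_part (2 * n - i) \<beta>)"
    by (rule sum.mono_neutral_right) (auto, metis z mult_zero_left image_eqI atMost_iff
      evenE mult_le_cancel1 zero_less_numeral)
  also have "\<dots> = (\<Sum>i\<le>n. deg_part (2 * i) \<alpha> * deg_part (2 * n - 2 * i) \<beta>)"
    by (simp add: sum.reindex inj_on_def)
  also have "\<dots> = (\<Sum>i\<le>n. Rep (even_series \<alpha> $ i) * Rep (even_series \<beta> $ (n - i)))"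
    by (simp add: Rep_even_series right_diff_distrib')
  finally show "deg_part (2 * n) (\<alpha> * \<beta>) = Rep ((even_series \<alpha> * even_series \<beta>) $ n)"
    by (simp add: fps_mult_nth Rep_sum times_eform.rep_eq atMost_atLeast0)
qed

lemma even_series_power: "even_form \<alpha> \<Longrightarrow> even_series (\<alpha> ^ n) = even_series \<alpha> ^ n"
  by (induction n) (simp_all add: even_series_1 even_series_times)

lemma even_series_sum: "even_series (\<Sum>i\<in>I. f i) = (\<Sum>i\<in>I. even_series (f i))"
  by (induction I rule: infinite_finite_induct) (simp_all add: even_series_0 even_series_add)

lemma even_series_of_int: "even_series (of_int n :: 'v form) = of_int n"
proof -
  have "even_series (of_nat m :: 'v form) = of_nat m" for m
    by (induction m) (simp_all add: even_series_0 even_series_1 even_series_add)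
  then show ?thesis
    by (cases n rule: int_cases2) (simp_all add: even_series_uminus)
qed

lemma even_series_deg_part_even:
  "even_series (deg_part (2 * n) \<omega>) = fps_const (even_series \<omega> $ n) * fps_X ^ n"
proof (rule even_series_eqI, rule form_eqI)
  fix k and vs :: "'a list"
  show "form_val (deg_part (2 * k) (deg_part (2 * n) \<omega>)) vs =
      form_val (Rep ((fps_const (even_series \<omega> $ n) * fps_X ^ n) $ k)) vs"
    by (auto simp: form_val_deg_part Rep_even_series zero_eform.rep_eq)
qed

lemma even_form_eqI:
  assumes "even_form \<alpha>" "even_form \<beta>" "even_series \<alpha> = even_series \<beta>"
  shows "\<alpha> = \<beta>"
proof (rule form_eqI)
  fix vs
  show "form_val \<alpha> vs = form_val \<beta> vs"
  proof (cases "odd (length vs)")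
    case True then show ?thesis using assms by (simp add: even_form_def)
  next
    case False
    then obtain n where n: "length vs = 2 * n" by (auto elim: evenE)
    have "deg_part (2 * n) \<alpha> = deg_part (2 * n) \<beta>"
      using assms(3) by (metis Rep_even_series)
    from arg_cong[OF this, of "\<lambda>\<omega>. form_val \<omega> vs"] n show ?thesis
      by (simp add: form_val_deg_part)
  qed
qed

lemma even_form_series: "even_form \<omega> \<Longrightarrow> even_form (form_series a \<omega>)"
  unfolding even_form_def form_series_def
  using even_form_power[of \<omega>] by (auto simp: even_form_def)

lemma fps_power_nth_zero_below:
  fixes F :: "'a::comm_ring_1 fps"
  assumes "F $ 0 = 0" "n < k"
  shows "F ^ k $ n = 0"
  using assms by (metis startsby_zero_power_prefix)

text \<open>\<open>form_series\<close> cuts off at the number of arguments, which is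
  \<open>2 * n\<close> in degree \<open>2 * n\<close>. As the series has no constant term, its
  powers beyond \<open>n\<close> do not reach coefficient \<open>n\<close>.\<close>

lemma even_series_form_series:
  assumes "even_form \<omega>" "even_series \<omega> $ 0 = 0"
  shows "even_series (form_series a \<omega>) $ n = (\<Sum>k\<le>n. econst (a $ k) * (even_series \<omega> ^ k) $ n)"
proof -
  have "deg_part (2 * n) (form_series a \<omega>) = (\<Sum>k\<le>2 * n. const_form (a $ k) * deg_part (2 * n) (\<omega> ^ k))"
    by (rule form_eqI) (auto simp: form_val_deg_part form_series_def form_val_sum const_form_times)
  also have "\<dots> = Rep (\<Sum>k\<le>2 * n. econst (a $ k) * (even_series \<omega> ^ k) $ n)"
    using assms(1) by (simp add: Rep_sum times_eform.rep_eq econst.rep_eq Rep_even_series flip: even_series_power)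
  also have "(\<Sum>k\<le>2 * n. econst (a $ k) * (even_series \<omega> ^ k) $ n) = (\<Sum>k\<le>n. econst (a $ k) * (even_series \<omega> ^ k) $ n)"
    by (rule sum.mono_neutral_right) (auto simp: fps_power_nth_zero_below assms(2))
  finally show ?thesis by (metis Rep_even_series Rep_inject)
qed

section \<open>Traces of powers of matrices\<close>

definition pow_trace :: "nat set \<Rightarrow> (nat \<Rightarrow> nat \<Rightarrow> 'a::ring_1) \<Rightarrow> nat \<Rightarrow> 'a" where
  "pow_trace I A n = (\<Sum>i\<in>I. mat_pow I A n i i)"

lemma mat_pow_Suc_right:
  assumes "finite I" "i \<in> I" "j \<in> I"
  shows "mat_pow I A (Suc n) i j = (\<Sum>k\<in>I. mat_pow I A n i k * A k j)"
  using assms(2)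
proof (induction n arbitrary: i)
  case 0
  then show ?case using assms(1,3) by simp
next
  case (Suc n)
  have "mat_pow I A (Suc (Suc n)) i j = (\<Sum>l\<in>I. A i l * mat_pow I A (Suc n) l j)"
    by simp
  also have "\<dots> = (\<Sum>l\<in>I. A i l * (\<Sum>k\<in>I. mat_pow I A n l k * A k j))"
    by (intro sum.cong refl arg_cong[where f = "(*) _"] Suc.IH)
  also have "\<dots> = (\<Sum>k\<in>I. \<Sum>l\<in>I. A i l * mat_pow I A n l k * A k j)"
    by (simp add: sum_distrib_left mult.assoc) (rule sum.swap)
  finally show ?case by (simp add: sum_distrib_right)
qed

lemma mat_pow_skew:
  fixes A :: "nat \<Rightarrow> nat \<Rightarrow> 'a::comm_ring_1"
  assumes "finite I" and skew: "\<And>i j. i \<in> I \<Longrightarrow> j \<in> I \<Longrightarrow> A j i = - A i j"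
  shows "i \<in> I \<Longrightarrow> j \<in> I \<Longrightarrow> mat_pow I A n j i = (-1) ^ n * mat_pow I A n i j"
proof (induction n arbitrary: i j)
  case (Suc n)
  have "mat_pow I A (Suc n) j i = (\<Sum>k\<in>I. A j k * mat_pow I A n k i)"
    by simp
  also have "\<dots> = (\<Sum>k\<in>I. - A k j * ((-1) ^ n * mat_pow I A n i k))"
    by (intro sum.cong refl arg_cong2[where f = "(*)"] skew Suc.IH Suc.prems)
  also have "\<dots> = (-1) ^ Suc n * (\<Sum>k\<in>I. mat_pow I A n i k * A k j)"
    by (simp add: sum_distrib_left sum_negf mult.commute mult.left_commute)
  finally show ?case using Suc.prems assms(1) by (simp only: mat_pow_Suc_right)
qed simp

text \<open>Transposition preserves the trace and multiplies an odd power of a skew matrix by -1.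
  The factor 2 stays because the ring may have 2-torsion; \<open>eform_cancel_2\<close> removes it
  for even forms.\<close>

lemma pow_trace_skew_odd:
  fixes A :: "nat \<Rightarrow> nat \<Rightarrow> 'a::comm_ring_1"
  assumes "finite I" "\<And>i j. i \<in> I \<Longrightarrow> j \<in> I \<Longrightarrow> A j i = - A i j" "odd n"
  shows "2 * pow_trace I A n = 0"
proof -
  have "pow_trace I A n = - pow_trace I A n"
    unfolding pow_trace_def sum_negf[symmetric]
    by (intro sum.cong refl, subst mat_pow_skew[OF assms(1,2)]) (use assms(3) in auto)
  then show ?thesis by (metis mult_2 add.right_inverse)
qed

text \<open>Pascal's rule as the inductive step of the binomial theorem for two commuting operators:
  \<open>f r s\<close> is the term with \<open>r\<close> factors of the first and \<open>s\<close>
  of the second.\<close>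

lemma binomial_sum_Suc:
  fixes f :: "nat \<Rightarrow> nat \<Rightarrow> 'a::comm_ring_1"
  shows "(\<Sum>r\<le>Suc n. of_nat (Suc n choose r) * f r (Suc n - r))
    = (\<Sum>r\<le>n. of_nat (n choose r) * (f (Suc r) (n - r) + f r (Suc (n - r))))"
proof -
  have "(\<Sum>r\<le>Suc n. of_nat (Suc n choose r) * f r (Suc n - r))
    = f 0 (Suc n) + (\<Sum>r\<le>n. of_nat (n choose Suc r) * f (Suc r) (n - r))
      + (\<Sum>r\<le>n. of_nat (n choose r) * f (Suc r) (n - r))"
    by (subst sum.atMost_Suc_shift) (simp add: algebra_simps sum.distrib)
  also have "f 0 (Suc n) + (\<Sum>r\<le>n. of_nat (n choose Suc r) * f (Suc r) (n - r))
    = (\<Sum>r\<le>Suc n. of_nat (n choose r) * f r (Suc n - r))"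
    by (simp add: sum.atMost_Suc_shift binomial_eq_0 del: sum.atMost_Suc)
  also have "\<dots> = (\<Sum>r\<le>n. of_nat (n choose r) * f r (Suc (n - r)))"
    by (simp add: Suc_diff_le binomial_eq_0)
  finally show ?thesis by (simp add: algebra_simps sum.distrib)
qed

section \<open>Powers of derivations on tensor products\<close>

lemma sum_prod_encode:
  "(\<Sum>m\<in>prod_encode ` S. f m) = (\<Sum>q\<in>S. f (prod_encode q))"
  by (simp add: sum.reindex inj_prod_encode)

text \<open>The Kronecker sum of \<open>A\<close> and \<open>B\<close> in the index code of
  \<open>tensor\<close>; connection and curvature of a tensor product both have this shape.\<close>

definition tensor_mat ::
  "(nat \<Rightarrow> nat \<Rightarrow> 'a::ring_1) \<Rightarrow> (nat \<Rightarrow> nat \<Rightarrow> 'a) \<Rightarrow> nat \<Rightarrow> nat \<Rightarrow> 'a" where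
  "tensor_mat A B m n = (let (k, l) = prod_decode m; (i, j) = prod_decode n
     in A k i * of_bool (l = j) + of_bool (k = i) * B l j)"

lemma tensor_mat_encode [simp]:
  "tensor_mat A B (prod_encode (k, l)) (prod_encode (i, j))
    = A k i * of_bool (l = j) + of_bool (k = i) * B l j"
  by (simp add: tensor_mat_def)

text \<open>The two summands of the Kronecker sum commute, so its powers follow the binomial
  theorem.\<close>

lemma mat_pow_tensor:
  fixes A B :: "nat \<Rightarrow> nat \<Rightarrow> 'a::comm_ring_1"
  assumes "finite I" "finite J" "i \<in> I" "j \<in> J"
  shows "k \<in> I \<Longrightarrow> l \<in> J \<Longrightarrow>
    mat_pow (prod_encode ` (I \<times> J)) (tensor_mat A B) n (prod_encode (k, l)) (prod_encode (i, j))
    = (\<Sum>r\<le>n. of_nat (n choose r) * (mat_pow I A r k i * mat_pow J B (n - r) l j))"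
proof (induction n arbitrary: k l)
  case 0
  then show ?case by simp
next
  case (Suc n)
  let ?f = "\<lambda>k l r s. mat_pow I A r k i * mat_pow J B s l j"
  let ?T = "\<lambda>k l. \<Sum>r\<le>n. of_nat (n choose r) * ?f k l r (n - r)"
  have "mat_pow (prod_encode ` (I \<times> J)) (tensor_mat A B) (Suc n) (prod_encode (k, l)) (prod_encode (i, j))
    = (\<Sum>a\<in>I. \<Sum>b\<in>J. (A k a * of_bool (l = b) + of_bool (k = a) * B l b) * ?T a b)"
    by (simp add: sum_prod_encode sum.cartesian_product' Suc.IH cong: sum.cong_simp)
  also have "\<dots> = (\<Sum>a\<in>I. A k a * ?T a l) + (\<Sum>b\<in>J. B l b * ?T k b)"
  proof -
    have 1: "(\<Sum>b\<in>J. A k a * of_bool (l = b) * ?T a b) = A k a * ?T a l" for a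
    proof -
      have "(\<Sum>b\<in>J. A k a * of_bool (l = b) * ?T a b) = (\<Sum>b\<in>J. if l = b then A k a * ?T a b else 0)"
        by (rule sum.cong) auto
      then show ?thesis using assms(2) \<open>l \<in> J\<close> by simp
    qed
    have 2: "(\<Sum>b\<in>J. of_bool (k = a) * B l b * ?T a b) = (if k = a then \<Sum>b\<in>J. B l b * ?T k b else 0)" for a
      by auto
    show ?thesis
      using assms(1) \<open>k \<in> I\<close> by (simp only: distrib_right sum.distrib 1 2) simp
  qed
  also have "(\<Sum>a\<in>I. A k a * ?T a l) = (\<Sum>r\<le>n. of_nat (n choose r) * ?f k l (Suc r) (n - r))"
    by (simp add: sum_distrib_left sum_distrib_right, subst sum.swap) (simp add: ac_simps)
  also have "(\<Sum>b\<in>J. B l b * ?T k b) = (\<Sum>r\<le>n. of_nat (n choose r) * ?f k l r (Suc (n - r)))"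
    by (simp add: sum_distrib_left sum_distrib_right, subst sum.swap) (simp add: ac_simps)
  also have "(\<Sum>r\<le>n. of_nat (n choose r) * ?f k l (Suc r) (n - r))
      + (\<Sum>r\<le>n. of_nat (n choose r) * ?f k l r (Suc (n - r)))
    = (\<Sum>r\<le>Suc n. of_nat (Suc n choose r) * ?f k l r (Suc n - r))"
    by (simp only: binomial_sum_Suc[of n "?f k l"] distrib_left sum.distrib)
  finally show ?case .
qed

lemma pow_trace_tensor:
  fixes A B :: "nat \<Rightarrow> nat \<Rightarrow> 'a::comm_ring_1"
  assumes "finite I" "finite J"
  shows "pow_trace (prod_encode ` (I \<times> J)) (tensor_mat A B) n
    = (\<Sum>r\<le>n. of_nat (n choose r) * (pow_trace I A r * pow_trace J B (n - r)))"
proof -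
  have "pow_trace (prod_encode ` (I \<times> J)) (tensor_mat A B) n
    = (\<Sum>i\<in>I. \<Sum>j\<in>J. \<Sum>r\<le>n. of_nat (n choose r) * (mat_pow I A r i i * mat_pow J B (n - r) j j))"
    unfolding pow_trace_def
    by (simp add: sum_prod_encode sum.cartesian_product' mat_pow_tensor assms cong: sum.cong_simp)
  also have "\<dots> = (\<Sum>r\<le>n. \<Sum>i\<in>I. \<Sum>j\<in>J. of_nat (n choose r) * (mat_pow I A r i i * mat_pow J B (n - r) j j))"
    by (simp only: sum.swap[of _ "{..n}"])
  finally show ?thesis
    by (simp only: pow_trace_def[of I] pow_trace_def[of J] sum_product) (simp only: sum_distrib_left)
qed

text \<open>The left side is the trace of the n-th power composed with the exchange of the two
  factors. For a tensor product of operators B and C this trace is that of BC, so every binomial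
  term gives \<open>pow_trace I A n\<close>, and the coefficients add up to
  \<open>2 ^ n\<close>.\<close>

lemma pow_trace_tensor_swap:
  fixes A :: "nat \<Rightarrow> nat \<Rightarrow> 'a::comm_ring_1"
  assumes "finite I"
  shows "(\<Sum>i\<in>I. \<Sum>j\<in>I. mat_pow (prod_encode ` (I \<times> I)) (tensor_mat A A) n (prod_encode (i, j)) (prod_encode (j, i)))
    = 2 ^ n * pow_trace I A n"
proof -
  have add: "k \<in> I \<Longrightarrow> (\<Sum>j\<in>I. mat_pow I A r k j * mat_pow I A s j i) = mat_pow I A (r + s) k i" for r s k i
  proof (induction r arbitrary: k)
    case 0
    have "(\<Sum>j\<in>I. of_bool (k = j) * mat_pow I A s j i) = (\<Sum>j\<in>I. if k = j then mat_pow I A s j i else 0)"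
      by (rule sum.cong) auto
    then show ?case using 0 assms by simp
  next
    case (Suc r)
    have "(\<Sum>j\<in>I. mat_pow I A (Suc r) k j * mat_pow I A s j i)
      = (\<Sum>l\<in>I. A k l * (\<Sum>j\<in>I. mat_pow I A r l j * mat_pow I A s j i))"
      by (simp add: sum_distrib_left sum_distrib_right mult.assoc) (rule sum.swap)
    then show ?case using Suc.IH by simp
  qed
  have "(\<Sum>i\<in>I. \<Sum>j\<in>I. mat_pow (prod_encode ` (I \<times> I)) (tensor_mat A A) n (prod_encode (i, j)) (prod_encode (j, i)))
    = (\<Sum>i\<in>I. \<Sum>j\<in>I. \<Sum>r\<le>n. of_nat (n choose r) * (mat_pow I A r i j * mat_pow I A (n - r) j i))"
    by (simp add: mat_pow_tensor assms cong: sum.cong_simp)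
  also have "\<dots> = (\<Sum>r\<le>n. \<Sum>i\<in>I. \<Sum>j\<in>I. of_nat (n choose r) * (mat_pow I A r i j * mat_pow I A (n - r) j i))"
    by (simp only: sum.swap[of _ "{..n}"])
  also have "\<dots> = (\<Sum>r\<le>n. of_nat (n choose r) * pow_trace I A n)"
    by (simp add: add pow_trace_def flip: sum_distrib_left cong: sum.cong_simp)
  also have "\<dots> = of_nat (\<Sum>r\<le>n. n choose r) * pow_trace I A n"
    by (simp add: sum_distrib_right)
  finally show ?thesis by (simp add: choose_row_sum)
qed

section \<open>Exterior and symmetric squares as quotients of the tensor square\<close>

text \<open>The derivation induced by \<open>A\<close> on products of basis vectors, with structure
  constants \<open>\<kappa>\<close>: the shape of the connection matrix in
  \<open>square_bundle\<close>.\<close>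

definition square_mat ::
  "nat set \<Rightarrow> (nat \<times> nat \<Rightarrow> nat \<times> nat \<Rightarrow> 'a) \<Rightarrow> (nat \<Rightarrow> nat \<Rightarrow> 'a::ring_1) \<Rightarrow> nat \<Rightarrow> nat \<Rightarrow> 'a" where
  "square_mat I \<kappa> A m n = (let (i, j) = prod_decode n
     in \<Sum>a\<in>I. A a i * \<kappa> (prod_decode m) (a, j) + A a j * \<kappa> (prod_decode m) (i, a))"

text \<open>The quotient \<open>e\<^sub>a \<otimes> e\<^sub>b \<mapsto> e\<^sub>a e\<^sub>b\<close> of the tensor square with \<open>e\<^sub>b e\<^sub>a = \<epsilon> e\<^sub>a e\<^sub>b\<close>, with basis
  indexed by \<open>J\<close>. The assumption \<open>factor\<close> says that a bilinear function with the symmetry \<open>\<epsilon>\<close> factors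
  through the quotient.\<close>

locale square_quotient =
  fixes I :: "nat set" and J :: "(nat \<times> nat) set" and \<epsilon> :: "'a::comm_ring_1"
    and \<kappa> :: "nat \<times> nat \<Rightarrow> nat \<times> nat \<Rightarrow> 'a"
  assumes finite: "finite I" and J_subset: "J \<subseteq> I \<times> I" and eps: "\<epsilon> * \<epsilon> = 1"
    and symmetry: "\<And>m a b. m \<in> J \<Longrightarrow> \<kappa> m (b, a) = \<epsilon> * \<kappa> m (a, b)"
    and basis: "\<And>m n. m \<in> J \<Longrightarrow> n \<in> J \<Longrightarrow> \<kappa> m n = of_bool (m = n)"
    and factor: "\<And>g a b. (\<And>a b. a \<in> I \<Longrightarrow> b \<in> I \<Longrightarrow> g b a = \<epsilon> * g a b) \<Longrightarrow> a \<in> I \<Longrightarrow> b \<in> I \<Longrightarrow>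
      (\<Sum>n\<in>J. g (fst n) (snd n) * \<kappa> n (a, b)) = g a b"
begin

lemma finite_J: "finite J"
  using J_subset finite finite_subset by blast

lemma square_mat_encode:
  "square_mat I \<kappa> A (prod_encode m) (prod_encode (i, j)) = (\<Sum>a\<in>I. A a i * \<kappa> m (a, j) + A a j * \<kappa> m (i, a))"
  by (simp add: square_mat_def)

lemma square_mat_symmetry:
  assumes "m \<in> J"
  shows "square_mat I \<kappa> A (prod_encode m) (prod_encode (j, i)) = \<epsilon> * square_mat I \<kappa> A (prod_encode m) (prod_encode (i, j))"
proof -
  have "A a j * \<kappa> m (a, i) + A a i * \<kappa> m (j, a) = \<epsilon> * (A a i * \<kappa> m (a, j) + A a j * \<kappa> m (i, a))" for a
  proof -
    have "\<kappa> m (a, i) = \<epsilon> * \<kappa> m (i, a)" "\<kappa> m (j, a) = \<epsilon> * \<kappa> m (a, j)"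
      using symmetry[OF assms, of a i] symmetry[OF assms, of j a] by simp_all
    then show ?thesis by (simp add: algebra_simps)
  qed
  then show ?thesis by (simp add: square_mat_encode sum_distrib_left)
qed

lemma square_mat_factor:
  assumes "m \<in> J" "i \<in> I" "j \<in> I"
  shows "(\<Sum>n\<in>J. square_mat I \<kappa> A (prod_encode m) (prod_encode n) * \<kappa> n (i, j))
    = square_mat I \<kappa> A (prod_encode m) (prod_encode (i, j))"
  using factor[of "\<lambda>a b. square_mat I \<kappa> A (prod_encode m) (prod_encode (a, b))" i j,
    OF square_mat_symmetry[OF assms(1)]] assms(2,3)
  by simp

text \<open>With \<open>\<kappa>\<close> read as the matrix of the projection to the quotient, this
  is its equivariance under the two derivations.\<close>

lemma square_mat_intertwines:
  assumes "i \<in> I" "j \<in> I"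
  shows "(\<Sum>q\<in>I \<times> I. \<kappa> m q * tensor_mat A A (prod_encode q) (prod_encode (i, j)))
    = square_mat I \<kappa> A (prod_encode m) (prod_encode (i, j))"
proof -
  have "(\<Sum>q\<in>I \<times> I. \<kappa> m q * tensor_mat A A (prod_encode q) (prod_encode (i, j)))
    = (\<Sum>a\<in>I. \<Sum>b\<in>I. (if b = j then A a i * \<kappa> m (a, b) else 0) + (if a = i then A b j * \<kappa> m (a, b) else 0))"
    by (simp add: sum.cartesian_product') (intro sum.cong refl, auto simp: algebra_simps)
  also have "\<dots> = (\<Sum>a\<in>I. A a i * \<kappa> m (a, j)) + (\<Sum>a\<in>I. \<Sum>b\<in>I. if a = i then A b j * \<kappa> m (a, b) else 0)"
    using assms finite by (simp add: sum.distrib)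
  also have "(\<Sum>a\<in>I. \<Sum>b\<in>I. if a = i then A b j * \<kappa> m (a, b) else 0) = (\<Sum>b\<in>I. A b j * \<kappa> m (i, b))"
    using assms finite by (subst sum.swap) simp
  finally show ?thesis by (simp add: square_mat_encode sum.distrib)
qed

abbreviation "sq_pow A r m n \<equiv> mat_pow (prod_encode ` J) (square_mat I \<kappa> A) r (prod_encode m) (prod_encode n)"
abbreviation "te_pow A r m n \<equiv> mat_pow (prod_encode ` (I \<times> I)) (tensor_mat A A) r (prod_encode m) (prod_encode n)"

text \<open>Equivariance of the projection passes to powers, which transfers traces on the quotient
  to the tensor square.\<close>

lemma sq_pow_intertwines:
  "m \<in> J \<Longrightarrow> q \<in> I \<times> I \<Longrightarrow> (\<Sum>n\<in>J. sq_pow A r m n * \<kappa> n q) = (\<Sum>s\<in>I \<times> I. \<kappa> m s * te_pow A r s q)"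
proof (induction r arbitrary: m)
  case 0
  have "(\<Sum>n\<in>J. of_bool (m = n) * \<kappa> n q) = (\<Sum>n\<in>J. if m = n then \<kappa> n q else 0)"
    "(\<Sum>s\<in>I \<times> I. \<kappa> m s * of_bool (s = q)) = (\<Sum>s\<in>I \<times> I. if s = q then \<kappa> m s else 0)"
    by (rule sum.cong; simp)+
  then show ?case using 0 finite_J finite by simp
next
  case (Suc r)
  let ?N = "\<lambda>m n. square_mat I \<kappa> A (prod_encode m) (prod_encode n)"
  let ?M = "\<lambda>m n. tensor_mat A A (prod_encode m) (prod_encode n)"
  have "(\<Sum>n\<in>J. sq_pow A (Suc r) m n * \<kappa> n q) = (\<Sum>k\<in>J. ?N m k * (\<Sum>n\<in>J. sq_pow A r k n * \<kappa> n q))"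
    by (simp add: sum_prod_encode sum_distrib_left sum_distrib_right mult.assoc) (rule sum.swap)
  also have "\<dots> = (\<Sum>k\<in>J. ?N m k * (\<Sum>s\<in>I \<times> I. \<kappa> k s * te_pow A r s q))"
    using Suc by simp
  also have "\<dots> = (\<Sum>s\<in>I \<times> I. (\<Sum>k\<in>J. ?N m k * \<kappa> k s) * te_pow A r s q)"
    by (simp only: sum_distrib_left sum_distrib_right mult.assoc) (rule sum.swap)
  also have "\<dots> = (\<Sum>s\<in>I \<times> I. (\<Sum>p\<in>I \<times> I. \<kappa> m p * ?M p s) * te_pow A r s q)"
    by (rule sum.cong[OF refl], intro arg_cong2[where f = "(*)", OF _ refl])
      (use Suc.prems in \<open>auto simp: square_mat_factor square_mat_intertwines simp del: tensor_mat_encode\<close>)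
  also have "\<dots> = (\<Sum>p\<in>I \<times> I. \<kappa> m p * (\<Sum>s\<in>I \<times> I. ?M p s * te_pow A r s q))"
    by (simp only: sum_distrib_left sum_distrib_right mult.assoc) (rule sum.swap)
  finally show ?case by (simp add: sum_prod_encode)
qed

text \<open>The quotient behaves as the image of the projector (1 + \<open>\<epsilon>\<close> flip)
  / 2 on the tensor square, so twice a trace on it is the full trace plus \<open>\<epsilon>\<close>
  times the trace against the flip, which \<open>pow_trace_tensor_swap\<close> evaluates.\<close>

lemma pow_trace_square:
  "2 * pow_trace (prod_encode ` J) (square_mat I \<kappa> A) r
    = (\<Sum>k\<le>r. of_nat (r choose k) * (pow_trace I A k * pow_trace I A (r - k))) + \<epsilon> * (2 ^ r * pow_trace I A r)"
proof -
  have te_swap: "te_pow A r (b, a) (d, c) = te_pow A r (a, b) (c, d)"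
    if "a \<in> I" "b \<in> I" "c \<in> I" "d \<in> I" for a b c d
  proof -
    have "te_pow A r (b, a) (d, c) = (\<Sum>k\<le>r. of_nat (r choose k) * (mat_pow I A k b d * mat_pow I A (r - k) a c))"
      using that finite by (simp add: mat_pow_tensor)
    also have "\<dots> = (\<Sum>k\<le>r. of_nat (r choose k) * (mat_pow I A k a c * mat_pow I A (r - k) b d))"
      by (rule sum.reindex_bij_witness[of _ "\<lambda>k. r - k" "\<lambda>k. r - k"])
        (auto simp: mult.commute binomial_symmetric[symmetric])
    finally show ?thesis using that finite by (simp add: mat_pow_tensor)
  qed
  have tr: "pow_trace (prod_encode ` J) (square_mat I \<kappa> A) r = (\<Sum>m\<in>J. \<Sum>s\<in>I \<times> I. \<kappa> m s * te_pow A r s m)"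
  proof -
    have "sq_pow A r m m = (\<Sum>s\<in>I \<times> I. \<kappa> m s * te_pow A r s m)" if "m \<in> J" for m
    proof -
      have "(\<Sum>n\<in>J. sq_pow A r m n * \<kappa> n m) = (\<Sum>n\<in>J. if n = m then sq_pow A r m n else 0)"
        using that by (intro sum.cong refl) (simp add: basis)
      then show ?thesis
        using that J_subset finite_J sq_pow_intertwines[of m m A r] by auto
    qed
    then show ?thesis by (simp add: pow_trace_def sum_prod_encode)
  qed
  \<comment> \<open>Flipping the summation index gives the trace a second form. The sum of both
    forms has in \<open>m\<close> the symmetry that \<open>factor\<close> demands.\<close>
  have swap: "(\<Sum>s\<in>I \<times> I. \<kappa> m s * te_pow A r s m)
      = (\<Sum>(a, b)\<in>I \<times> I. \<kappa> m (a, b) * (\<epsilon> * te_pow A r (a, b) (snd m, fst m)))" if "m \<in> J" for m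
  proof -
    have "(\<Sum>s\<in>I \<times> I. \<kappa> m s * te_pow A r s m) = (\<Sum>(a, b)\<in>I \<times> I. \<kappa> m (b, a) * te_pow A r (b, a) m)"
      by (rule sum.reindex_bij_witness[of _ "\<lambda>(a, b). (b, a)" "\<lambda>(a, b). (b, a)"]) auto
    also have "\<dots> = (\<Sum>(a, b)\<in>I \<times> I. \<kappa> m (a, b) * (\<epsilon> * te_pow A r (a, b) (snd m, fst m)))"
    proof (intro sum.cong refl, clarify)
      fix a b assume "a \<in> I" "b \<in> I"
      moreover obtain k l where "m = (k, l)" "k \<in> I" "l \<in> I" using \<open>m \<in> J\<close> J_subset by blast
      ultimately show "\<kappa> m (b, a) * te_pow A r (b, a) m = \<kappa> m (a, b) * (\<epsilon> * te_pow A r (a, b) (snd m, fst m))"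
        using symmetry[OF \<open>m \<in> J\<close>, of b a] te_swap[of a b l k] by simp
    qed
    finally show ?thesis .
  qed
  have "2 * pow_trace (prod_encode ` J) (square_mat I \<kappa> A) r
    = (\<Sum>m\<in>J. \<Sum>(a, b)\<in>I \<times> I. (te_pow A r (a, b) m + \<epsilon> * te_pow A r (a, b) (snd m, fst m)) * \<kappa> m (a, b))"
    unfolding mult_2 by (subst tr, subst tr, subst (2) sum.cong[OF refl swap], assumption)
      (simp add: case_prod_unfold algebra_simps flip: sum.distrib)
  also have "\<dots> = (\<Sum>(a, b)\<in>I \<times> I. \<Sum>m\<in>J. (te_pow A r (a, b) m + \<epsilon> * te_pow A r (a, b) (snd m, fst m)) * \<kappa> m (a, b))"
    by (simp only: case_prod_unfold) (rule sum.swap)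
  also have "\<dots> = (\<Sum>(a, b)\<in>I \<times> I. te_pow A r (a, b) (a, b) + \<epsilon> * te_pow A r (a, b) (b, a))"
  proof (intro sum.cong refl, clarify)
    fix a b assume "a \<in> I" "b \<in> I"
    then show "(\<Sum>m\<in>J. (te_pow A r (a, b) m + \<epsilon> * te_pow A r (a, b) (snd m, fst m)) * \<kappa> m (a, b))
        = te_pow A r (a, b) (a, b) + \<epsilon> * te_pow A r (a, b) (b, a)"
      using factor[of "\<lambda>c d. te_pow A r (a, b) (c, d) + \<epsilon> * te_pow A r (a, b) (d, c)" a b]
      by (simp add: distrib_left eps add.commute flip: mult.assoc)
  qed
  also have "\<dots> = pow_trace (prod_encode ` (I \<times> I)) (tensor_mat A A) r + \<epsilon> * (2 ^ r * pow_trace I A r)"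
    unfolding pow_trace_tensor_swap[OF finite, of A r, symmetric]
    by (simp add: pow_trace_def sum_prod_encode sum.cartesian_product' sum.distrib sum_distrib_left)
  finally show ?thesis by (simp only: pow_trace_tensor[OF finite finite])
qed

text \<open>Inducing derivations on the quotient respects commutators, as the quadratic term of the
  curvature requires.\<close>

lemma square_mat_commutator:
  assumes "m \<in> prod_encode ` J" "n \<in> prod_encode ` J"
  shows "(\<Sum>k\<in>prod_encode ` J. square_mat I \<kappa> A m k * square_mat I \<kappa> B k n - square_mat I \<kappa> B m k * square_mat I \<kappa> A k n)
    = square_mat I \<kappa> (\<lambda>i j. \<Sum>k\<in>I. A i k * B k j - B i k * A k j) m n"
proof -
  obtain m' i j where m: "m = prod_encode m'" "m' \<in> J" and n: "n = prod_encode (i, j)" "i \<in> I" "j \<in> I"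
    using assms J_subset by auto
  \<comment> \<open>The last two double sums are the mixed terms, where the matrices act on
    different factors; exchanging \<open>A\<close> and \<open>B\<close> exchanges them, so they
    cancel in the commutator.\<close>
  have prod: "(\<Sum>k\<in>prod_encode ` J. square_mat I \<kappa> A m k * square_mat I \<kappa> B k n)
      = (\<Sum>b\<in>I. \<Sum>a\<in>I. A a b * B b i * \<kappa> m' (a, j) + A a b * B b j * \<kappa> m' (i, a))
        + ((\<Sum>b\<in>I. \<Sum>a\<in>I. B b i * A a j * \<kappa> m' (b, a)) + (\<Sum>b\<in>I. \<Sum>a\<in>I. A b i * B a j * \<kappa> m' (b, a)))" for A B
  proof -
    have "(\<Sum>k\<in>prod_encode ` J. square_mat I \<kappa> A m k * square_mat I \<kappa> B k n)
      = (\<Sum>k\<in>J. \<Sum>b\<in>I. B b i * (square_mat I \<kappa> A m (prod_encode k) * \<kappa> k (b, j))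
          + B b j * (square_mat I \<kappa> A m (prod_encode k) * \<kappa> k (i, b)))"
      unfolding n sum_prod_encode square_mat_encode
      by (simp add: sum_distrib_left distrib_left mult.left_commute)
    also have "\<dots> = (\<Sum>b\<in>I. \<Sum>k\<in>J. B b i * (square_mat I \<kappa> A m (prod_encode k) * \<kappa> k (b, j))
          + B b j * (square_mat I \<kappa> A m (prod_encode k) * \<kappa> k (i, b)))"
      by (rule sum.swap)
    also have "\<dots> = (\<Sum>b\<in>I. B b i * square_mat I \<kappa> A m (prod_encode (b, j)) + B b j * square_mat I \<kappa> A m (prod_encode (i, b)))"
      using m n by (simp add: sum.distrib square_mat_factor flip: sum_distrib_left)
    also have "\<dots> = (\<Sum>b\<in>I. \<Sum>a\<in>I. A a b * B b i * \<kappa> m' (a, j) + A a b * B b j * \<kappa> m' (i, a))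
        + ((\<Sum>b\<in>I. \<Sum>a\<in>I. B b i * A a j * \<kappa> m' (b, a)) + (\<Sum>b\<in>I. \<Sum>a\<in>I. B b j * A a i * \<kappa> m' (a, b)))"
      by (simp add: m square_mat_encode sum.distrib sum_distrib_left algebra_simps)
    also have "(\<Sum>b\<in>I. \<Sum>a\<in>I. B b j * A a i * \<kappa> m' (a, b)) = (\<Sum>b\<in>I. \<Sum>a\<in>I. A b i * B a j * \<kappa> m' (b, a))"
      by (subst sum.swap) (simp add: mult.commute)
    finally show ?thesis .
  qed
  have "(\<Sum>k\<in>prod_encode ` J. square_mat I \<kappa> A m k * square_mat I \<kappa> B k n - square_mat I \<kappa> B m k * square_mat I \<kappa> A k n)
    = (\<Sum>b\<in>I. \<Sum>a\<in>I. A a b * B b i * \<kappa> m' (a, j) + A a b * B b j * \<kappa> m' (i, a))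
     - (\<Sum>b\<in>I. \<Sum>a\<in>I. B a b * A b i * \<kappa> m' (a, j) + B a b * A b j * \<kappa> m' (i, a))"
    unfolding sum_subtractf prod by (simp add: ac_simps)
  also have "\<dots> = (\<Sum>a\<in>I. \<Sum>b\<in>I. (A a b * B b i - B a b * A b i) * \<kappa> m' (a, j) + (A a b * B b j - B a b * A b j) * \<kappa> m' (i, a))"
    unfolding sum_subtractf[symmetric] by (subst sum.swap) (simp add: algebra_simps)
  finally show ?thesis
    by (simp add: m n square_mat_encode sum_distrib_right sum.distrib)
qed

end

text \<open>The structure constants of \<open>ext2\<close> over an arbitrary ring: the connection
  uses them over the complex numbers, the traces over even forms.\<close>

definition ext2_coeff :: "nat \<times> nat \<Rightarrow> nat \<times> nat \<Rightarrow> 'a::comm_ring_1" where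
  "ext2_coeff = (\<lambda>(k, l) (a, b). if (a, b) = (k, l) then 1 else if (b, a) = (k, l) then -1 else 0)"

definition sym2_coeff :: "nat \<times> nat \<Rightarrow> nat \<times> nat \<Rightarrow> 'a::comm_ring_1" where
  "sym2_coeff = (\<lambda>(k, l) (a, b). if (a, b) = (k, l) \<or> (b, a) = (k, l) then 1 else 0)"

lemma square_quotient_sym2:
  assumes "finite I"
  shows "square_quotient I {(k, l) \<in> I \<times> I. k \<le> l} 1 sym2_coeff"
proof
  have fin: "finite {(k, l) \<in> I \<times> I. k \<le> l}"
    by (rule finite_subset[of _ "I \<times> I"]) (use assms in auto)
  fix g :: "nat \<Rightarrow> nat \<Rightarrow> 'a" and a b :: nat
  assume g: "\<And>a b. a \<in> I \<Longrightarrow> b \<in> I \<Longrightarrow> g b a = 1 * g a b" and ab: "a \<in> I" "b \<in> I"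
  have "(\<Sum>n\<in>{(k, l) \<in> I \<times> I. k \<le> l}. g (fst n) (snd n) * sym2_coeff n (a, b))
    = (\<Sum>n\<in>{(k, l) \<in> I \<times> I. k \<le> l}. if n = (min a b, max a b) then g a b else 0)"
  proof (intro sum.cong refl)
    fix n assume "n \<in> {(k, l) \<in> I \<times> I. k \<le> l}"
    moreover have "g b a = g a b" using g[OF ab] by simp
    ultimately show "g (fst n) (snd n) * sym2_coeff n (a, b) = (if n = (min a b, max a b) then g a b else 0)"
      by (cases n; cases a b rule: linorder_cases) (auto simp: sym2_coeff_def)
  qed
  then show "(\<Sum>n\<in>{(k, l) \<in> I \<times> I. k \<le> l}. g (fst n) (snd n) * sym2_coeff n (a, b)) = g a b"
    using fin ab by (cases "a \<le> b") (simp_all add: min_def max_def)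
qed (use assms in \<open>auto simp: sym2_coeff_def split: if_splits\<close>)

text \<open>No basis element corresponds to a pair (a, a), so an antisymmetric \<open>g\<close> must
  vanish on the diagonal; this is where the second assumption, the absence of 2-torsion,
  enters.\<close>

lemma square_quotient_ext2:
  fixes sgn :: "'a::comm_ring_1"
  assumes "finite I" and sgn: "\<And>x :: 'a. x = - x \<Longrightarrow> x = 0"
  shows "square_quotient I {(k, l) \<in> I \<times> I. k < l} (- 1 :: 'a) ext2_coeff"
proof
  have fin: "finite {(k, l) \<in> I \<times> I. k < l}"
    by (rule finite_subset[of _ "I \<times> I"]) (use assms in auto)
  fix g :: "nat \<Rightarrow> nat \<Rightarrow> 'a" and a b :: nat
  assume g: "\<And>a b. a \<in> I \<Longrightarrow> b \<in> I \<Longrightarrow> g b a = - 1 * g a b" and ab: "a \<in> I" "b \<in> I"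
  have eq: "(\<Sum>n\<in>{(k, l) \<in> I \<times> I. k < l}. g (fst n) (snd n) * ext2_coeff n (a, b))
    = (\<Sum>n\<in>{(k, l) \<in> I \<times> I. k < l}. if n = (min a b, max a b) then g a b else 0)"
  proof (intro sum.cong refl)
    fix n assume "n \<in> {(k, l) \<in> I \<times> I. k < l}"
    moreover have "g b a = - g a b" using g[OF ab] by simp
    ultimately show "g (fst n) (snd n) * ext2_coeff n (a, b) = (if n = (min a b, max a b) then g a b else 0)"
      by (cases n; cases a b rule: linorder_cases) (auto simp: ext2_coeff_def)
  qed
  show "(\<Sum>n\<in>{(k, l) \<in> I \<times> I. k < l}. g (fst n) (snd n) * ext2_coeff n (a, b)) = g a b"
  proof (cases "a = b")
    case True
    then show ?thesis using sgn[of "g a a"] g[of a a] ab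
      by (auto simp: ext2_coeff_def intro!: sum.neutral)
  next
    case False
    then show ?thesis unfolding eq using fin ab by (cases a b rule: linorder_cases) (simp_all add: min_def max_def)
  qed
qed (use assms(1) in \<open>auto simp: ext2_coeff_def split: if_splits\<close>)

section \<open>Connection forms in charts\<close>

lemma frechet_derivative_cong_open:
  assumes "open S" "x \<in> S" "\<And>y. y \<in> S \<Longrightarrow> f y = g y"
  shows "frechet_derivative f (at x) = frechet_derivative g (at x)"
    and "f differentiable (at x) \<longleftrightarrow> g differentiable (at x)"
proof -
  have "(f has_derivative D) (at x) \<longleftrightarrow> (g has_derivative D) (at x)" for D
    using has_derivative_transform_within_open[of f D x UNIV S g]
      has_derivative_transform_within_open[of g D x UNIV S f] assms by auto
  then show "frechet_derivative f (at x) = frechet_derivative g (at x)"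
    and "f differentiable (at x) \<longleftrightarrow> g differentiable (at x)"
    by (auto simp: frechet_derivative_def differentiable_def)
qed

lemma class_C_const:
  assumes "open S" "\<And>x. x \<in> S \<Longrightarrow> f x = k"
  shows "class_C n S f"
  using assms(2)
proof (induction n arbitrary: f k)
  case 0
  then show ?case by (simp cong: continuous_on_cong)
next
  case (Suc n)
  have "f differentiable (at x) \<and> frechet_derivative f (at x) v = 0" if "x \<in> S" for x v
    using frechet_derivative_cong_open[OF assms(1) that, of f "\<lambda>_. k"] Suc.prems by simp
  then show ?case using Suc.IH[of _ 0] by auto
qed

lemma smooth_on_const: "open S \<Longrightarrow> (\<And>x. x \<in> S \<Longrightarrow> f x = k) \<Longrightarrow> smooth_on S f"
  by (simp add: smooth_on_def class_C_const)

lemma smooth_on_differentiable: "smooth_on S f \<Longrightarrow> x \<in> S \<Longrightarrow> f differentiable (at x)"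
  using class_C.simps(2)[of 0 S f] by (auto simp: smooth_on_def simp del: class_C.simps)

context
  fixes X :: "('x, 'm::real_normed_vector) mfd"
  assumes manifold: "smooth_manifold X"
begin

lemma chart_facts:
  assumes "c \<in> atlas X"
  shows chart_open: "openin (mtop X) (fst c)"
    and chart_inj: "inj_on (snd c) (fst c)"
    and chart_image_open: "openin (mtop X) V \<Longrightarrow> open (snd c ` (V \<inter> fst c))"
proof -
  obtain U \<phi> where c: "c = (U, \<phi>)" by (cases c)
  have *: "openin (mtop X) U" "open (\<phi> ` U)"
    "homeomorphic_map (subtopology (mtop X) U) (top_of_set (\<phi> ` U)) \<phi>"
    using manifold assms unfolding smooth_manifold_def c by blast+
  show "openin (mtop X) (fst c)" using * c by simp
  have top: "topspace (subtopology (mtop X) U) = U"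
    using openin_subset[OF *(1)] by (simp add: topspace_subtopology Int_absorb1)
  show "inj_on (snd c) (fst c)"
    using homeomorphic_imp_injective_map[OF *(3)] top c by simp
  assume "openin (mtop X) V"
  then have "openin (top_of_set (\<phi> ` U)) (\<phi> ` (V \<inter> U))"
    using homeomorphic_imp_open_map[OF *(3)] openin_subtopology_Int[of "mtop X" V U]
    by (simp add: open_map_def)
  then show "open (snd c ` (V \<inter> fst c))"
    using *(2) c by (simp add: openin_open_eq)
qed

lemma chart_inv_left [simp]: "c \<in> atlas X \<Longrightarrow> y \<in> fst c \<Longrightarrow> chart_inv c (snd c y) = y"
  by (simp add: chart_inv_def chart_inj)

lemma chart_at_props:
  assumes "p \<in> pts X"
  shows "chart_at X p \<in> atlas X" "p \<in> fst (chart_at X p)"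
proof -
  have "\<exists>c. c \<in> atlas X \<and> p \<in> fst c"
    using manifold assms unfolding smooth_manifold_def by blast
  from someI_ex[OF this] show "chart_at X p \<in> atlas X" "p \<in> fst (chart_at X p)"
    by (simp_all add: chart_at_def)
qed

lemma chart_subset: "c \<in> atlas X \<Longrightarrow> fst c \<subseteq> pts X"
  by (rule openin_subset) (rule chart_open)

lemma transition_differentiable:
  assumes "c \<in> atlas X" "d \<in> atlas X" "y \<in> fst c" "y \<in> fst d"
  shows "(snd d \<circ> chart_inv c) differentiable (at (snd c y))"
proof -
  have "smooth_on (snd c ` (fst c \<inter> fst d)) (snd d \<circ> chart_inv c)"
  proof -
    have "\<forall>(U, \<phi>)\<in>atlas X. \<forall>(V, \<psi>)\<in>atlas X. smooth_on (\<phi> ` (U \<inter> V)) (\<psi> \<circ> chart_inv (U, \<phi>))"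
      using manifold unfolding smooth_manifold_def by (elim conjE)
    from bspec[OF this assms(1)] assms(2) show ?thesis
      by (cases c; cases d) auto
  qed
  then show ?thesis
    by (rule smooth_on_differentiable) (use assms in blast)
qed

text \<open>\<open>smooth_fun\<close> only provides some chart around the point; the transition map,
  differentiable by compatibility of the atlas, leads to the chart \<open>c\<close>.\<close>

lemma smooth_fun_differentiable:
  assumes "smooth_fun X W f" "y \<in> W" "c \<in> atlas X" "y \<in> fst c"
  shows "(f \<circ> chart_inv c) differentiable (at (snd c y))"
proof -
  obtain d V where d: "d \<in> atlas X" "openin (mtop X) V" "y \<in> V" "V \<subseteq> fst d \<inter> W"
    "smooth_on (snd d ` V) (f \<circ> chart_inv d)"
    using assms unfolding smooth_fun_def by blast
  have "(f \<circ> chart_inv d) differentiable (at ((snd d \<circ> chart_inv c) (snd c y)))"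
    using smooth_on_differentiable[OF d(5)] d assms by auto
  then have "((f \<circ> chart_inv d) \<circ> (snd d \<circ> chart_inv c)) differentiable (at (snd c y))"
    by (intro differentiable_chain_at transition_differentiable) (use d assms in auto)
  moreover have "open (snd c ` (fst d \<inter> fst c))"
    using d assms by (simp add: chart_image_open chart_open)
  ultimately show ?thesis
    by (subst frechet_derivative_cong_open(2)[of "snd c ` (fst d \<inter> fst c)" _ _
          "(f \<circ> chart_inv d) \<circ> (snd d \<circ> chart_inv c)"]) (use d assms in auto)
qed

lemma smooth_fun_const:
  assumes "openin (mtop X) W" "\<And>y. y \<in> W \<Longrightarrow> f y = k"
  shows "smooth_fun X W f"
  unfolding smooth_fun_def
proof
  fix y assume "y \<in> W"
  then have "y \<in> pts X" using assms(1) openin_subset by blast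
  define c where "c = chart_at X y"
  note c = chart_at_props[OF \<open>y \<in> pts X\<close>, folded c_def]
  have "smooth_on (snd c ` (W \<inter> fst c)) (f \<circ> chart_inv c)"
    by (rule smooth_on_const[of _ _ k]) (use assms c in \<open>auto intro: chart_image_open\<close>)
  then show "\<exists>c\<in>atlas X. \<exists>V. openin (mtop X) V \<and> y \<in> V \<and> V \<subseteq> fst c \<inter> W \<and>
      smooth_on (snd c ` V) (f \<circ> chart_inv c)"
    using c \<open>y \<in> W\<close> openin_Int[OF assms(1) chart_open[OF c(1)]]
    by (intro bexI[of _ c] exI[of _ "W \<inter> fst c"]) auto
qed

lemma dfun_const:
  assumes "openin (mtop X) W" "\<And>y. y \<in> W \<Longrightarrow> f y = k" "p \<in> W"
  shows "dfun X f p v = 0"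
proof -
  have "p \<in> pts X" using assms(1,3) openin_subset by blast
  define c where "c = chart_at X p"
  note c = chart_at_props[OF \<open>p \<in> pts X\<close>, folded c_def]
  have "frechet_derivative (f \<circ> chart_inv c) (at (snd c p)) = frechet_derivative (\<lambda>_. k) (at (snd c p))"
    by (rule frechet_derivative_cong_open[of "snd c ` (W \<inter> fst c)"])
      (use assms c in \<open>auto intro: chart_image_open\<close>)
  then show ?thesis by (simp add: dfun_def c_def)
qed

lemma tan_coord_tan_vec:
  assumes "c \<in> atlas X" "y \<in> fst c"
  shows "tan_coord X c y (tan_vec X c y u) = u"
proof -
  have "y \<in> pts X" using assms chart_subset by blast
  define d where "d = chart_at X y"
  note d = chart_at_props[OF \<open>y \<in> pts X\<close>, folded d_def]
  have "frechet_derivative ((snd c \<circ> chart_inv d) \<circ> (snd d \<circ> chart_inv c)) (at (snd c y))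
    = frechet_derivative (snd c \<circ> chart_inv d) (at ((snd d \<circ> chart_inv c) (snd c y)))
      \<circ> frechet_derivative (snd d \<circ> chart_inv c) (at (snd c y))"
    by (rule frechet_derivative_compose) (use assms d in \<open>auto intro!: transition_differentiable\<close>)
  moreover have "frechet_derivative ((snd c \<circ> chart_inv d) \<circ> (snd d \<circ> chart_inv c)) (at (snd c y))
    = frechet_derivative (\<lambda>z. z) (at (snd c y))"
    by (rule frechet_derivative_cong_open[of "snd c ` (fst d \<inter> fst c)"])
      (use assms d in \<open>auto intro: chart_image_open chart_open\<close>)
  moreover have "frechet_derivative (\<lambda>z. z) (at (snd c y)) = (\<lambda>h. h)"
    using frechet_derivative_at[OF has_derivative_ident] by metis
  ultimately show ?thesis
    using assms d by (simp add: tan_coord_def tan_vec_def d_def[symmetric] fun_eq_iff)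
qed

text \<open>In the chart \<open>c\<close> this field has the constant coordinate \<open>u\<close>.
  \<open>con_coord\<close> evaluates the connection along such fields, and the connection axioms
  give smooth sections only along smooth fields.\<close>

lemma smooth_vf_coordinate:
  assumes "c \<in> atlas X" "openin (mtop X) W" "W \<subseteq> fst c"
  shows "smooth_vf X W (\<lambda>y. tan_vec X c y u)"
  unfolding smooth_vf_def
proof
  fix y assume "y \<in> W"
  have "smooth_on (snd c ` W) (vf_coord X c (\<lambda>y. tan_vec X c y u))"
  proof (rule smooth_on_const[of _ _ u])
    show "open (snd c ` W)"
      using chart_image_open[OF assms(1,2)] assms(3) by (simp add: Int_absorb2)
    fix z assume "z \<in> snd c ` W"
    then show "vf_coord X c (\<lambda>y. tan_vec X c y u) z = u"
      using assms by (auto simp: vf_coord_def subset_iff tan_coord_tan_vec)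
  qed
  then show "\<exists>d\<in>atlas X. \<exists>V. openin (mtop X) V \<and> y \<in> V \<and> V \<subseteq> fst d \<inter> W \<and>
      smooth_on (snd d ` V) (vf_coord X d (\<lambda>y. tan_vec X c y u))"
    using assms \<open>y \<in> W\<close> by (intro bexI[of _ c] exI[of _ W]) auto
qed

end

text \<open>Differentiability has to be carried along because \<open>frechet_derivative\<close> is an arbitrary value
  at points where there is no derivative.\<close>

definition regular_at ::
  "('x, 'm::real_normed_vector) mfd \<Rightarrow> ('x, 'm) cbundle \<Rightarrow> 'x \<Rightarrow> bool" where
  "regular_at X E p \<longleftrightarrow> finite (idx E) \<and>
     (\<forall>i\<in>idx E. \<forall>j\<in>idx E. \<forall>u. con_coord X E p i j u differentiable (at (snd (chart_at X p) p)))"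

lemma regular_atD:
  assumes "regular_at X E p"
  shows "finite (idx E)"
    and "i \<in> idx E \<Longrightarrow> j \<in> idx E \<Longrightarrow> (con_coord X E p i j u has_derivative
      frechet_derivative (con_coord X E p i j u) (at (snd (chart_at X p) p))) (at (snd (chart_at X p) p))"
  using assms by (auto simp: regular_at_def frechet_derivative_works)

lemma orthonormal_frameD:
  assumes "orthonormal_frame X E U e"
  shows "openin (mtop X) U"
    and "y \<in> U \<Longrightarrow> span ((\<lambda>i. e i y) ` {..<rk E}) = fib E y"
    and "y \<in> U \<Longrightarrow> i < rk E \<Longrightarrow> j < rk E \<Longrightarrow> inn E y (e i y) (e j y) = (if i = j then 1 else 0)"
    and "openin (mtop X) W \<Longrightarrow> W \<subseteq> U \<Longrightarrow> s \<in> sec E W \<longleftrightarrow>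
      (\<forall>x\<in>W. s x \<in> fib E x) \<and> (\<forall>i<rk E. smooth_fun X W (\<lambda>x. inn E x (s x) (e i x)))"
  using assms by (simp_all add: orthonormal_frame_def)

lemma euclidean_connectionD:
  assumes "euclidean_connection X E" "openin (mtop X) W" "s \<in> sec E W"
  shows "y \<in> W \<Longrightarrow> nab E y v s \<in> fib E y"
    and "y \<in> W \<Longrightarrow> t \<in> sec E W \<Longrightarrow> dfun X (\<lambda>y. inn E y (s y) (t y)) y v
           = inn E y (nab E y v s) (t y) + inn E y (s y) (nab E y v t)"
    and "smooth_vf X W Y \<Longrightarrow> (\<lambda>x. nab E x (Y x) s) \<in> sec E W"
proof -
  note * = assms(1)[unfolded euclidean_connection_def]
  show "smooth_vf X W Y \<Longrightarrow> (\<lambda>x. nab E x (Y x) s) \<in> sec E W"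
    using *[THEN conjunct2] assms(2,3) by simp
  assume "y \<in> W"
  note ** = *[THEN conjunct1, THEN spec, THEN spec, THEN spec, THEN mp,
      OF conjI[OF assms(2) conjI[OF this assms(3)]]]
  show "nab E y v s \<in> fib E y"
    using **[THEN conjunct1] by simp
  show "t \<in> sec E W \<Longrightarrow> dfun X (\<lambda>y. inn E y (s y) (t y)) y v
      = inn E y (nab E y v s) (t y) + inn E y (s y) (nab E y v t)"
    using **[THEN conjunct2, THEN conjunct2, THEN conjunct2, THEN conjunct2, THEN conjunct2] by simp
qed

lemma form_val_curv_pair:
  "form_val (curv X E p i j) [u, v] =
     frechet_derivative (con_coord X E p i j v) (at (snd (chart_at X p) p)) u
     - frechet_derivative (con_coord X E p i j u) (at (snd (chart_at X p) p)) v
     + (\<Sum>k\<in>idx E. con_coord X E p i k u (snd (chart_at X p) p) * con_coord X E p k j v (snd (chart_at X p) p)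
        - con_coord X E p i k v (snd (chart_at X p) p) * con_coord X E p k j u (snd (chart_at X p) p))"
  by (simp add: curv_def Let_def)

lemma form_val_curv_eq_0: "length vs \<noteq> 2 \<Longrightarrow> form_val (curv X E p i j) vs = 0"
  by (auto simp: curv_def split: list.splits)

lemma curv_eqI:
  assumes "\<And>u v. form_val (curv X E p i j) [u, v] = form_val \<omega> [u, v]"
    and "\<And>vs. length vs \<noteq> 2 \<Longrightarrow> form_val \<omega> vs = 0"
  shows "curv X E p i j = \<omega>"
proof (rule form_eqI)
  fix vs
  show "form_val (curv X E p i j) vs = form_val \<omega> vs"
    by (cases "length vs = 2")
      (auto simp: assms form_val_curv_eq_0 length_Suc_conv numeral_2_eq_2)
qed

section \<open>Curvature of a Euclidean bundle in an orthonormal frame\<close>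

locale framed_point =
  fixes X :: "('x, 'm::real_normed_vector) mfd" and E :: "('x, 'm, 'v::real_vector) rbundle" and p :: 'x
  assumes manifold: "smooth_manifold X" and euclidean: "euclidean_bundle_conn X E" and point: "p \<in> pts X"
begin

definition "U = fst (frame_at X E p)"
definition "e = snd (frame_at X E p)"
definition "c = chart_at X p"

lemma frame: "p \<in> U" "orthonormal_frame X E U e"
proof -
  have "\<exists>q. case q of (V, f) \<Rightarrow> p \<in> V \<and> orthonormal_frame X E V f"
    using euclidean point unfolding euclidean_bundle_conn_def euclidean_bundle_def by auto
  from someI_ex[OF this] show "p \<in> U" "orthonormal_frame X E U e"
    by (simp_all add: U_def e_def frame_at_def case_prod_unfold)
qed

lemma U_open: "openin (mtop X) U"
  by (rule orthonormal_frameD(1)[OF frame(2)])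

lemma orthonormal:
  assumes "y \<in> U" "i < rk E" "j < rk E"
  shows "inn E y (e i y) (e j y) = (if i = j then 1 else 0)"
  using orthonormal_frameD(3)[OF frame(2)] assms by simp

lemma frame_fib: "y \<in> U \<Longrightarrow> i < rk E \<Longrightarrow> e i y \<in> fib E y"
  using span_base[of "e i y" "(\<lambda>i. e i y) ` {..<rk E}"] orthonormal_frameD(2)[OF frame(2), of y] by simp

lemma c_atlas: "c \<in> atlas X" and p_chart: "p \<in> fst c"
  using chart_at_props[OF manifold point] by (simp_all add: c_def)

lemma frame_section:
  assumes "openin (mtop X) W" "W \<subseteq> U" "j < rk E"
  shows "e j \<in> sec E W"
proof -
  have "smooth_fun X W (\<lambda>x. inn E x (e j x) (e i x))" if "i < rk E" for i
    by (rule smooth_fun_const[OF manifold assms(1)]) (use assms that in \<open>auto simp: orthonormal subset_iff\<close>)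
  then show ?thesis
    using orthonormal_frameD(4)[OF frame(2) assms(1,2)] assms frame_fib by blast
qed

text \<open>Metric compatibility is applied to the inner product of two frame vectors, which is
  constant.\<close>

lemma connection_skew:
  assumes y: "y \<in> U" and ij: "i < rk E" "j < rk E"
  shows "inn E y (nab E y v (e j)) (e i y) = - inn E y (nab E y v (e i)) (e j y)"
proof -
  have conn: "euclidean_connection X E" and eb: "euclidean_bundle X E"
    using euclidean by (simp_all add: euclidean_bundle_conn_def)
  have s: "e i \<in> sec E U" "e j \<in> sec E U"
    using frame_section[OF U_open] ij by auto
  have "dfun X (\<lambda>x. inn E x (e j x) (e i x)) y v = 0"
    by (rule dfun_const[OF manifold U_open, of _ "if j = i then 1 else 0"])
      (use y ij in \<open>simp_all add: orthonormal\<close>)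
  moreover have "dfun X (\<lambda>x. inn E x (e j x) (e i x)) y v
      = inn E y (nab E y v (e j)) (e i y) + inn E y (e j y) (nab E y v (e i))"
    by (rule euclidean_connectionD(2)[OF conn U_open s(2) y s(1)])
  moreover have "nab E y v (e i) \<in> fib E y"
    by (rule euclidean_connectionD(1)[OF conn U_open s(1) y])
  then have "inn E y (e j y) (nab E y v (e i)) = inn E y (nab E y v (e i)) (e j y)"
    using frame_fib[OF y ij(2)]
      eb[unfolded euclidean_bundle_def, THEN conjunct1, THEN bspec, of y, THEN conjunct2, THEN conjunct1]
      y openin_subset[OF U_open] by blast
  ultimately show ?thesis by linarith
qed

lemma con_coord_complexify:
  "con_coord X (complexify X E) p i j u =
     complex_of_real \<circ> ((\<lambda>y. inn E y (nab E y (tan_vec X c y u) (e j)) (e i y)) \<circ> chart_inv c)"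
  by (simp add: con_coord_def complexify_def Let_def fun_eq_iff c_def e_def)

lemma con_coord_skew:
  assumes "i < rk E" "j < rk E" "z \<in> snd c ` (U \<inter> fst c)"
  shows "con_coord X (complexify X E) p j i u z = - con_coord X (complexify X E) p i j u z"
  using assms connection_skew[of _ j i] chart_inv_left[OF manifold c_atlas]
  by (auto simp: con_coord_complexify)

text \<open>The entries pair the derivative of a frame section along a coordinate field with a frame
  section. That derivative is again a smooth section, and smoothness of sections is expressed
  through these very pairings.\<close>

lemma regular: "regular_at X (complexify X E) p"
  unfolding regular_at_def
proof (intro conjI ballI allI)
  show "finite (idx (complexify X E))" by (simp add: complexify_def)
  fix i j u assume "i \<in> idx (complexify X E)" "j \<in> idx (complexify X E)"
  then have ij: "i < rk E" "j < rk E" by (simp_all add: complexify_def)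
  define W where "W = U \<inter> fst c"
  have W: "openin (mtop X) W" "W \<subseteq> U" "W \<subseteq> fst c" "p \<in> W"
    using U_open chart_open[OF manifold c_atlas] frame(1) p_chart by (auto simp: W_def)
  have sec: "(\<lambda>y. nab E y (tan_vec X c y u) (e j)) \<in> sec E W"
    using euclidean unfolding euclidean_bundle_conn_def
    by (elim conjE) (rule euclidean_connectionD(3)[OF _ W(1) frame_section[OF W(1,2) ij(2)]
        smooth_vf_coordinate[OF manifold c_atlas W(1,3)]])
  have "smooth_fun X W (\<lambda>y. inn E y (nab E y (tan_vec X c y u) (e j)) (e i y))"
    using orthonormal_frameD(4)[OF frame(2) W(1,2), THEN iffD1, OF sec] ij by simp
  from smooth_fun_differentiable[OF manifold this W(4) c_atlas p_chart]
  have "((\<lambda>y. inn E y (nab E y (tan_vec X c y u) (e j)) (e i y)) \<circ> chart_inv c) differentiable (at (snd c p))" .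
  then show "con_coord X (complexify X E) p i j u differentiable (at (snd (chart_at X p) p))"
    unfolding con_coord_complexify c_def[symmetric] differentiable_def o_def
    using bounded_linear.has_derivative[OF bounded_linear_of_real] by blast
qed

lemma curv_skew:
  assumes ij: "i < rk E" "j < rk E"
  shows "curv X (complexify X E) p j i = - curv X (complexify X E) p i j"
proof (rule curv_eqI)
  fix u v :: 'm
  let ?w = "con_coord X (complexify X E) p" and ?z = "snd c p"
  have z: "?z \<in> snd c ` (U \<inter> fst c)" using frame(1) p_chart by blast
  have d: "frechet_derivative (?w j i v) (at ?z) u = - frechet_derivative (?w i j v) (at ?z) u" for u v
  proof -
    have "frechet_derivative (?w j i v) (at ?z) = frechet_derivative (\<lambda>x. - ?w i j v x) (at ?z)"
      using chart_image_open[OF manifold c_atlas U_open] z con_coord_skew[OF ij]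
      by (intro frechet_derivative_cong_open) auto
    also have "\<dots> = (\<lambda>h. - frechet_derivative (?w i j v) (at ?z) h)"
      using regular_atD(2)[OF regular, of i j v] ij unfolding c_def[symmetric]
      by (intro frechet_derivative_at[symmetric] has_derivative_minus) (simp add: complexify_def)
    finally show ?thesis by simp
  qed
  \<comment> \<open>Transposing both entries restores the sign but exchanges the roles of
    \<open>u\<close> and \<open>v\<close>, and this produces the minus.\<close>
  have s: "(\<Sum>k<rk E. ?w j k u ?z * ?w k i v ?z - ?w j k v ?z * ?w k i u ?z)
      = - (\<Sum>k<rk E. ?w i k u ?z * ?w k j v ?z - ?w i k v ?z * ?w k j u ?z)" for u v
    unfolding sum_negf[symmetric]
  proof (intro sum.cong refl)
    fix k assume "k \<in> {..<rk E}"
    then have k: "k < rk E" by simp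
    have "?w j k t ?z = - ?w k j t ?z" "?w k i t ?z = - ?w i k t ?z" for t
      using con_coord_skew[OF k ij(2) z] con_coord_skew[OF ij(1) k z] by auto
    then show "?w j k u ?z * ?w k i v ?z - ?w j k v ?z * ?w k i u ?z
        = - (?w i k u ?z * ?w k j v ?z - ?w i k v ?z * ?w k j u ?z)"
      by simp
  qed
  have "idx (complexify X E) = {..<rk E}" by (simp add: complexify_def)
  then show "form_val (curv X (complexify X E) p j i) [u, v] = form_val (- curv X (complexify X E) p i j) [u, v]"
    by (simp add: form_val_curv_pair d s c_def[symmetric])
qed (simp add: form_val_curv_eq_0)

end

section \<open>Curvature of tensor products and squares\<close>

text \<open>The mixed products are symmetric under exchanging the primed and unprimed matrices, so
  they cancel.\<close>

lemma tensor_mat_commutator: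
  fixes A B A' B' :: "nat \<Rightarrow> nat \<Rightarrow> 'a::comm_ring_1"
  assumes "finite I" "finite J" "m \<in> prod_encode ` (I \<times> J)" "n \<in> prod_encode ` (I \<times> J)"
  shows "(\<Sum>q\<in>prod_encode ` (I \<times> J). tensor_mat A B m q * tensor_mat A' B' q n - tensor_mat A' B' m q * tensor_mat A B q n)
    = tensor_mat (\<lambda>i j. \<Sum>k\<in>I. A i k * A' k j - A' i k * A k j) (\<lambda>i j. \<Sum>k\<in>J. B i k * B' k j - B' i k * B k j) m n"
proof -
  obtain k l i j where mn: "m = prod_encode (k, l)" "n = prod_encode (i, j)"
    and kl: "k \<in> I" "l \<in> J" "i \<in> I" "j \<in> J"
    using assms(3,4) by auto
  have prod: "(\<Sum>q\<in>prod_encode ` (I \<times> J). tensor_mat A B m q * tensor_mat A' B' q n)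
    = (\<Sum>a\<in>I. A k a * A' a i) * of_bool (l = j) + (A k i * B' l j + A' k i * B l j)
      + of_bool (k = i) * (\<Sum>b\<in>J. B l b * B' b j)" for A B A' B' :: "nat \<Rightarrow> nat \<Rightarrow> 'a"
  proof -
    have "(\<Sum>q\<in>prod_encode ` (I \<times> J). tensor_mat A B m q * tensor_mat A' B' q n)
      = (\<Sum>a\<in>I. \<Sum>b\<in>J. (if b = l then A k a * A' a i * of_bool (l = j) else 0)
         + (if b = l then if a = i then A k i * B' l j else 0 else 0)
         + (if b = j then if a = k then A' k i * B l j else 0 else 0)
         + (if a = k then of_bool (k = i) * (B l b * B' b j) else 0))"
      unfolding mn sum_prod_encode sum.cartesian_product' tensor_mat_encode
      by (intro sum.cong refl) (auto simp: algebra_simps)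
    also have "\<dots> = (\<Sum>a\<in>I. A k a * A' a i * of_bool (l = j)) + (A k i * B' l j + A' k i * B l j)
        + (\<Sum>b\<in>J. of_bool (k = i) * (B l b * B' b j))"
    proof -
      have "(\<Sum>a\<in>I. \<Sum>b\<in>J. if a = k then of_bool (k = i) * (B l b * B' b j) else 0)
        = (\<Sum>b\<in>J. of_bool (k = i) * (B l b * B' b j))"
        using assms(1) kl by (subst sum.swap) simp
      then show ?thesis using assms(1,2) kl by (simp add: sum.distrib)
    qed
    finally show ?thesis by (simp add: sum_distrib_left sum_distrib_right)
  qed
  have "(\<Sum>q\<in>prod_encode ` (I \<times> J). tensor_mat A B m q * tensor_mat A' B' q n - tensor_mat A' B' m q * tensor_mat A B q n)
    = ((\<Sum>a\<in>I. A k a * A' a i) - (\<Sum>a\<in>I. A' k a * A a i)) * of_bool (l = j)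
      + of_bool (k = i) * ((\<Sum>b\<in>J. B l b * B' b j) - (\<Sum>b\<in>J. B' l b * B b j))"
    by (simp only: sum_subtractf prod) (simp add: algebra_simps)
  then show ?thesis by (simp only: mn tensor_mat_encode sum_subtractf)
qed

lemma con_coord_tensor:
  "con_coord X (tensor E F) p m n u z
    = tensor_mat (\<lambda>i j. con_coord X E p i j u z) (\<lambda>i j. con_coord X F p i j u z) m n"
  by (simp add: con_coord_def tensor_def tensor_mat_def Let_def)

text \<open>The derivative part is linear in the connection matrix, where \<open>regular_at\<close>
  justifies termwise differentiation; the quadratic part is a commutator.\<close>

lemma curv_tensor:
  assumes "regular_at X E p" "regular_at X F p" "m \<in> idx (tensor E F)" "n \<in> idx (tensor E F)"
  shows "curv X (tensor E F) p m n = tensor_mat (curv X E p) (curv X F p) m n"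
proof (rule curv_eqI)
  fix u v :: 'b
  let ?z = "snd (chart_at X p) p"
  obtain k l i j where mn: "m = prod_encode (k, l)" "n = prod_encode (i, j)"
    and kl: "k \<in> idx E" "l \<in> idx F" "i \<in> idx E" "j \<in> idx F"
    using assms(3,4) by (auto simp: tensor_def)
  have d: "frechet_derivative (con_coord X (tensor E F) p m n v) (at ?z) u
      = tensor_mat (\<lambda>i j. frechet_derivative (con_coord X E p i j v) (at ?z) u)
         (\<lambda>i j. frechet_derivative (con_coord X F p i j v) (at ?z) u) m n" for u v
  proof -
    have "con_coord X (tensor E F) p m n v = (\<lambda>z. con_coord X E p k i v z * of_bool (l = j)
        + of_bool (k = i) * con_coord X F p l j v z)"
      by (simp add: fun_eq_iff con_coord_tensor mn)
    moreover have "((\<lambda>z. con_coord X E p k i v z * of_bool (l = j)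
        + of_bool (k = i) * con_coord X F p l j v z) has_derivative
        (\<lambda>h. frechet_derivative (con_coord X E p k i v) (at ?z) h * of_bool (l = j)
           + of_bool (k = i) * frechet_derivative (con_coord X F p l j v) (at ?z) h)) (at ?z)"
      by (intro has_derivative_add has_derivative_mult_left has_derivative_mult_right
          regular_atD[OF assms(1)] regular_atD[OF assms(2)] kl)
    ultimately show ?thesis
      by (simp add: mn flip: frechet_derivative_at)
  qed
  have fin: "finite (idx E)" "finite (idx F)"
    using regular_atD(1)[OF assms(1)] regular_atD(1)[OF assms(2)] by auto
  let ?D = "\<lambda>E u v i j. frechet_derivative (con_coord X E p i j v) (at ?z) u"
  let ?w = "\<lambda>E u i j. con_coord X E p i j u ?z"
  let ?C = "\<lambda>E i j. \<Sum>k\<in>idx E. ?w E u i k * ?w E v k j - ?w E v i k * ?w E u k j"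
  have idx: "idx (tensor E F) = prod_encode ` (idx E \<times> idx F)" by (simp add: tensor_def)
  have "form_val (curv X (tensor E F) p m n) [u, v]
    = tensor_mat (?D E u v) (?D F u v) m n - tensor_mat (?D E v u) (?D F v u) m n + tensor_mat (?C E) (?C F) m n"
    using assms(3,4) by (simp only: form_val_curv_pair d con_coord_tensor idx tensor_mat_commutator[OF fin])
  also have "\<dots> = tensor_mat (\<lambda>i j. form_val (curv X E p i j) [u, v]) (\<lambda>i j. form_val (curv X F p i j) [u, v]) m n"
    by (simp add: mn form_val_curv_pair algebra_simps)
  finally show "form_val (curv X (tensor E F) p m n) [u, v] = form_val (tensor_mat (curv X E p) (curv X F p) m n) [u, v]"
    by (simp add: mn)
qed (auto simp: tensor_mat_def form_val_curv_eq_0 split: prod.splits)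

lemma con_coord_square:
  "con_coord X (square_bundle J \<kappa> E) p m n u z
    = square_mat (idx E) \<kappa> (\<lambda>i j. con_coord X E p i j u z) m n"
  by (simp add: con_coord_def square_bundle_def square_mat_def Let_def)

lemma form_val_times_const: "form_val (\<omega> * const_form z) vs = z * form_val \<omega> vs"
  by (metis const_form_times even_form_commute even_form_intros(3))

text \<open>As for tensor products, with a change of coefficient ring: \<open>\<kappa>\<close> is
  complex for the connection matrix and becomes a constant form for the curvature.\<close>

lemma curv_square:
  assumes "square_quotient (idx E) J \<epsilon> \<kappa>" "regular_at X E p"
    and "m \<in> prod_encode ` J" "n \<in> prod_encode ` J"
  shows "curv X (square_bundle J \<kappa> E) p m n
    = square_mat (idx E) (\<lambda>q r. const_form (\<kappa> q r)) (curv X E p) m n"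
proof (rule curv_eqI)
  interpret square_quotient "idx E" J \<epsilon> \<kappa> by fact
  fix u v :: 'b
  let ?z = "snd (chart_at X p) p"
  obtain i j where n: "n = prod_encode (i, j)" and ij: "i \<in> idx E" "j \<in> idx E"
    using assms(4) J_subset by auto
  have d: "frechet_derivative (con_coord X (square_bundle J \<kappa> E) p m n v) (at ?z) u
      = square_mat (idx E) \<kappa> (\<lambda>i j. frechet_derivative (con_coord X E p i j v) (at ?z) u) m n" for u v
  proof -
    have "con_coord X (square_bundle J \<kappa> E) p m n v = (\<lambda>z. \<Sum>a\<in>idx E. con_coord X E p a i v z * \<kappa> (prod_decode m) (a, j)
        + con_coord X E p a j v z * \<kappa> (prod_decode m) (i, a))"
      by (simp add: fun_eq_iff con_coord_square square_mat_def n)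
    moreover have "((\<lambda>z. \<Sum>a\<in>idx E. con_coord X E p a i v z * \<kappa> (prod_decode m) (a, j)
        + con_coord X E p a j v z * \<kappa> (prod_decode m) (i, a)) has_derivative
        (\<lambda>h. \<Sum>a\<in>idx E. frechet_derivative (con_coord X E p a i v) (at ?z) h * \<kappa> (prod_decode m) (a, j)
        + frechet_derivative (con_coord X E p a j v) (at ?z) h * \<kappa> (prod_decode m) (i, a))) (at ?z)"
      by (intro has_derivative_sum has_derivative_add has_derivative_mult_left
          regular_atD[OF assms(2)] ij)
    ultimately show ?thesis
      by (simp add: n square_mat_def flip: frechet_derivative_at)
  qed
  let ?D = "\<lambda>u v i j. frechet_derivative (con_coord X E p i j v) (at ?z) u"
  let ?w = "\<lambda>u i j. con_coord X E p i j u ?z"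
  let ?S = "square_mat (idx E) \<kappa>"
  have "idx (square_bundle J \<kappa> E) = prod_encode ` J" by (simp add: square_bundle_def)
  then have "form_val (curv X (square_bundle J \<kappa> E) p m n) [u, v]
    = ?S (?D u v) m n - ?S (?D v u) m n + ?S (\<lambda>i j. \<Sum>k\<in>idx E. ?w u i k * ?w v k j - ?w v i k * ?w u k j) m n"
    by (simp only: form_val_curv_pair d con_coord_square square_mat_commutator[OF assms(3,4)])
  also have "\<dots> = ?S (\<lambda>i j. form_val (curv X E p i j) [u, v]) m n"
    by (simp add: n square_mat_def form_val_curv_pair algebra_simps flip: sum.distrib sum_subtractf)
  finally show "form_val (curv X (square_bundle J \<kappa> E) p m n) [u, v]
      = form_val (square_mat (idx E) (\<lambda>q r. const_form (\<kappa> q r)) (curv X E p) m n) [u, v]"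
    by (simp add: n square_mat_def form_val_sum form_val_times_const mult.commute)
qed (simp add: square_mat_def form_val_sum form_val_times_const form_val_curv_eq_0 split: prod.splits)

section \<open>Chern forms\<close>

lemma Rep_simps:
  "Rep 0 = 0" "Rep 1 = 1" "Rep (a + b) = Rep a + Rep b" "Rep (a - b) = Rep a - Rep b"
  "Rep (- a) = - Rep a" "Rep (a * b) = Rep a * Rep b" "Rep (econst z) = const_form z"
  by (simp_all add: zero_eform.rep_eq one_eform.rep_eq plus_eform.rep_eq minus_eform.rep_eq
      uminus_eform.rep_eq times_eform.rep_eq econst.rep_eq)

lemma Rep_of_bool: "Rep (of_bool b) = of_bool b"
  by (cases b) (simp_all add: Rep_simps)

lemma Rep_numeral: "Rep (numeral n) = numeral n"
proof -
  have "Rep (of_nat k :: 'a eform) = of_nat k" for k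
    by (induction k) (simp_all add: Rep_simps)
  from this[of "numeral n"] show ?thesis by simp
qed

lemma even_form_Rep: "even_form (Rep a)"
  using Rep[of a] by simp

lemma eform_cancel_2: "2 * a = 2 * b \<Longrightarrow> a = b" for a b :: "'v eform"
proof -
  have "econst (1 / 2) * (2 * a) = a" for a :: "'v eform"
    unfolding mult.assoc[symmetric] econst_numeral[symmetric] econst_hom(4)[symmetric]
    by (simp add: econst_hom)
  then show "2 * a = 2 * b \<Longrightarrow> a = b" by metis
qed

lemma even_series_Rep_times: "even_series (Rep (a * b)) = even_series (Rep a) * even_series (Rep b)"
  by (simp add: Rep_simps even_series_times even_form_Rep)

definition chern_entry :: "('x, 'm::real_normed_vector) mfd \<Rightarrow> ('x, 'm) cbundle \<Rightarrow> 'x \<Rightarrow> nat \<Rightarrow> nat \<Rightarrow> 'm eform" where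
  "chern_entry X E p i j = Even (chern_matrix X E p i j)"

definition chern_trace :: "('x, 'm::real_normed_vector) mfd \<Rightarrow> ('x, 'm) cbundle \<Rightarrow> 'x \<Rightarrow> nat \<Rightarrow> 'm eform" where
  "chern_trace X E p n = pow_trace (idx E) (chern_entry X E p) n"

lemma even_form_curv: "even_form (curv X E p i j)"
  by (auto simp: even_form_def intro!: form_val_curv_eq_0)

lemma Rep_chern_entry: "Rep (chern_entry X E p i j) = const_form (\<i> / (2 * of_real pi)) * curv X E p i j"
  by (simp add: chern_entry_def chern_matrix_def Even_inverse even_form_times even_form_intros even_form_curv)

lemma homogeneous_2:
  assumes "\<And>vs. length vs \<noteq> 2 \<Longrightarrow> form_val (Rep a) vs = 0"
  shows "even_series (Rep a) = fps_const a * fps_X"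
proof (rule even_series_eqI, rule form_eqI)
  fix n and vs :: "'a list"
  show "form_val (deg_part (2 * n) (Rep a)) vs = form_val (Rep ((fps_const a * fps_X) $ n)) vs"
    by (auto simp: form_val_deg_part Rep_simps assms)
qed

lemma even_series_chern_entry: "even_series (Rep (chern_entry X E p i j)) = fps_const (chern_entry X E p i j) * fps_X"
  by (rule homogeneous_2) (simp add: Rep_chern_entry const_form_times form_val_curv_eq_0)

lemma fps_const_sum: "fps_const (\<Sum>i\<in>I. f i) = (\<Sum>i\<in>I. fps_const (f i))"
  by (induction I rule: infinite_finite_induct) (simp_all flip: fps_const_add)

lemma even_series_mat_pow:
  assumes "\<And>i j. even_series (Rep (A i j)) = fps_const (A i j) * fps_X"
  shows "even_series (Rep (mat_pow I A n i j)) = fps_const (mat_pow I A n i j) * fps_X ^ n"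
proof (induction n arbitrary: i j)
  case 0
  then show ?case by (simp add: Rep_simps even_series_0 even_series_1)
next
  case (Suc n)
  have "even_series (Rep (mat_pow I A (Suc n) i j)) = (\<Sum>k\<in>I. even_series (Rep (A i k)) * even_series (Rep (mat_pow I A n k j)))"
    by (simp add: Rep_sum even_series_sum even_series_Rep_times)
  also have "\<dots> = (\<Sum>k\<in>I. fps_const (A i k * mat_pow I A n k j)) * fps_X ^ Suc n"
    unfolding assms Suc.IH sum_distrib_right
    by (intro sum.cong refl) (simp flip: fps_const_mult add: ac_simps)
  finally show ?case by (simp add: fps_const_sum)
qed

lemma even_series_chern_trace: "even_series (Rep (chern_trace X E p n)) = fps_const (chern_trace X E p n) * fps_X ^ n"
  by (simp add: chern_trace_def pow_trace_def Rep_sum even_series_sum even_series_mat_pow[OF even_series_chern_entry] sum_distrib_right fps_const_sum)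

lemma Rep_mat_pow: "Rep (mat_pow I A n i j) = mat_pow I (\<lambda>i j. Rep (A i j)) n i j"
  by (induction n arbitrary: i j) (simp_all add: Rep_of_bool Rep_sum Rep_simps)

lemma tr_series_chern_trace:
  "tr_series a X E p = Form (\<lambda>vs. \<Sum>k\<le>length vs. a $ k * form_val (Rep (chern_trace X E p k)) vs)"
proof -
  have "chern_matrix X E p = (\<lambda>i j. Rep (chern_entry X E p i j))"
    by (simp add: Rep_chern_entry chern_matrix_def fun_eq_iff)
  then show ?thesis by (simp add: tr_series_def chern_trace_def pow_trace_def Rep_sum Rep_mat_pow)
qed

lemma even_form_tr_series: "even_form (tr_series a X E p)"
proof -
  have "form_val (Rep (chern_trace X E p k)) vs = 0" if "odd (length vs)" for k vs
    using even_form_Rep[of "chern_trace X E p k"] that by (simp add: even_form_def)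
  then show ?thesis by (simp add: even_form_def tr_series_chern_trace)
qed

text \<open>The trace of the k-th power is homogeneous of degree \<open>2 * k\<close>, so of the
  terms summed in \<open>tr_series\<close> only \<open>k = n\<close> reaches degree
  \<open>2 * n\<close>.\<close>

lemma even_series_tr_series: "even_series (tr_series a X E p) $ n = econst (a $ n) * chern_trace X E p n"
proof -
  have "deg_part (2 * n) (tr_series a X E p)
    = (\<Sum>k\<le>2 * n. const_form (a $ k) * deg_part (2 * n) (Rep (chern_trace X E p k)))"
    by (rule form_eqI) (auto simp: form_val_deg_part tr_series_chern_trace form_val_sum const_form_times)
  also have "\<dots> = (\<Sum>k\<le>2 * n. if k = n then Rep (econst (a $ k) * chern_trace X E p k) else 0)"
    unfolding Rep_even_series[symmetric] even_series_chern_trace by (intro sum.cong refl) (auto simp: Rep_simps)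
  also have "\<dots> = Rep (econst (a $ n) * chern_trace X E p n)" by simp
  finally show ?thesis by (metis Rep_even_series Rep_inject)
qed

section \<open>Chern characters of tensor products and squares\<close>

definition ch_series :: "('x, 'm::real_normed_vector) mfd \<Rightarrow> ('x, 'm) cbundle \<Rightarrow> 'x \<Rightarrow> 'm eform fps" where
  "ch_series X E p = even_series (ch_bundle X E p)"

lemma ch_series_nth: "ch_series X E p $ n = econst (1 / fact n) * chern_trace X E p n"
  by (simp add: ch_series_def ch_bundle_def even_series_tr_series)

lemma mat_pow_cong:
  assumes "\<And>i j. i \<in> I \<Longrightarrow> j \<in> I \<Longrightarrow> A i j = B i j"
  shows "i \<in> I \<Longrightarrow> j \<in> I \<Longrightarrow> mat_pow I A n i j = mat_pow I B n i j"
  by (induction n arbitrary: i) (simp_all add: assms)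

lemma pow_trace_cong:
  assumes "\<And>i j. i \<in> I \<Longrightarrow> j \<in> I \<Longrightarrow> A i j = B i j"
  shows "pow_trace I A n = pow_trace I B n"
  unfolding pow_trace_def by (intro sum.cong refl mat_pow_cong[OF assms])

lemma chern_trace_tensor:
  assumes "regular_at X E p" "regular_at X F p"
  shows "chern_trace X (tensor E F) p n = (\<Sum>r\<le>n. of_nat (n choose r) * (chern_trace X E p r * chern_trace X F p (n - r)))"
proof -
  have "chern_entry X (tensor E F) p i j = tensor_mat (chern_entry X E p) (chern_entry X F p) i j"
    if "i \<in> idx (tensor E F)" "j \<in> idx (tensor E F)" for i j
  proof -
    have "Rep (chern_entry X (tensor E F) p i j) = Rep (tensor_mat (chern_entry X E p) (chern_entry X F p) i j)"
      unfolding Rep_chern_entry curv_tensor[OF assms that]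
      by (simp add: tensor_mat_def case_prod_unfold Let_def Rep_simps Rep_of_bool Rep_chern_entry algebra_simps of_bool_def)
    then show ?thesis by (simp add: Rep_inject)
  qed
  then have "chern_trace X (tensor E F) p n = pow_trace (idx (tensor E F)) (tensor_mat (chern_entry X E p) (chern_entry X F p)) n"
    unfolding chern_trace_def by (rule pow_trace_cong)
  moreover have "idx (tensor E F) = prod_encode ` (idx E \<times> idx F)" by (simp add: tensor_def)
  ultimately show ?thesis
    using pow_trace_tensor[OF regular_atD(1)[OF assms(1)] regular_atD(1)[OF assms(2)]] by (simp add: chern_trace_def)
qed

text \<open>Division by factorials turns the binomial convolution of traces into the Cauchy product
  of Chern characters.\<close>

lemma econst_binomial:
  assumes "r \<le> n"
  shows "econst (1 / fact n) * (of_nat (n choose r) * (a * b))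
    = (econst (1 / fact r) * a) * (econst (1 / fact (n - r)) * b)"
proof -
  have "(1 / fact n) * of_nat (n choose r) = (1 / fact r) * (1 / fact (n - r) :: complex)"
    using assms by (simp add: binomial_fact field_simps)
  then have "econst (1 / fact n) * of_nat (n choose r) = econst (1 / fact r) * econst (1 / fact (n - r))"
    by (metis econst_hom(4) econst_of_nat)
  then show ?thesis by (metis (no_types, opaque_lifting) mult.assoc mult.left_commute)
qed

lemma ch_series_nth_square:
  "(ch_series X E p * ch_series X F p) $ n
    = econst (1 / fact n) * (\<Sum>r\<le>n. of_nat (n choose r) * (chern_trace X E p r * chern_trace X F p (n - r)))"
  by (simp add: fps_mult_nth ch_series_nth sum_distrib_left econst_binomial atMost_atLeast0)

lemma ch_series_tensor:
  assumes "regular_at X E p" "regular_at X F p"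
  shows "ch_series X (tensor E F) p = ch_series X E p * ch_series X F p"
  by (rule fps_ext) (simp only: ch_series_nth_square ch_series_nth[of X "tensor E F"] chern_trace_tensor[OF assms])

text \<open>Two instances of the quotient appear: complex coefficients for the curvature of the
  bundle, even forms for the trace of its powers.\<close>

lemma chern_trace_square:
  assumes q: "square_quotient (idx E) J \<epsilon> \<kappa>"
    and q': "square_quotient (idx E) J \<epsilon>' (\<lambda>q r. econst (\<kappa> q r))"
    and reg: "regular_at X E p"
  shows "2 * chern_trace X (square_bundle J \<kappa> E) p n
    = (\<Sum>r\<le>n. of_nat (n choose r) * (chern_trace X E p r * chern_trace X E p (n - r))) + \<epsilon>' * (2 ^ n * chern_trace X E p n)"
proof -
  have "chern_entry X (square_bundle J \<kappa> E) p i j = square_mat (idx E) (\<lambda>q r. econst (\<kappa> q r)) (chern_entry X E p) i j"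
    if "i \<in> prod_encode ` J" "j \<in> prod_encode ` J" for i j
  proof -
    have "Rep (chern_entry X (square_bundle J \<kappa> E) p i j)
      = Rep (square_mat (idx E) (\<lambda>q r. econst (\<kappa> q r)) (chern_entry X E p) i j)"
      unfolding Rep_chern_entry curv_square[OF q reg that]
      by (simp add: square_mat_def case_prod_unfold Let_def Rep_simps Rep_sum Rep_chern_entry
          sum_distrib_left distrib_left mult.assoc)
    then show ?thesis by (simp add: Rep_inject)
  qed
  then have "pow_trace (prod_encode ` J) (chern_entry X (square_bundle J \<kappa> E) p) n
    = pow_trace (prod_encode ` J) (square_mat (idx E) (\<lambda>q r. econst (\<kappa> q r)) (chern_entry X E p)) n"
    by (rule pow_trace_cong)
  moreover have "idx (square_bundle J \<kappa> E) = prod_encode ` J" by (simp add: square_bundle_def)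
  ultimately show ?thesis
    using square_quotient.pow_trace_square[OF q', of "chern_entry X E p" n] by (simp add: chern_trace_def)
qed

lemma ch_series_square:
  assumes "square_quotient (idx E) J \<epsilon> \<kappa>"
    and "square_quotient (idx E) J \<epsilon>' (\<lambda>q r. econst (\<kappa> q r))" and "regular_at X E p"
  shows "2 * ch_series X (square_bundle J \<kappa> E) p $ n = (ch_series X E p ^ 2) $ n + \<epsilon>' * (2 ^ n * ch_series X E p $ n)"
proof -
  have "2 * ch_series X (square_bundle J \<kappa> E) p $ n = econst (1 / fact n) * (2 * chern_trace X (square_bundle J \<kappa> E) p n)"
    by (simp add: ch_series_nth mult.left_commute)
  also have "\<dots> = (ch_series X E p * ch_series X E p) $ n + \<epsilon>' * (2 ^ n * ch_series X E p $ n)"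
    unfolding chern_trace_square[OF assms] ch_series_nth_square by (simp add: ch_series_nth algebra_simps)
  finally show ?thesis by (simp only: power2_eq_square)
qed

text \<open>The factor \<open>2 ^ n\<close> is the second Adams operation in degree
  \<open>2 * n\<close>, which doubles all Chern roots.\<close>

lemma ch_series_ext2:
  assumes "regular_at X E p"
  shows "2 * ch_series X (ext2 E) p $ n = (ch_series X E p ^ 2) $ n - 2 ^ n * ch_series X E p $ n"
proof -
  let ?J = "{(k, l) \<in> idx E \<times> idx E. k < l}"
  have fin: "finite (idx E)" by (rule regular_atD(1)[OF assms])
  have "ext2 E = square_bundle ?J ext2_coeff E" by (simp add: ext2_def ext2_coeff_def)
  moreover have "square_quotient (idx E) ?J (-1) (ext2_coeff :: _ \<Rightarrow> _ \<Rightarrow> complex)"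
    by (rule square_quotient_ext2[OF fin]) simp
  moreover have "square_quotient (idx E) ?J (-1) (ext2_coeff :: _ \<Rightarrow> _ \<Rightarrow> 'b eform)"
    by (rule square_quotient_ext2[OF fin]) (metis add.right_inverse eform_cancel_2 mult_2 mult_zero_right)
  moreover have "(\<lambda>q r. econst (ext2_coeff q r)) = (ext2_coeff :: _ \<Rightarrow> _ \<Rightarrow> 'b eform)"
    by (auto simp: ext2_coeff_def fun_eq_iff econst_hom)
  ultimately show ?thesis using ch_series_square[OF _ _ assms, of ?J "-1" ext2_coeff "-1"] by simp
qed

lemma ch_series_sym2:
  assumes "regular_at X E p"
  shows "2 * ch_series X (sym2 E) p $ n = (ch_series X E p ^ 2) $ n + 2 ^ n * ch_series X E p $ n"
proof -
  let ?J = "{(k, l) \<in> idx E \<times> idx E. k \<le> l}"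
  have fin: "finite (idx E)" by (rule regular_atD(1)[OF assms])
  have "sym2 E = square_bundle ?J sym2_coeff E" by (simp add: sym2_def sym2_coeff_def)
  moreover have "(\<lambda>q r. econst (sym2_coeff q r)) = (sym2_coeff :: _ \<Rightarrow> _ \<Rightarrow> 'b eform)"
    by (auto simp: sym2_coeff_def fun_eq_iff econst_hom)
  ultimately show ?thesis
    using ch_series_square[OF square_quotient_sym2[OF fin] _ assms, of 1] square_quotient_sym2[OF fin, where 'a = "'b eform"]
    by simp
qed

lemma con_coord_trivial_line: "con_coord X (trivial_line X) p i j u = (\<lambda>z. 0)"
  by (simp add: con_coord_def trivial_line_def Let_def fun_eq_iff)

lemma regular_at_trivial_line: "regular_at X (trivial_line X) p"
  unfolding regular_at_def con_coord_trivial_line by (simp add: trivial_line_def)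

lemma ch_series_trivial_line: "ch_series X (trivial_line X) p = 1"
proof -
  have "curv X (trivial_line X) p i j = 0" for i j
    by (rule curv_eqI) (simp_all add: form_val_curv_pair con_coord_trivial_line)
  then have "Rep (chern_entry X (trivial_line X) p i j) = Rep 0" for i j
    by (simp add: Rep_chern_entry Rep_simps)
  then have "chern_entry X (trivial_line X) p i j = 0" for i j by (simp add: Rep_inject)
  then have "chern_trace X (trivial_line X) p n = of_bool (n = 0)" for n
    by (cases n) (simp_all add: chern_trace_def pow_trace_def trivial_line_def)
  then show ?thesis by (intro fps_ext) (simp add: ch_series_nth econst_hom)
qed

section \<open>Chern characters of virtual bundles\<close>

lemma ch_eq_sum:
  assumes "finite S" "Poly_Mapping.keys V \<subseteq> S"
  shows "ch X V p = (\<Sum>E\<in>S. of_int (Poly_Mapping.lookup V E) * ch_bundle X E p)"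
  unfolding ch_def by (rule sum.mono_neutral_left) (use assms in \<open>auto simp: in_keys_iff\<close>)

lemma ch_add: "ch X (V + W) p = ch X V p + ch X W p"
proof -
  let ?S = "Poly_Mapping.keys V \<union> Poly_Mapping.keys W"
  have "Poly_Mapping.keys (V + W) \<subseteq> ?S" by (rule Poly_Mapping.keys_add)
  then show ?thesis
    by (simp add: ch_eq_sum[of ?S] lookup_add distrib_right sum.distrib)
qed

lemma ch_cmul: "ch X (frag_cmul k V) p = of_int k * ch X V p"
  using keys_cmul[of k V]
  by (simp add: ch_eq_sum[of "Poly_Mapping.keys V"] sum_distrib_left mult.assoc)

lemma ch_diff: "ch X (V - W) p = ch X V p - ch X W p"
  using ch_add[of X V "frag_cmul (-1) W" p] ch_cmul[of X "-1" W p] by simp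

lemma ch_of: "ch X (frag_of E) p = ch_bundle X E p"
  by (simp add: ch_def)

definition ch_vseries :: "('x, 'm::real_normed_vector) mfd \<Rightarrow> ('x, 'm) vbundle \<Rightarrow> 'x \<Rightarrow> 'm eform fps" where
  "ch_vseries X V p = even_series (ch X V p)"

lemma ch_vseries_simps:
  "ch_vseries X (V + W) p = ch_vseries X V p + ch_vseries X W p"
  "ch_vseries X (V - W) p = ch_vseries X V p - ch_vseries X W p"
  "ch_vseries X (frag_cmul k V) p = of_int k * ch_vseries X V p"
  "ch_vseries X (frag_of E) p = ch_series X E p"
  "ch_vseries X (vtrivial X k) p = of_int k"
  by (simp_all add: ch_vseries_def ch_add ch_diff ch_cmul ch_of even_series_add even_series_diff even_series_times even_series_of_int
      even_form_of_int vtrivial_def ch_series_trivial_line flip: ch_series_def)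

lemma vtensor_simps:
  "(V + V') \<otimes>\<^sub>v W = V \<otimes>\<^sub>v W + V' \<otimes>\<^sub>v W"
  "(V - V') \<otimes>\<^sub>v W = V \<otimes>\<^sub>v W - V' \<otimes>\<^sub>v W"
  "frag_cmul k V \<otimes>\<^sub>v W = frag_cmul k (V \<otimes>\<^sub>v W)"
  "frag_of E \<otimes>\<^sub>v (W + W') = frag_of E \<otimes>\<^sub>v W + frag_of E \<otimes>\<^sub>v W'"
  "frag_of E \<otimes>\<^sub>v (W - W') = frag_of E \<otimes>\<^sub>v W - frag_of E \<otimes>\<^sub>v W'"
  "frag_of E \<otimes>\<^sub>v frag_cmul k W = frag_cmul k (frag_of E \<otimes>\<^sub>v W)"
  "frag_of E \<otimes>\<^sub>v frag_of F = frag_of (tensor E F)"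
  by (simp_all add: vtensor_def frag_extend_add frag_extend_diff frag_extend_cmul)

context framed_point
begin

lemma chern_trace_0: "chern_trace X (complexify X E) p 0 = of_nat (rk E)"
  by (simp add: chern_trace_def pow_trace_def complexify_def)

lemma chern_entry_skew:
  assumes "i < rk E" "j < rk E"
  shows "chern_entry X (complexify X E) p j i = - chern_entry X (complexify X E) p i j"
proof -
  have "Rep (chern_entry X (complexify X E) p j i) = Rep (- chern_entry X (complexify X E) p i j)"
    by (simp add: Rep_chern_entry Rep_simps curv_skew[OF assms])
  then show ?thesis by (simp add: Rep_inject)
qed

lemma chern_trace_odd: "odd n \<Longrightarrow> chern_trace X (complexify X E) p n = 0"
proof -
  assume "odd n"
  have "2 * pow_trace {..<rk E} (chern_entry X (complexify X E) p) n = 0"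
    by (rule pow_trace_skew_odd[OF _ _ \<open>odd n\<close>]) (auto intro: chern_entry_skew)
  then show ?thesis
    using eform_cancel_2[of "chern_trace X (complexify X E) p n" 0] by (simp add: chern_trace_def complexify_def)
qed

end

section \<open>Coefficients up to degree 12\<close>

text \<open>With S = 2 sinh (x/2), logarithmic differentiation of \<open>a * S = fps_X\<close> gives
  the equation \<open>ode\<close>, which determines the coefficients of \<open>L\<close> one by one
  without expanding the composition.\<close>

lemma ahat_log_coeffs:
  defines "L \<equiv> fps_compose (fps_ln 1) (ahat_fps - 1)"
  shows "L $ 0 = 0" "L $ 2 = - 1 / 24" "L $ 4 = 1 / 2880" "L $ 6 = - 1 / 181440"
proof -
  define S :: "complex fps" where "S = fps_exp (1/2) - fps_exp (- 1/2)"
  have S: "S $ n = ((1/2) ^ n - (- 1/2) ^ n) / fact n" for n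
    by (simp add: S_def diff_divide_distrib)
  have "S $ 1 = 1" by (simp add: S)
  then have S_nz: "S \<noteq> 0" by auto
  have sub: "subdegree S = 1"
    by (rule subdegreeI) (simp_all add: S)
  define a where "a = ahat_fps"
  \<comment> \<open>The quotient in \<open>ahat_fps\<close> is an exact division because
    \<open>S\<close> has subdegree 1.\<close>
  have aS: "a * S = fps_X"
  proof -
    have "S dvd fps_X"
      using S_nz sub by (simp add: fps_dvd_iff)
    then show ?thesis by (simp add: a_def ahat_fps_def S_def)
  qed
  have a0: "a $ 0 = 1"
  proof -
    have "(a * S) $ 1 = a $ 0 * S $ 1 + a $ 1 * S $ 0" by (simp add: fps_mult_nth)
    then show ?thesis by (simp add: aS S)
  qed
  have L0: "L $ 0 = 0" by (simp add: L_def)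
  have dL: "fps_deriv L = inverse a * fps_deriv a"
  proof -
    have "fps_deriv L = (inverse (1 + fps_X) oo (a - 1)) * fps_deriv (a - 1)"
      unfolding L_def a_def[symmetric]
      by (subst fps_compose_deriv) (simp_all add: a0 fps_ln_deriv)
    also have "inverse (1 + fps_X) oo (a - 1) = inverse ((1 + fps_X) oo (a - 1))"
      by (rule fps_inverse_compose) (simp_all add: a0)
    also have "(1 + fps_X) oo (a - 1) = a"
      by (simp add: fps_compose_add_distrib a0)
    finally show ?thesis by simp
  qed
  have ode: "fps_X * fps_deriv L * S = S - fps_X * fps_deriv S"
  proof -
    have "fps_deriv (a * S) = 1" by (simp add: aS)
    then have 1: "fps_deriv a * S + a * fps_deriv S = 1" by (simp add: add.commute)
    have "fps_deriv a * S * S = (fps_deriv a * S + a * fps_deriv S) * S - (a * S) * fps_deriv S"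
      by (simp add: algebra_simps)
    then have "fps_deriv a * S * S = S - fps_X * fps_deriv S"
      by (simp only: 1 aS mult_1_left)
    moreover have "fps_X * fps_deriv L = fps_deriv a * S"
    proof -
      have "fps_X * fps_deriv L = S * (a * inverse a) * fps_deriv a"
        by (simp add: dL aS[symmetric] ac_simps)
      then show ?thesis using a0 by (simp add: inverse_mult_eq_1' mult.commute)
    qed
    ultimately show ?thesis by simp
  qed
  have XD: "(fps_X * fps_deriv F) $ n = of_nat n * F $ n" for F :: "complex fps" and n
    by (cases n) simp_all
  have rec: "(\<Sum>i=0..n. of_nat i * L $ i * S $ (n - i)) = S $ n - of_nat n * S $ n" for n
    using arg_cong[OF ode, of "\<lambda>F. F $ n"]
    by (simp only: fps_mult_nth[of "fps_X * fps_deriv L"] XD fps_sub_nth)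
  have S_val: "S $ 0 = 0" "S $ 1 = 1" "S $ 2 = 0" "S $ 3 = 1 / 24" "S $ 4 = 0" "S $ 5 = 1 / 1920"
    "S $ 6 = 0" "S $ 7 = 1 / 322560"
    by (simp_all add: S power_numeral_reduce fact_numeral)
  have e: "{0..2::nat} = {0,1,2}" "{0..3::nat} = {0,1,2,3}" "{0..4::nat} = {0,1,2,3,4}"
    "{0..5::nat} = {0,1,2,3,4,5}" "{0..6::nat} = {0,1,2,3,4,5,6}" "{0..7::nat} = {0,1,2,3,4,5,6,7}"
    by auto
  note S_val' = S_val S_val(2)[unfolded One_nat_def]
  have L1: "L $ 1 = 0" using rec[of 2] S_val' by (simp add: e)
  then have L1': "L $ Suc 0 = 0" by simp
  have L2: "L $ 2 = - 1 / 24" using rec[of 3] S_val' L1' by (simp add: e field_simps)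
  have L3: "L $ 3 = 0" using rec[of 4] S_val' L1' L2 by (simp add: e)
  have L4: "L $ 4 = 1 / 2880" using rec[of 5] S_val' L1' L2 L3 by (simp add: e field_simps)
  have L5: "L $ 5 = 0" using rec[of 6] S_val' L1' L2 L3 L4 by (simp add: e)
  \<comment> \<open>The recursion at 7 with cleared denominators; the common factor 92160 is
    cancelled next.\<close>
  have "92160 * (L $ 6 * 181440 + 1) = 0"
    using rec[of 7] S_val' L1' L2 L3 L4 L5 by (simp add: e field_simps)
  then have "L $ 6 * 181440 + 1 = 0" by (simp only: mult_eq_0_iff) simp
  then have "L $ 6 * 181440 = - 1" by (simp only: eq_neg_iff_add_eq_0)
  then show "L $ 6 = - 1 / 181440" by (simp only: eq_divide_eq) simp
  show "L $ 0 = 0" "L $ 2 = - 1 / 24" "L $ 4 = 1 / 2880"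
    by (fact L0 L2 L4)+
qed

text \<open>Coefficient n has degree 2n, so these are the components of degree 2, 6 and 10.\<close>

definition even_upto_6 :: "'a::comm_ring_1 fps \<Rightarrow> bool" where
  "even_upto_6 F \<longleftrightarrow> F $ 1 = 0 \<and> F $ 3 = 0 \<and> F $ 5 = 0"

lemma atLeastAtMost_0_numerals:
  "{0..1::nat} = {0,1}" "{0..2::nat} = {0,1,2}" "{0..3::nat} = {0,1,2,3}" "{0..4::nat} = {0,1,2,3,4}"
  "{0..5::nat} = {0,1,2,3,4,5}" "{0..6::nat} = {0,1,2,3,4,5,6}"
  by auto

text \<open>\<open>G\<close> may have odd coefficients, as exp (c/2) does: at an even index their
  partners in \<open>F\<close> are 0.\<close>

lemma even_upto_6_mult_nth:
  assumes "even_upto_6 F"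
  shows "(F * G) $ 0 = F $ 0 * G $ 0"
    and "(F * G) $ 2 = F $ 0 * G $ 2 + F $ 2 * G $ 0"
    and "(F * G) $ 4 = F $ 0 * G $ 4 + F $ 2 * G $ 2 + F $ 4 * G $ 0"
    and "(F * G) $ 6 = F $ 0 * G $ 6 + F $ 2 * G $ 4 + F $ 4 * G $ 2 + F $ 6 * G $ 0"
    and "even_upto_6 G \<Longrightarrow> even_upto_6 (F * G)"
  using assms by (simp_all add: fps_mult_nth even_upto_6_def atLeastAtMost_0_numerals)

lemma even_upto_6_intros:
  "even_upto_6 1" "even_upto_6 (numeral n)"
  "even_upto_6 F \<Longrightarrow> even_upto_6 G \<Longrightarrow> even_upto_6 (F + G)"
  "even_upto_6 F \<Longrightarrow> even_upto_6 G \<Longrightarrow> even_upto_6 (F - G)"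
  "even_upto_6 F \<Longrightarrow> even_upto_6 G \<Longrightarrow> even_upto_6 (F * G)"
  by (simp_all add: even_upto_6_mult_nth) (simp_all add: even_upto_6_def fps_numeral_nth)

text \<open>The series play the roles of \<open>exp (p/24)\<close>, \<open>Ahat (TZ)\<close>, \<open>exp (c/2)\<close>, \<open>ch (\<wedge>\<^sup>2F)\<close>, \<open>ch (TZ)\<close>,
  \<open>ch F\<close> for \<open>F = F\<^sub>1 - F\<^sub>2\<close>, \<open>ch\<close> of the reduced \<open>\<xi>\<close>, and \<open>p\<close>. The odd coefficients of \<open>ec\<close> do not
  contribute.\<close>

lemma anomaly_coefficient:
  fixes Q A ec L T F x P :: "'a::comm_ring_1 fps" and x1 x2 x3 y1 y2 y3 \<gamma> :: 'a
  assumes Q: "even_upto_6 Q" "Q $ 0 = 1" "Q $ 2 = 6 * (x1 - y1)" "Q $ 4 = 18 * (x1 - y1)\<^sup>2"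
      "Q $ 6 = 36 * (x1 - y1) ^ 3"
    and A: "even_upto_6 A" "A $ 0 = 1" "A $ 2 = - 6 * x1" "A $ 4 = x2 + 18 * x1\<^sup>2"
      "A $ 6 = - x3 - 6 * x1 * x2 - 36 * x1 ^ 3"
    and ec: "ec $ 0 = 1" "ec $ 2 = 450 * \<gamma>" "ec $ 4 = 33750 * \<gamma>\<^sup>2" "ec $ 6 = 1012500 * \<gamma> ^ 3"
    and T: "even_upto_6 T" "T $ 0 = 10" "T $ 2 = 144 * x1" "T $ 4 = 240 * x2" "T $ 6 = 504 * x3"
    and F: "even_upto_6 F" "F $ 0 = 32" "F $ 2 = 144 * y1" "F $ 4 = 240 * y2" "F $ 6 = 504 * y3"
    and L: "even_upto_6 L" "L $ 0 = 496" "L $ 2 = 30 * (144 * y1)" "L $ 4 = 24 * (240 * y2) + 10368 * y1\<^sup>2"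
      "L $ 6 = 34560 * (y1 * y2)"
    and x: "even_upto_6 x" "x $ 0 = 0" "x $ 2 = 3600 * \<gamma>" "x $ 4 = 1080000 * \<gamma>\<^sup>2" "x $ 6 = 129600000 * \<gamma> ^ 3"
    and P: "even_upto_6 P" "P $ 0 = 0" "P $ 2 = 144 * (x1 - y1)" "P $ 4 = 0" "P $ 6 = 0"
  shows "(Q * A * (L + T - 2 + 5 * x\<^sup>2 + 3 * ((1 - F) * x) - P) * ec) $ 6 = 0"
proof -
  define M where "M = L + T - 2 + 5 * x\<^sup>2 + 3 * ((1 - F) * x) - P"
  have M_even: "even_upto_6 M"
    unfolding M_def power2_eq_square by (intro even_upto_6_intros L T F x P)
  \<comment> \<open>504 = 496 + 10 - 2. Against the term \<open>504 * x3\<close> of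
    \<open>M $ 6\<close>, it cancels the term \<open>- x3\<close> of \<open>H $ 6\<close>.\<close>
  have M0: "M $ 0 = 504" and M2: "M $ 2 = 4464 * y1 - 334800 * \<gamma>"
    and M4: "M $ 4 = 5760 * y2 + 10368 * y1\<^sup>2 + 240 * x2 - 35640000 * \<gamma>\<^sup>2 - 1555200 * y1 * \<gamma>"
    and M6: "M $ 6 = 34560 * (y1 * y2) + 504 * x3 + 26827200000 * \<gamma> ^ 3 - 466560000 * y1 * \<gamma>\<^sup>2
      - 2592000 * y2 * \<gamma>"
    unfolding M_def power2_eq_square fps_sub_nth fps_add_nth
      even_upto_6_mult_nth(1-4)[OF x(1)] even_upto_6_mult_nth(1-4)[OF even_upto_6_intros(2)]
      even_upto_6_mult_nth(1-4)[OF even_upto_6_intros(4)[OF even_upto_6_intros(1) F(1)]]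
      L T F x P
    by (simp_all add: fps_numeral_nth algebra_simps power2_eq_square power3_eq_cube)
  define H where "H = Q * A"
  have H_even: "even_upto_6 H" unfolding H_def by (intro even_upto_6_intros Q A)
  \<comment> \<open>The factor exp (p/24) removes the first Pontryagin form of TZ from the
    \<open>ahat\<close> series, so \<open>x1\<close> disappears.\<close>
  have H0: "H $ 0 = 1" and H2: "H $ 2 = - 6 * y1"
    and H4: "H $ 4 = x2 + 18 * y1\<^sup>2"
    and H6: "H $ 6 = - x3 - 6 * y1 * x2 - 36 * y1 ^ 3"
    unfolding H_def even_upto_6_mult_nth[OF Q(1)] Q A
    by (simp_all add: algebra_simps power2_eq_square power3_eq_cube)
  show ?thesis
    unfolding M_def[symmetric] H_def[symmetric]
      even_upto_6_mult_nth(4)[OF even_upto_6_mult_nth(5)[OF H_even M_even]]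
      even_upto_6_mult_nth(1-4)[OF H_even] H0 H2 H4 H6 M0 M2 M4 M6 ec
    by (simp add: algebra_simps power2_eq_square power3_eq_cube)
qed

text \<open>\<open>N\<close> starts at index 2, so its k-th power starts at index
  \<open>2 * k\<close> and only the first three powers reach index 6.\<close>

lemma form_series_coeffs:
  fixes \<omega> :: "'v form"
  defines "N \<equiv> even_series \<omega>"
  assumes even: "even_form \<omega>" and N: "even_upto_6 N" "N $ 0 = 0"
  shows "even_upto_6 (even_series (form_series a \<omega>))"
    and "even_series (form_series a \<omega>) $ 0 = econst (a $ 0)"
    and "even_series (form_series a \<omega>) $ 2 = econst (a $ 1) * N $ 2"
    and "even_series (form_series a \<omega>) $ 4 = econst (a $ 1) * N $ 4 + econst (a $ 2) * (N $ 2)\<^sup>2"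
    and "even_series (form_series a \<omega>) $ 6 = econst (a $ 1) * N $ 6 + econst (a $ 2) * (2 * (N $ 2 * N $ 4))
      + econst (a $ 3) * (N $ 2) ^ 3"
proof -
  note series = even_series_form_series[OF even N(2)[unfolded N_def], folded N_def]
  have e: "{..1::nat} = {0,1}" "{..2::nat} = {0,1,2}" "{..3::nat} = {0,1,2,3}" "{..4::nat} = {0,1,2,3,4}"
    "{..5::nat} = {0,1,2,3,4,5}" "{..6::nat} = {0,1,2,3,4,5,6}"
    by auto
  have ev: "even_upto_6 (N ^ k)" for k
    by (induction k) (simp_all add: even_upto_6_intros N)
  have odd: "(N ^ k) $ 1 = 0" "(N ^ k) $ 3 = 0" "(N ^ k) $ 5 = 0" for k
    using ev[of k] by (simp_all add: even_upto_6_def)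
  note mult = even_upto_6_mult_nth(1-4)[OF N(1)]
  have p2: "(N ^ 2) $ 0 = 0" "(N ^ 2) $ 2 = 0" "(N ^ 2) $ 4 = (N $ 2)\<^sup>2" "(N ^ 2) $ 6 = 2 * (N $ 2 * N $ 4)"
    unfolding power2_eq_square mult N(2) by (simp_all add: mult.commute)
  have p3: "(N ^ 3) $ 0 = 0" "(N ^ 3) $ 2 = 0" "(N ^ 3) $ 4 = 0" "(N ^ 3) $ 6 = (N $ 2) ^ 3"
  proof -
    have "N ^ 3 = N * N ^ 2" by (simp add: power3_eq_cube power2_eq_square mult.assoc)
    then show "(N ^ 3) $ 0 = 0" "(N ^ 3) $ 2 = 0" "(N ^ 3) $ 4 = 0" "(N ^ 3) $ 6 = (N $ 2) ^ 3"
      by (simp_all only: mult N(2) p2) (simp_all add: power3_eq_cube power2_eq_square mult.assoc)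
  qed
  have p4: "(N ^ (k + 4)) $ 0 = 0" "(N ^ (k + 4)) $ 2 = 0" "(N ^ (k + 4)) $ 4 = 0" "(N ^ (k + 4)) $ 6 = 0" for k
  proof (induction k)
    case 0
    have "N ^ 4 = N * N ^ 3" by (simp add: power_numeral_reduce)
    then show "(N ^ (0 + 4)) $ 0 = 0" "(N ^ (0 + 4)) $ 2 = 0" "(N ^ (0 + 4)) $ 4 = 0" "(N ^ (0 + 4)) $ 6 = 0"
      by (simp_all add: mult N p3)
  next
    case (Suc k)
    then show "(N ^ (Suc k + 4)) $ 0 = 0" "(N ^ (Suc k + 4)) $ 2 = 0" "(N ^ (Suc k + 4)) $ 4 = 0" "(N ^ (Suc k + 4)) $ 6 = 0"
      by (simp_all only: add_Suc power_Suc mult N mult_zero_left mult_zero_right add_0)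
  qed
  note p456 = p4[of 0, simplified] p4[of 1, simplified] p4[of 2, simplified]
  show "even_upto_6 (even_series (form_series a \<omega>))"
    unfolding even_upto_6_def series by (simp only: odd) simp
  show "even_series (form_series a \<omega>) $ 0 = econst (a $ 0)"
    by (simp add: series)
  show "even_series (form_series a \<omega>) $ 2 = econst (a $ 1) * N $ 2"
    by (simp add: series e p2)
  show "even_series (form_series a \<omega>) $ 4 = econst (a $ 1) * N $ 4 + econst (a $ 2) * (N $ 2)\<^sup>2"
    by (simp add: series e p2 p3 p456)
  show "even_series (form_series a \<omega>) $ 6 = econst (a $ 1) * N $ 6 + econst (a $ 2) * (2 * (N $ 2 * N $ 4))
      + econst (a $ 3) * (N $ 2) ^ 3"
    by (simp add: series e p2 p3 p456)
qed

lemma numeral_econst: "numeral n * (econst z * a) = econst (numeral n * z) * a"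
  by (simp add: econst_hom econst_numeral mult.assoc)

lemma econst_times_numeral: "econst z * (numeral n * a) = econst (z * numeral n) * a"
  by (simp add: econst_hom econst_numeral mult.assoc)

lemma econst_assoc: "econst y * (econst z * a) = econst (y * z) * a"
  by (simp add: econst_hom mult.assoc)

lemma fps_numeral_mult_nth: "(numeral k * F) $ n = numeral k * F $ n" for F :: "'a::comm_ring_1 fps"
  by (simp add: numeral_fps_const)

context framed_point
begin

text \<open>The power sums \<open>\<Sum>y\<^sub>j\<^sup>2\<close>, \<open>\<Sum>y\<^sub>j\<^sup>4\<close>, \<open>\<Sum>y\<^sub>j\<^sup>6\<close> divided by 144, 2880 and 181440 (a trace
  counts both \<open>y\<^sub>j\<close> and \<open>-y\<^sub>j\<close>). With this scaling, and with \<open>c\<^sup>2 / 3600\<close> in place of \<open>c\<^sup>2\<close>, all the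
  coefficients below are integers.\<close>

definition "s1 = econst (1 / 288) * chern_trace X (complexify X E) p 2"
definition "s2 = econst (1 / 5760) * chern_trace X (complexify X E) p 4"
definition "s3 = econst (1 / 362880) * chern_trace X (complexify X E) p 6"

lemma chern_trace_s:
  "econst z * chern_trace X (complexify X E) p 2 = econst (288 * z) * s1"
  "econst z * chern_trace X (complexify X E) p 4 = econst (5760 * z) * s2"
  "econst z * chern_trace X (complexify X E) p 6 = econst (362880 * z) * s3"
  by (simp_all add: s1_def s2_def s3_def econst_assoc)

lemma ch_series_coeffs:
  "even_upto_6 (ch_series X (complexify X E) p)"
  "ch_series X (complexify X E) p $ 0 = of_nat (rk E)"
  "ch_series X (complexify X E) p $ 2 = 144 * s1"
  "ch_series X (complexify X E) p $ 4 = 240 * s2"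
  "ch_series X (complexify X E) p $ 6 = 504 * s3"
  by (simp_all add: even_upto_6_def ch_series_nth chern_trace_odd chern_trace_0 econst_hom chern_trace_s fact_numeral econst_numeral)

text \<open>The scaling makes the logarithm of the \<open>ahat\<close> series
  \<open>- 6 * s1\<close>, \<open>s2\<close>, \<open>- s3\<close> at indices 2, 4, 6. The 6 absorbs
  the denominators of the exponential: 18 = 36 / 2 and 36 = 216 / 6.\<close>

lemma ahat_coeffs:
  "even_upto_6 (even_series (ahat X E p))"
  "even_series (ahat X E p) $ 0 = 1"
  "even_series (ahat X E p) $ 2 = - 6 * s1"
  "even_series (ahat X E p) $ 4 = s2 + 18 * s1\<^sup>2"
  "even_series (ahat X E p) $ 6 = - s3 - 6 * s1 * s2 - 36 * s1 ^ 3"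
proof -
  let ?t = "tr_series (fps_compose (fps_ln 1) (ahat_fps - 1)) X (complexify X E) p"
  have t: "even_upto_6 (even_series ?t)" "even_series ?t $ 0 = 0" "even_series ?t $ 2 = - 12 * s1" "even_series ?t $ 4 = 2 * s2" "even_series ?t $ 6 = - 2 * s3"
    by (simp_all only: even_upto_6_def even_series_tr_series ahat_log_coeffs chern_trace_s chern_trace_odd)
      (simp_all add: chern_trace_odd econst_hom econst_numeral)
  note series = form_series_coeffs[OF even_form_tr_series t(1,2), where a = "fps_exp (1/2)",
      folded ahat_def, unfolded t]
  show "even_upto_6 (even_series (ahat X E p))" by (rule series(1))
  show "even_series (ahat X E p) $ 0 = 1" by (simp add: series econst_hom)
  show "even_series (ahat X E p) $ 2 = - 6 * s1" 
    "even_series (ahat X E p) $ 4 = s2 + 18 * s1\<^sup>2"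
    "even_series (ahat X E p) $ 6 = - s3 - 6 * s1 * s2 - 36 * s1 ^ 3"
    by (simp_all only: series fps_exp_nth econst_numeral[symmetric] econst_hom(3)[symmetric] mult_minus_left)
      (simp_all add: fact_numeral power_divide econst_hom econst_numeral power_mult_distrib
          econst_times_numeral)
qed

lemma even_form_ahat: "even_form (ahat X E p)"
  unfolding ahat_def by (intro even_form_series even_form_tr_series)

lemma even_form_pont1: "even_form (pont1 X E p)"
  unfolding pont1_def by (intro even_form_times even_form_intros even_form_tr_series)

lemma even_series_pont1: "even_series (pont1 X E p) = fps_const (144 * s1) * fps_X ^ 2"
proof (rule fps_ext)
  fix n
  have "even_series (pont1 X E p) $ n = econst (1 / 2) * (econst ((fps_X ^ 2) $ n) * chern_trace X (complexify X E) p n)"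
    by (simp add: pont1_def even_series_times even_form_intros even_series_const even_series_tr_series)
  also have "\<dots> = (fps_const (144 * s1) * fps_X ^ 2) $ n"
    by (simp add: fps_X_power_iff econst_hom chern_trace_s econst_numeral)
  finally show "even_series (pont1 X E p) $ n = (fps_const (144 * s1) * fps_X ^ 2) $ n" .
qed

text \<open>The unit 3600 is chosen so that it, its square and its cube are divisible by 8, 384 and
  46080, the denominators of c^2, c^4 and c^6 in exp (c/2).\<close>

definition "eul2 pos = econst (1 / 3600) * (even_series (euler2 X E pos p) $ 1)\<^sup>2"

lemma even_form_euler2: "even_form (euler2 X E pos p)"
  unfolding euler2_def Let_def by (intro even_form_times even_form_intros even_form_curv)

lemma even_series_euler2: "even_series (euler2 X E pos p) = fps_const (even_series (euler2 X E pos p) $ 1) * fps_X"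
proof -
  define a where "a = Even (euler2 X E pos p)"
  have a: "Rep a = euler2 X E pos p" by (simp add: a_def Even_inverse even_form_euler2)
  have "even_series (Rep a) = fps_const a * fps_X"
    by (rule homogeneous_2) (simp add: a euler2_def Let_def const_form_times form_val_curv_eq_0)
  then show ?thesis by (simp add: a)
qed

lemma exp_euler2_coeffs:
  "even_form (form_series (fps_exp (1/2)) (euler2 X E pos p))"
  "even_series (form_series (fps_exp (1/2)) (euler2 X E pos p)) $ 0 = 1"
  "even_series (form_series (fps_exp (1/2)) (euler2 X E pos p)) $ 2 = 450 * eul2 pos"
  "even_series (form_series (fps_exp (1/2)) (euler2 X E pos p)) $ 4 = 33750 * (eul2 pos)\<^sup>2"
  "even_series (form_series (fps_exp (1/2)) (euler2 X E pos p)) $ 6 = 1012500 * eul2 pos ^ 3"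
proof -
  define a where "a = even_series (euler2 X E pos p) $ 1"
  note even_series_a = even_series_euler2[of pos, folded a_def]
  have nth: "even_series (form_series (fps_exp (1/2)) (euler2 X E pos p)) $ n = econst ((1/2) ^ n / fact n) * a ^ n" for n
  proof -
    have "even_series (form_series (fps_exp (1/2)) (euler2 X E pos p)) $ n
      = (\<Sum>k\<le>n. econst ((1/2) ^ k / fact k) * ((fps_const a * fps_X) ^ k) $ n)"
      by (subst even_series_form_series[OF even_form_euler2]) (simp_all add: even_series_a)
    also have "\<dots> = (\<Sum>k\<le>n. if k = n then econst ((1/2) ^ k / fact k) * a ^ k else 0)"
      by (intro sum.cong refl) (auto simp: power_mult_distrib fps_const_power)
    finally show ?thesis by simp
  qed
  show "even_form (form_series (fps_exp (1/2)) (euler2 X E pos p))"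
    by (intro even_form_series even_form_euler2)
  show "even_series (form_series (fps_exp (1/2)) (euler2 X E pos p)) $ 0 = 1"
    by (simp add: nth econst_hom)
  define b where "b = a\<^sup>2"
  have a_pow: "a ^ 2 = b" "a ^ 4 = b\<^sup>2" "a ^ 6 = b ^ 3" by (simp_all add: b_def flip: power_mult)
  have eul2: "eul2 pos = econst (1 / 3600) * b" by (simp only: eul2_def a_def b_def)
  show "even_series (form_series (fps_exp (1/2)) (euler2 X E pos p)) $ 2 = 450 * eul2 pos"
    "even_series (form_series (fps_exp (1/2)) (euler2 X E pos p)) $ 4 = 33750 * (eul2 pos)\<^sup>2"
    "even_series (form_series (fps_exp (1/2)) (euler2 X E pos p)) $ 6 = 1012500 * eul2 pos ^ 3"
    by (simp_all only: nth a_pow eul2 power_mult_distrib econst_power[symmetric] numeral_econst)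
      (simp_all add: fact_numeral power_divide)
qed

text \<open>A skew matrix of size 2 with entry b squares to -b^2 times the identity. Here -b^2 =
  c^2, since b is i / (2 pi) times a curvature entry and c is, up to sign, 1 / (2 pi) times the same
  entry. The Chern roots are thus c and -c.\<close>

lemma rank_2_traces:
  assumes rk: "rk E = 2"
  shows "chern_trace X (complexify X E) p (Suc (Suc n)) = (even_series (euler2 X E pos p) $ 1)\<^sup>2 * chern_trace X (complexify X E) p n"
proof -
  define a where "a = even_series (euler2 X E pos p) $ 1"
  define b where "b = chern_entry X (complexify X E) p 0 1"
  have idx: "idx (complexify X E) = {0, 1}" by (auto simp: complexify_def rk)
  have diag: "chern_entry X (complexify X E) p i i = 0" if "i < 2" for i
  proof -
    have "2 * chern_entry X (complexify X E) p i i = 2 * 0"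
      using chern_entry_skew[of i i] that rk by (metis mult_2 add.right_inverse mult_zero_right)
    then show ?thesis by (rule eform_cancel_2)
  qed
  have entries: "chern_entry X (complexify X E) p 0 0 = 0" "chern_entry X (complexify X E) p 1 1 = 0"
    "chern_entry X (complexify X E) p 0 1 = b" "chern_entry X (complexify X E) p 1 0 = - b"
    using diag[of 0] diag[of 1] chern_entry_skew[of 0 1] rk by (simp_all add: b_def)
  have sq: "b * - b = a\<^sup>2"
  proof -
    define r where "r = Even (curv X (complexify X E) p 0 1)"
    have Rr: "Rep r = curv X (complexify X E) p 0 1" by (simp add: r_def Even_inverse even_form_curv)
    have b: "b = econst (\<i> / (2 * of_real pi)) * r"
      by (simp add: b_def Rep_chern_entry Rr Rep_simps flip: Rep_inject)
    \<comment> \<open>\<open>\<sigma>\<close> is the orientation sign in \<open>euler2\<close>; it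
      disappears from the square of c.\<close>
    obtain \<sigma> :: complex where \<sigma>: "\<sigma> * \<sigma> = 1" "euler2 X E pos p = Rep (econst (\<sigma> / (2 * of_real pi)) * r)"
    proof
      let ?s = "if (snd (frame_at X E p) 0 p, snd (frame_at X E p) 1 p) \<in> pos p then 1 else -1 :: complex"
      show "?s * ?s = 1" by simp
      show "euler2 X E pos p = Rep (econst (?s / (2 * of_real pi)) * r)"
        by (simp add: euler2_def Let_def Rep_simps Rr)
    qed
    have "even_series (Rep (econst (\<sigma> / (2 * of_real pi)) * r)) = fps_const (econst (\<sigma> / (2 * of_real pi)) * r) * fps_X"
      by (rule homogeneous_2) (simp add: Rep_simps Rr const_form_times form_val_curv_eq_0)
    then have a: "a = econst (\<sigma> / (2 * of_real pi)) * r" by (simp add: a_def \<sigma>(2))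
    have "econst z * r * - (econst z * r) = econst (- (z * z)) * (r * r)" for z
      by (simp add: econst_hom ac_simps)
    then have "b * - b = econst (- ((\<i> / (2 * of_real pi)) * (\<i> / (2 * of_real pi)))) * (r * r)"
      by (simp only: b)
    also have "- ((\<i> / (2 * of_real pi)) * (\<i> / (2 * of_real pi))) = (\<sigma> / (2 * of_real pi)) * (\<sigma> / (2 * of_real pi))"
      using \<sigma>(1) by simp
    also have "econst \<dots> * (r * r) = a\<^sup>2"
      by (simp only: a econst_hom(4) power2_eq_square ac_simps)
    finally show ?thesis .
  qed
  show ?thesis
    unfolding chern_trace_def pow_trace_def idx a_def[symmetric] sq[symmetric]
    by (simp add: entries[unfolded One_nat_def] algebra_simps)
qed

lemma reduced_rank_2_coeffs:
  assumes rk: "rk E = 2"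
  shows "even_upto_6 (ch_series X (complexify X E) p - 2)"
    and "(ch_series X (complexify X E) p - 2) $ 0 = 0"
    and "(ch_series X (complexify X E) p - 2) $ 2 = 3600 * eul2 pos"
    and "(ch_series X (complexify X E) p - 2) $ 4 = 1080000 * (eul2 pos)\<^sup>2"
    and "(ch_series X (complexify X E) p - 2) $ 6 = 129600000 * eul2 pos ^ 3"
proof -
  define a where "a = even_series (euler2 X E pos p) $ 1"
  note tr = rank_2_traces[OF rk, of _ pos, folded a_def]
  have t0: "chern_trace X (complexify X E) p 0 = 2" by (simp add: chern_trace_0 rk)
  have t: "chern_trace X (complexify X E) p 2 = 2 * a\<^sup>2" "chern_trace X (complexify X E) p 4 = 2 * (a\<^sup>2)\<^sup>2"
     "chern_trace X (complexify X E) p 6 = 2 * (a\<^sup>2) ^ 3"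
  proof -
    have "chern_trace X (complexify X E) p 2 = a\<^sup>2 * chern_trace X (complexify X E) p 0"
      using tr[of 0] by (simp add: numeral_2_eq_2)
    moreover have "chern_trace X (complexify X E) p 4 = a\<^sup>2 * chern_trace X (complexify X E) p 2"
      "chern_trace X (complexify X E) p 6 = a\<^sup>2 * chern_trace X (complexify X E) p 4"
      using tr[of 2] tr[of 4] by simp_all
    ultimately show "chern_trace X (complexify X E) p 2 = 2 * a\<^sup>2" "chern_trace X (complexify X E) p 4 = 2 * (a\<^sup>2)\<^sup>2"
      "chern_trace X (complexify X E) p 6 = 2 * (a\<^sup>2) ^ 3"
      by (simp_all add: t0 power2_eq_square power3_eq_cube)
  qed
  show "even_upto_6 (ch_series X (complexify X E) p - 2)"
    by (intro even_upto_6_intros ch_series_coeffs)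
  show "(ch_series X (complexify X E) p - 2) $ 0 = 0"
    by (simp add: ch_series_coeffs rk fps_numeral_nth)
  show "(ch_series X (complexify X E) p - 2) $ 2 = 3600 * eul2 pos"
    "(ch_series X (complexify X E) p - 2) $ 4 = 1080000 * (eul2 pos)\<^sup>2"
    "(ch_series X (complexify X E) p - 2) $ 6 = 129600000 * eul2 pos ^ 3"
  proof -
    define b where "b = a\<^sup>2"
    have "eul2 pos = econst (1 / 3600) * b" by (simp only: eul2_def a_def b_def)
    then show "(ch_series X (complexify X E) p - 2) $ 2 = 3600 * eul2 pos"
      "(ch_series X (complexify X E) p - 2) $ 4 = 1080000 * (eul2 pos)\<^sup>2"
      "(ch_series X (complexify X E) p - 2) $ 6 = 129600000 * eul2 pos ^ 3"
      by (simp_all only: ch_series_nth t[folded b_def] fps_sub_nth fps_numeral_nth power_mult_distrib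
          econst_power[symmetric] econst_numeral[symmetric] econst_assoc)
        (simp_all add: fact_numeral power_divide econst_numeral)
  qed
qed

end

text \<open>The hypothesis on \<open>L\<close> is the formula \<open>2 ch (\<wedge>\<^sup>2F) = (ch F)\<^sup>2 - ch (\<psi>\<^sup>2F)\<close>.\<close>

lemma virtual_square_coeffs:
  fixes F L :: "'v eform fps"
  assumes F: "even_upto_6 F" "F $ 0 = 32" "F $ 2 = 144 * y1" "F $ 4 = 240 * y2" "F $ 6 = 504 * y3"
    and L: "\<And>n. 2 * L $ n = (F ^ 2) $ n - 2 ^ n * F $ n"
  shows "even_upto_6 L" "L $ 0 = 496" "L $ 2 = 30 * (144 * y1)" "L $ 4 = 24 * (240 * y2) + 10368 * y1\<^sup>2"
    "L $ 6 = 34560 * (y1 * y2)"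
proof -
  have "even_upto_6 (F ^ 2)" unfolding power2_eq_square by (intro even_upto_6_intros F)
  then have "2 * L $ n = 2 * 0" if "n = 1 \<or> n = 3 \<or> n = 5" for n
    using that F(1) unfolding L even_upto_6_def by auto
  then show "even_upto_6 L"
    unfolding even_upto_6_def by (blast intro: eform_cancel_2)
  note sq = even_upto_6_mult_nth(1-4)[OF F(1)]
  \<comment> \<open>The power sum of order n enters linearly with the factor 2 * 32 - 2 ^ n, that is
    60, 48 and 0 for n = 2, 4, 6; the last removes \<open>y3\<close>.\<close>
  have "2 * L $ 0 = 2 * 496" "2 * L $ 2 = 2 * (30 * (144 * y1))"
    "2 * L $ 4 = 2 * (24 * (240 * y2) + 10368 * y1\<^sup>2)" "2 * L $ 6 = 2 * (34560 * (y1 * y2))"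
    unfolding L power2_eq_square sq F by (simp_all add: algebra_simps)
  then show "L $ 0 = 496" "L $ 2 = 30 * (144 * y1)" "L $ 4 = 24 * (240 * y2) + 10368 * y1\<^sup>2"
    "L $ 6 = 34560 * (y1 * y2)"
    by (simp_all only: eform_cancel_2)
qed

section \<open>From coefficients to the identity of forms\<close>

lemma ch_vseries_of_vtensor_reduced:
  assumes "regular_at X E p" "regular_at X F p"
  shows "ch_vseries X (frag_of E \<otimes>\<^sub>v vreduced X F) p = ch_series X E p * (ch_series X F p - of_nat (card (idx F)))"
  by (simp add: vreduced_def vtrivial_def vtensor_simps ch_vseries_simps ch_series_tensor assms regular_at_trivial_line
      ch_series_trivial_line algebra_simps)

text \<open>By \<open>anomaly_coefficient\<close>, Q \<open>A\<close> \<open>ec\<close>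
  \<open>M\<close> and P Q \<open>A\<close> \<open>ec\<close> agree in degree 12. Splitting Q as 1 +
  P Z isolates the left side; every other term carries the factor P, which is \<open>\<pi>\<close>
  in degree 4 and leaves a component of degree 8.\<close>

lemma anomaly_identity:
  fixes P A ec L T F x Q Z :: "'v eform fps"
  assumes A: "even_upto_6 A" "A $ 0 = 1" "A $ 2 = - 6 * x1" "A $ 4 = x2 + 18 * x1\<^sup>2"
      "A $ 6 = - x3 - 6 * x1 * x2 - 36 * x1 ^ 3"
    and ec: "ec $ 0 = 1" "ec $ 2 = 450 * \<gamma>" "ec $ 4 = 33750 * \<gamma>\<^sup>2" "ec $ 6 = 1012500 * \<gamma> ^ 3"
    and T: "even_upto_6 T" "T $ 0 = 10" "T $ 2 = 144 * x1" "T $ 4 = 240 * x2" "T $ 6 = 504 * x3"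
    and F: "even_upto_6 F" "F $ 0 = 32" "F $ 2 = 144 * y1" "F $ 4 = 240 * y2" "F $ 6 = 504 * y3"
    and L: "\<And>n. 2 * L $ n = (F ^ 2) $ n - 2 ^ n * F $ n"
    and x: "even_upto_6 x" "x $ 0 = 0" "x $ 2 = 3600 * \<gamma>" "x $ 4 = 1080000 * \<gamma>\<^sup>2" "x $ 6 = 129600000 * \<gamma> ^ 3"
    and w: "even_form w" "even_series w = fps_const \<pi> * fps_X ^ 2" "\<pi> = 144 * (x1 - y1)"
  defines "M \<equiv> L + T - 2 + 5 * x\<^sup>2 + 3 * ((1 - F) * x)"
  shows "(A * ec * M) $ 6 = \<pi> * (even_series (form_series (fps_exp (1/24)) w) * A * ec
    - even_series (form_series (Abs_fps (\<lambda>k. 1 / (24 ^ (k + 1) * fact (k + 1)))) w) * A * ec * M) $ 4"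
proof -
  define Q where "Q = even_series (form_series (fps_exp (1/24)) w)"
  define Z where "Z = even_series (form_series (Abs_fps (\<lambda>k. 1 / (24 ^ (k + 1) * fact (k + 1)))) w)"
  define P where "P = even_series w"
  have P: "even_upto_6 P" "P $ 0 = 0" "P $ 2 = \<pi>" "P $ 4 = 0" "P $ 6 = 0"
    by (simp_all add: P_def w(2) even_upto_6_def)
  note series = form_series_coeffs[OF w(1) P(1,2)[unfolded P_def], folded P_def, unfolded P]
  note Q = series[where a = "fps_exp (1/24)", folded Q_def]
  note Z = series[where a = "Abs_fps (\<lambda>k. 1 / (24 ^ (k + 1) * fact (k + 1)))", folded Z_def]
  \<comment> \<open>These are the coefficients of Q = 1 + P Z: the shift \<open>k + 1\<close> in the
    series defining \<open>Z\<close> is the division of exp (p/24) - 1 by p.\<close>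
  have Q': "Q $ 0 = 1" "Q $ 2 = \<pi> * Z $ 0" "Q $ 4 = \<pi> * Z $ 2" "Q $ 6 = \<pi> * Z $ 4"
    by (simp_all add: Q Z econst_hom fact_numeral power2_eq_square power3_eq_cube power_numeral_reduce ac_simps)
  have Q'': "Q $ 2 = 6 * (x1 - y1)" "Q $ 4 = 18 * (x1 - y1)\<^sup>2" "Q $ 6 = 36 * (x1 - y1) ^ 3"
    by (simp_all add: Q w(3) fact_numeral power_divide power_mult_distrib econst_times_numeral econst_numeral
        del: right_diff_distrib_numeral)
  have "(Q * A * (M - P) * ec) $ 6 = 0"
    unfolding M_def
    by (rule anomaly_coefficient[OF Q(1) Q'(1) Q'' A ec T F virtual_square_coeffs[OF F L] x P(1,2) _ P(4,5)])
      (simp add: P w(3))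
  moreover have "Q * A * (M - P) * ec = Q * (A * ec * M) - P * (Q * A * ec)"
    by (simp add: algebra_simps)
  ultimately have "(Q * (A * ec * M)) $ 6 = (P * (Q * A * ec)) $ 6" by simp
  then have "(A * ec * M) $ 6 + \<pi> * (Z * (A * ec * M)) $ 4 = \<pi> * (Q * A * ec) $ 4"
    unfolding even_upto_6_mult_nth(4)[OF Q(1)] even_upto_6_mult_nth(4)[OF P(1)]
      even_upto_6_mult_nth(3)[OF Z(1)] P Q'
    by (simp add: algebra_simps)
  then show ?thesis
    unfolding Q_def[symmetric] Z_def[symmetric] by (simp add: algebra_simps)
qed

lemma deg_part_12: "deg_part 12 \<omega> = Rep (even_series \<omega> $ 6)" and deg_part_8: "deg_part 8 \<omega> = Rep (even_series \<omega> $ 4)"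
  by (simp_all add: Rep_even_series)

theorem corollary1:
  fixes X :: "('x, 'm::real_normed_vector) mfd"
    and B :: "('b, 'k::real_normed_vector) mfd"
    and Z :: "('z, 'f::real_normed_vector) mfd"
    and \<pi> :: "'x \<Rightarrow> 'b"
    and g :: "'x \<Rightarrow> 'm \<Rightarrow> 'm \<Rightarrow> real"
    and nabla :: "'x \<Rightarrow> 'm \<Rightarrow> ('x \<Rightarrow> 'm) \<Rightarrow> 'm"
    and TZ :: "('x, 'm, 'm) rbundle"
    and F\<^sub>1 :: "('x, 'm, 'v::real_vector) rbundle"
    and F\<^sub>2 :: "('x, 'm, 'w::real_vector) rbundle"
    and \<xi> :: "('x, 'm, 'u::real_vector) rbundle"
    and pos :: "'x \<Rightarrow> ('u \<times> 'u) set"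
  assumes "fiber_bundle X B Z \<pi>" and "mfd_dim Z = 10"
    and "TZ = vertical_bundle X B Z \<pi> g nabla" and "levi_civita_vertical X TZ"
    and "euclidean_bundle_conn X F\<^sub>1"
    and "euclidean_bundle_conn X F\<^sub>2"
    and "euclidean_bundle_conn X \<xi>" and "oriented_rank2 X \<xi> pos"
    and "int (rk F\<^sub>1) - int (rk F\<^sub>2) = 32"
  shows
    "let F1 = complexify X F\<^sub>1; F2 = complexify X F\<^sub>2; T = complexify X TZ;
         rxi = vreduced X (complexify X \<xi>);
         V = vtrivial X 1 - frag_of F1 + frag_of F2;
         D = frag_of (ext2 F1) + frag_of (sym2 F2) - frag_of (tensor F1 F2) + frag_of T - vtrivial X 2;
         C = D + frag_cmul 5 (rxi \<otimes>\<^sub>v rxi) + frag_cmul 3 (V \<otimes>\<^sub>v rxi);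
         quot = Abs_fps (\<lambda>k. 1 / (24 ^ (k + 1) * fact (k + 1)))
     in (\<forall>x\<in>pts X.
           let A = ahat X TZ x;
               ec = form_series (fps_exp (1/2)) (euler2 X \<xi> pos x);
               p = pont1 X TZ x - pont1 X F\<^sub>1 x + pont1 X F\<^sub>2 x
           in deg_part 12 (A * ec * ch X (frag_of (ext2 F1)) x)
              + deg_part 12 (A * ec * ch X (frag_of (sym2 F2)) x)
              - deg_part 12 (A * ec * ch X (frag_of (tensor F1 F2)) x)
              + deg_part 12 (A * ec * ch X (frag_of T) x)
              - 2 * deg_part 12 (A * ec)
              + 5 * deg_part 12 (A * ec * ch X (rxi \<otimes>\<^sub>v rxi) x)
              + 3 * deg_part 12 (A * ec * ch X (V \<otimes>\<^sub>v rxi) x)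
              = p * deg_part 8 (- (form_series quot p * A * ec * ch X C x)
                                + form_series (fps_exp (1/24)) p * A * ec))
        \<and> (trivial_bundle X \<xi> \<longrightarrow>
           (\<forall>x\<in>pts X.
              let A = ahat X TZ x;
                  p = pont1 X TZ x - pont1 X F\<^sub>1 x + pont1 X F\<^sub>2 x
              in deg_part 12 (A * ch X (frag_of (ext2 F1)) x)
                 + deg_part 12 (A * ch X (frag_of (sym2 F2)) x)
                 - deg_part 12 (A * ch X (frag_of (tensor F1 F2)) x)
                 + deg_part 12 (A * ch X (frag_of T) x)
                 - 2 * deg_part 12 A
                 = p * deg_part 8 (- (form_series quot p * A * ch X D x)
                                   + form_series (fps_exp (1/24)) p * A)))"
proof -
  define F1 where "F1 = complexify X F\<^sub>1"
  define F2 where "F2 = complexify X F\<^sub>2"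
  define T where "T = complexify X TZ"
  define rxi where "rxi = vreduced X (complexify X \<xi>)"
  define V where "V = vtrivial X 1 - frag_of F1 + frag_of F2"
  define D where "D = frag_of (ext2 F1) + frag_of (sym2 F2) - frag_of (tensor F1 F2) + frag_of T - vtrivial X 2"
  define C where "C = D + frag_cmul 5 (rxi \<otimes>\<^sub>v rxi) + frag_cmul 3 (V \<otimes>\<^sub>v rxi)"
  define quot :: "complex fps" where "quot = Abs_fps (\<lambda>k. 1 / (24 ^ (k + 1) * fact (k + 1)))"
  have manifold: "smooth_manifold X"
    using assms(1) by (simp add: fiber_bundle_def)
  have rk_TZ: "rk TZ = 10"
    using assms(2,3) by (simp add: vertical_bundle_def)
  have eucl_TZ: "euclidean_bundle_conn X TZ"
    using assms(4) by (simp add: levi_civita_vertical_def)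
  have rk_xi: "rk \<xi> = 2"
    using assms(8) by (simp add: oriented_rank2_def)
  {
    fix x assume x: "x \<in> pts X"
    interpret T: framed_point X TZ x by unfold_locales (fact manifold eucl_TZ x)+
    interpret F1: framed_point X F\<^sub>1 x by unfold_locales (fact manifold assms(5) x)+
    interpret F2: framed_point X F\<^sub>2 x by unfold_locales (fact manifold assms(6) x)+
    interpret xi: framed_point X \<xi> x by unfold_locales (fact manifold assms(7) x)+
    define A where "A = ahat X TZ x"
    define p where "p = pont1 X TZ x - pont1 X F\<^sub>1 x + pont1 X F\<^sub>2 x"
    define GA where "GA = even_series A"
    define GT where "GT = ch_series X T x"
    define GF where "GF = ch_series X F1 x - ch_series X F2 x"
    define GL where "GL = ch_series X (ext2 F1) x + ch_series X (sym2 F2) x - ch_series X F1 x * ch_series X F2 x"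
    define Gx where "Gx = ch_series X (complexify X \<xi>) x - 2"
    define q where "q = 144 * (T.s1 - (F1.s1 - F2.s1))"
    note reg = T.regular F1.regular F2.regular xi.regular
    have A_even: "even_form A" by (simp add: A_def T.even_form_ahat)
    have p_even: "even_form p"
      unfolding p_def by (intro even_form_intros T.even_form_pont1 F1.even_form_pont1 F2.even_form_pont1)
    have even_series_p: "even_series p = fps_const q * fps_X ^ 2"
      by (simp add: p_def q_def even_series_add even_series_diff T.even_series_pont1 F1.even_series_pont1 F2.even_series_pont1 algebra_simps
          flip: fps_const_add fps_const_sub)
    \<comment> \<open>\<open>p\<close> is homogeneous of degree 4, hence equal to its single
      coefficient; the outer factor \<open>p\<close> of the claim can then be moved into the
      coefficient ring.\<close>
    have Rep_p: "p = Rep q"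
    proof (rule even_form_eqI[OF p_even even_form_Rep])
      have "Rep q = deg_part (2 * 2) p" using Rep_even_series[of p 2] by (simp add: even_series_p)
      then show "even_series p = even_series (Rep q)" by (simp only: even_series_deg_part_even) (simp add: even_series_p)
    qed
    note GA = T.ahat_coeffs[folded A_def, folded GA_def]
    note GT = T.ch_series_coeffs[folded T_def, folded GT_def, unfolded rk_TZ of_nat_numeral]
    have GF: "even_upto_6 GF" "GF $ 0 = 32" "GF $ 2 = 144 * (F1.s1 - F2.s1)" "GF $ 4 = 240 * (F1.s2 - F2.s2)"
      "GF $ 6 = 504 * (F1.s3 - F2.s3)"
    proof -
      have "rk F\<^sub>1 = rk F\<^sub>2 + 32" using assms(9) by linarith
      then show "GF $ 0 = 32"
        by (simp add: GF_def F1_def F2_def F1.ch_series_coeffs F2.ch_series_coeffs)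
    qed (simp_all add: GF_def F1_def F2_def F1.ch_series_coeffs F2.ch_series_coeffs even_upto_6_intros)
    \<comment> \<open>\<open>GL\<close> is the Chern character of the exterior square of the virtual
      bundle \<open>F\<^sub>1 - F\<^sub>2\<close>: passing to the negative of a bundle exchanges
      exterior and symmetric squares.\<close>
    have GL: "2 * GL $ n = (GF ^ 2) $ n - 2 ^ n * GF $ n" for n
    proof -
      have "2 * GL $ n = 2 * ch_series X (ext2 F1) x $ n + 2 * ch_series X (sym2 F2) x $ n - 2 * (ch_series X F1 x * ch_series X F2 x) $ n"
        by (simp add: GL_def algebra_simps)
      also have "\<dots> = (ch_series X F1 x ^ 2) $ n + (ch_series X F2 x ^ 2) $ n - (2 * (ch_series X F1 x * ch_series X F2 x)) $ n - 2 ^ n * GF $ n"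
        unfolding F1_def F2_def ch_series_ext2[OF reg(2)] ch_series_sym2[OF reg(3)] fps_numeral_mult_nth
        by (simp add: GF_def F1_def F2_def algebra_simps)
      also have "(ch_series X F1 x ^ 2) $ n + (ch_series X F2 x ^ 2) $ n - (2 * (ch_series X F1 x * ch_series X F2 x)) $ n = (GF ^ 2) $ n"
        by (simp add: GF_def power2_diff mult.assoc)
      finally show ?thesis .
    qed
    note Gx = xi.reduced_rank_2_coeffs(1,2)[OF rk_xi, folded Gx_def]
      xi.reduced_rank_2_coeffs(3-5)[OF rk_xi, of pos, folded Gx_def]
    have card: "card (idx (complexify X \<xi>)) = 2" by (simp add: complexify_def rk_xi)
    have ch_vseries_D: "ch_vseries X D x = GL + GT - 2"
      by (simp add: D_def ch_vseries_simps GL_def GT_def F1_def F2_def ch_series_tensor reg)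
    have ch_vseries_rxi: "ch_vseries X (frag_of E \<otimes>\<^sub>v rxi) x = ch_series X E x * Gx" if "regular_at X E x" for E
      unfolding rxi_def using ch_vseries_of_vtensor_reduced[OF that reg(4)] by (simp add: card Gx_def)
    have ch_vseries_xx: "ch_vseries X (rxi \<otimes>\<^sub>v rxi) x = Gx\<^sup>2"
    proof -
      \<comment> \<open>The left factor alone is expanded, so that \<open>ch_vseries_rxi\<close>
        applies to each summand.\<close>
      have eq: "rxi \<otimes>\<^sub>v rxi = frag_of (complexify X \<xi>) \<otimes>\<^sub>v rxi - frag_cmul 2 (frag_of (trivial_line X) \<otimes>\<^sub>v rxi)"
        by (subst rxi_def) (simp add: vreduced_def card vtrivial_def vtensor_simps)
      show ?thesis
        by (simp only: eq ch_vseries_simps ch_vseries_rxi reg regular_at_trivial_line ch_series_trivial_line)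
          (simp add: Gx_def power2_eq_square algebra_simps)
    qed
    have ch_vseries_Vx: "ch_vseries X (V \<otimes>\<^sub>v rxi) x = (1 - GF) * Gx"
      by (simp add: V_def vtrivial_def vtensor_simps ch_vseries_simps ch_vseries_rxi reg regular_at_trivial_line
          ch_series_trivial_line GF_def F1_def F2_def algebra_simps)
    have ch_vseries_C: "ch_vseries X C x = GL + GT - 2 + 5 * Gx\<^sup>2 + 3 * ((1 - GF) * Gx)"
      by (simp add: C_def ch_vseries_simps ch_vseries_D ch_vseries_xx ch_vseries_Vx)
    \<comment> \<open>The open premises concern exp (c/2) and the reduced \<xi>; the two formulas
      fill them differently.\<close>
    note ident = anomaly_identity[OF GA _ _ _ _ GT GF GL _ _ _ _ _ p_even even_series_p q_def]
    define ec where "ec = form_series (fps_exp (1/2)) (euler2 X \<xi> pos x)"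
    note ec = xi.exp_euler2_coeffs[of pos, folded ec_def]
    have ident1: "(GA * even_series ec * ch_vseries X C x) $ 6
        = q * (even_series (form_series (fps_exp (1/24)) p) * GA * even_series ec - even_series (form_series quot p) * GA * even_series ec * ch_vseries X C x) $ 4"
      unfolding ch_vseries_C quot_def by (rule ident[OF ec(2-5) Gx])
    have ident2: "(GA * ch_vseries X D x) $ 6
        = q * (even_series (form_series (fps_exp (1/24)) p) * GA - even_series (form_series quot p) * GA * ch_vseries X D x) $ 4"
      unfolding ch_vseries_D quot_def
      \<comment> \<open>The series of exp (c/2) becomes 1, while c^2 and the Chern character of the
        reduced \<xi> become 0.\<close>
      using ident[of 1 0 0] by (simp add: even_upto_6_def)
    have p_mult: "p * deg_part 8 \<omega> = Rep (q * even_series \<omega> $ 4)" for \<omega>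
      by (simp add: deg_part_8 Rep_simps flip: Rep_p)
    note even_series_simps = even_series_add even_series_diff even_series_uminus even_series_times even_form_times even_form_intros even_form_series
      A_even p_even ec(1)
    have e1: "deg_part 12 (A * ec * ch X (frag_of (ext2 F1)) x)
        + deg_part 12 (A * ec * ch X (frag_of (sym2 F2)) x)
        - deg_part 12 (A * ec * ch X (frag_of (tensor F1 F2)) x)
        + deg_part 12 (A * ec * ch X (frag_of T) x)
        - 2 * deg_part 12 (A * ec)
        + 5 * deg_part 12 (A * ec * ch X (rxi \<otimes>\<^sub>v rxi) x)
        + 3 * deg_part 12 (A * ec * ch X (V \<otimes>\<^sub>v rxi) x)
      = p * deg_part 8 (- (form_series quot p * A * ec * ch X C x)
          + form_series (fps_exp (1/24)) p * A * ec)" (is "?lhs = p * deg_part 8 ?\<omega>")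
    proof -
      have even_series12: "deg_part 12 (A * ec * ch X W x) = Rep ((GA * even_series ec * ch_vseries X W x) $ 6)"
        "deg_part 12 (A * ec) = Rep ((GA * even_series ec) $ 6)" for W
        by (simp_all add: deg_part_12 even_series_simps GA_def ch_vseries_def)
      have "?lhs = Rep ((GA * even_series ec * ch_vseries X C x) $ 6)"
      proof -
        have "GA * even_series ec * ch_vseries X C x = GA * even_series ec * ch_vseries X (frag_of (ext2 F1)) x
            + GA * even_series ec * ch_vseries X (frag_of (sym2 F2)) x - GA * even_series ec * ch_vseries X (frag_of (tensor F1 F2)) x
            + GA * even_series ec * ch_vseries X (frag_of T) x - 2 * (GA * even_series ec)
            + 5 * (GA * even_series ec * ch_vseries X (rxi \<otimes>\<^sub>v rxi) x) + 3 * (GA * even_series ec * ch_vseries X (V \<otimes>\<^sub>v rxi) x)"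
          by (simp add: C_def D_def ch_vseries_simps algebra_simps)
        then show ?thesis
          by (simp only: even_series12 fps_add_nth fps_sub_nth fps_numeral_mult_nth Rep_simps Rep_numeral)
      qed
      also have "\<dots> = p * deg_part 8 ?\<omega>"
        unfolding p_mult ident1 by (simp add: even_series_simps GA_def ch_vseries_def)
      finally show ?thesis .
    qed
    have e2: "deg_part 12 (A * ch X (frag_of (ext2 F1)) x)
        + deg_part 12 (A * ch X (frag_of (sym2 F2)) x)
        - deg_part 12 (A * ch X (frag_of (tensor F1 F2)) x)
        + deg_part 12 (A * ch X (frag_of T) x)
        - 2 * deg_part 12 A
      = p * deg_part 8 (- (form_series quot p * A * ch X D x)
          + form_series (fps_exp (1/24)) p * A)" (is "?lhs = p * deg_part 8 ?\<omega>")
    proof -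
      have even_series12: "deg_part 12 (A * ch X W x) = Rep ((GA * ch_vseries X W x) $ 6)"
        "deg_part 12 A = Rep (GA $ 6)" for W
        by (simp_all add: deg_part_12 even_series_simps GA_def ch_vseries_def)
      have "?lhs = Rep ((GA * ch_vseries X D x) $ 6)"
      proof -
        have "GA * ch_vseries X D x = GA * ch_vseries X (frag_of (ext2 F1)) x
            + GA * ch_vseries X (frag_of (sym2 F2)) x - GA * ch_vseries X (frag_of (tensor F1 F2)) x
            + GA * ch_vseries X (frag_of T) x - 2 * GA"
          by (simp add: D_def ch_vseries_simps algebra_simps)
        then show ?thesis
          by (simp only: even_series12 fps_add_nth fps_sub_nth fps_numeral_mult_nth Rep_simps Rep_numeral)
      qed
      also have "\<dots> = p * deg_part 8 ?\<omega>"
        unfolding p_mult ident2 by (simp add: even_series_simps GA_def ch_vseries_def)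
      finally show ?thesis .
    qed
    note conjI[OF e1[unfolded A_def p_def ec_def] e2[unfolded A_def p_def]]
  } note * = this
  show ?thesis
    unfolding Let_def
    unfolding F1_def[symmetric] F2_def[symmetric] T_def[symmetric] rxi_def[symmetric]
    unfolding V_def[symmetric] D_def[symmetric] quot_def[symmetric]
    unfolding C_def[symmetric]
    by (intro conjI ballI impI) (erule *[THEN conjunct1], erule *[THEN conjunct2])
qed

end
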